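(* Let $\mu,r\in\mathbb R$, $\xi>0$, $\rho\in[-1,1]$, $h>0$, $c=\mu-\frac{\xi^2}{4}$, and let $X_t\in\mathbb R$, $V_t>0$ be given. Consider the Hull-White stochastic volatility model $$dX_t=\left(r-\tfrac{V_t}{2}\right)dt+\sqrt{V_t}\left(\rho\,dW_t+\sqrt{1-\rho^2}\,dW^\perp_t\right),\qquad dV_t=\mu V_t\,dt+\xi V_t\,dW_t,$$ with $W,W^\perp$ independent Brownian motions, split into the two systems $$\text{(1)}\quad dX^{(1)}_t=\left(r-\tfrac{V_t^{(1)}}{2}\right)dt+\sqrt{1-\rho^2}\sqrt{V_t^{(1)}}\,dW_t^\perp,\qquad dV^{(1)}_t=\left(\mu-\tfrac{\xi^2}{4}\right)V_t^{(1)}\,dt,$$ $$\text{(2)}\quad dX_t^{(2)}=\rho\sqrt{V_t^{(2)}}\,dW_t,\qquad dV_t^{(2)}=\tfrac{\xi^2}{4}V_t^{(2)}\,dt+\xi V_t^{(2)}\,dW_t .$$ Let $(X^{\mathrm{split}}_{t+h},V^{\mathrm{split}}_{t+h})$ be the result of one step of the second-order (Strang) operator splitting scheme started from $(X_t,V_t)$: evolve by system (1) for time $h/2$, then by system (2) for time $h$, then by system (1) for time $h/2$. Then, in distribution given $(X_t,V_t)$, $$X_{t+h}^{\mathrm{split}}=X_t+rh-\tfrac12\tilde I_t^h+\tfrac{2\rho}{\xi}\left(\sqrt{\hat V^{(2)}_{t+h}}-\sqrt{\tilde V^{(1)}_{t+h/2}}\right)+N\!\left(0,(1-\rho^2)\tilde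 I_t^h\right),\qquad V_{t+h}^{\mathrm{split}}=e^{ch/2}\hat V^{(2)}_{t+h},$$ where $\tilde V^{(1)}_{t+h/2}=e^{ch/2}V_t$, $\hat V^{(2)}_{t+h}=\tilde V^{(1)}_{t+h/2}e^{-\frac{\xi^2}{4}h+\xi\Delta W_t^h}$ with $\Delta W_t^h\sim N(0,h)$, and $$\tilde I_t^h=\begin{cases}\dfrac{V_t+\hat V^{(2)}_{t+h}}{c}\left(e^{ch/2}-1\right),&c\ne0,\\[2mm]\dfrac{(V_t+\hat V^{(2)}_{t+h})h}{2},&c=0.\end{cases}$$
   Context: $N(0,s)$ denotes a normal random variable with mean $0$ and variance $s$; when $s$ is random it is, conditionally on $\hat V^{(2)}_{t+h}$, normal with that variance. In the splitting scheme the three successive evolutions use mutually independent Brownian increments, the output of each evolution being the initial state for the next one. *)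

theory Defs
  imports "HOL-Probability.Probability"
begin

section \<open>Brownian motion and the Ito integral\<close>

text \<open>Normal law with variance \<open>s \<ge> 0\<close>; the library's \<open>normal_density\<close> is parametrised by the
  standard deviation and is meaningful only for \<open>s > 0\<close>. The Dirac case is needed since the variance
  \<open>(1 - \<rho>\<^sup>2) I\<close> vanishes for \<open>\<bar>\<rho>\<bar> = 1\<close>.\<close>

definition normal_law :: "real \<Rightarrow> real \<Rightarrow> real measure" where
  "normal_law m s =
     (if s = 0 then return borel m else density lborel (\<lambda>x. ennreal (normal_density m (sqrt s) x)))"

text \<open>Only the times \<open>t \<ge> 0\<close> matter; filtrations are indexed by all reals so that the library's
  locale \<open>filtration\<close> applies (one may take \<open>F t = F 0\<close> for \<open>t < 0\<close>).\<close>

definition filtered_prob_space :: "'a measure \<Rightarrow> (real \<Rightarrow> 'a measure) \<Rightarrow> bool" where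
  "filtered_prob_space M F \<longleftrightarrow>
     prob_space M \<and> filtration (space M) F \<and> (\<forall>t. subalgebra M (F t))"

definition brownian_motion ::
    "'a measure \<Rightarrow> (real \<Rightarrow> 'a measure) \<Rightarrow> (real \<Rightarrow> 'a \<Rightarrow> real) \<Rightarrow> bool" where
  "brownian_motion M F W \<longleftrightarrow>
     filtered_prob_space M F \<and>
     (AE \<omega> in M. W 0 \<omega> = 0) \<and>
     (AE \<omega> in M. continuous_on {0..} (\<lambda>t. W t \<omega>)) \<and>
     (\<forall>t\<ge>0. W t \<in> borel_measurable (F t)) \<and>
     (\<forall>s t. 0 \<le> s \<and> s < t \<longrightarrow>
        distr M borel (\<lambda>\<omega>. W t \<omega> - W s \<omega>) = normal_law 0 (t - s) \<and>
        prob_space.indep_set M (sets (F s))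
          (sets (vimage_algebra (space M) (\<lambda>\<omega>. W t \<omega> - W s \<omega>) borel)))"

text \<open>The triple \<open>(n, \<tau>, \<eta>)\<close> encodes \<open>\<Sum>i<n. \<eta> i \<sqdot> 1\<close> over the intervals from \<open>\<tau> i\<close> (excluded)
  to \<open>\<tau> (i + 1)\<close> (included).\<close>

type_synonym 'a simple_integrand = "nat \<times> (nat \<Rightarrow> real) \<times> (nat \<Rightarrow> 'a \<Rightarrow> real)"

fun simple_predictable :: "(real \<Rightarrow> 'a measure) \<Rightarrow> real \<Rightarrow> 'a simple_integrand \<Rightarrow> bool" where
  "simple_predictable F T (n, \<tau>, \<eta>) \<longleftrightarrow>
     0 \<le> \<tau> 0 \<and> (\<forall>i<n. \<tau> i \<le> \<tau> (Suc i)) \<and> \<tau> n \<le> T \<and>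
     (\<forall>i<n. \<eta> i \<in> borel_measurable (F (\<tau> i)) \<and> (\<exists>C. \<forall>\<omega>\<in>space (F (\<tau> i)). \<bar>\<eta> i \<omega>\<bar> \<le> C))"

fun simple_value :: "'a simple_integrand \<Rightarrow> real \<Rightarrow> 'a \<Rightarrow> real" where
  "simple_value (n, \<tau>, \<eta>) s \<omega> = (\<Sum>i<n. \<eta> i \<omega> * indicator {\<tau> i<..\<tau> (Suc i)} s)"

fun simple_integral_wrt :: "'a simple_integrand \<Rightarrow> (real \<Rightarrow> 'a \<Rightarrow> real) \<Rightarrow> 'a \<Rightarrow> real" where
  "simple_integral_wrt (n, \<tau>, \<eta>) W \<omega> = (\<Sum>i<n. \<eta> i \<omega> * (W (\<tau> (Suc i)) \<omega> - W (\<tau> i) \<omega>))"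

definition null_in_prob :: "'a measure \<Rightarrow> (nat \<Rightarrow> 'a \<Rightarrow> ennreal) \<Rightarrow> bool" where
  "null_in_prob M Y \<longleftrightarrow>
     (\<forall>\<epsilon>>0. (\<lambda>k. measure M {\<omega> \<in> space M. ennreal \<epsilon> < Y k \<omega>}) \<longlonglongrightarrow> 0)"

definition progressively_measurable ::
    "(real \<Rightarrow> 'a measure) \<Rightarrow> real \<Rightarrow> (real \<Rightarrow> 'a \<Rightarrow> real) \<Rightarrow> bool" where
  "progressively_measurable F T H \<longleftrightarrow>
     (\<forall>t\<in>{0..T}. (\<lambda>(s, \<omega>). H s \<omega>) \<in> borel_measurable (restrict_space borel {0..t} \<Otimes>\<^sub>M F t))"

text \<open>\<open>I\<close> is a version of the Ito integral of \<open>H\<close> with respect to \<open>W\<close> over \<open>[0, T]\<close>: the limit in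
  probability of the integrals of simple integrands whose squared distance to \<open>H\<close> in \<open>L\<^sup>2[0, T]\<close>
  tends to 0 in probability. Such a sequence exists iff \<open>\<integral> H\<^sup>2 < \<infinity>\<close> almost surely, and then \<open>I\<close> is
  unique up to null sets. Measurability of \<open>H\<close> is part of the definition, so \<open>null_in_prob\<close>
  never measures a non-measurable set.\<close>

definition has_ito_integral ::
    "'a measure \<Rightarrow> (real \<Rightarrow> 'a measure) \<Rightarrow> (real \<Rightarrow> 'a \<Rightarrow> real) \<Rightarrow> (real \<Rightarrow> 'a \<Rightarrow> real)
      \<Rightarrow> real \<Rightarrow> ('a \<Rightarrow> real) \<Rightarrow> bool" where
  "has_ito_integral M F W H T I \<longleftrightarrow>
     progressively_measurable F T H \<and> I \<in> borel_measurable M \<and>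
     (\<exists>S :: nat \<Rightarrow> 'a simple_integrand.
        (\<forall>k. simple_predictable F T (S k)) \<and>
        null_in_prob M (\<lambda>k \<omega>. \<integral>\<^sup>+s\<in>{0..T}. ennreal ((simple_value (S k) s \<omega> - H s \<omega>)\<^sup>2) \<partial>lborel) \<and>
        null_in_prob M (\<lambda>k \<omega>. ennreal \<bar>simple_integral_wrt (S k) W \<omega> - I \<omega>\<bar>))"

section \<open>Stochastic differential equations and Strang splitting\<close>

text \<open>Drift and diffusion coefficient of an autonomous system driven by one Brownian motion.\<close>

type_synonym 'b sde_system = "('b \<Rightarrow> 'b) \<times> ('b \<Rightarrow> 'b)"

text \<open>\<open>dZ = a(Z) dt + \<sigma>(Z) dW\<close> on \<open>[0, T]\<close> in integrated form, componentwise.\<close>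

fun sde_solution ::
    "'a measure \<Rightarrow> (real \<Rightarrow> 'a measure) \<Rightarrow> (real \<Rightarrow> 'a \<Rightarrow> real) \<Rightarrow> real
      \<Rightarrow> 'b::euclidean_space sde_system \<Rightarrow> (real \<Rightarrow> 'a \<Rightarrow> 'b) \<Rightarrow> bool" where
  "sde_solution M F W T (a, \<sigma>) Z \<longleftrightarrow>
     brownian_motion M F W \<and>
     (AE \<omega> in M. continuous_on {0..T} (\<lambda>t. Z t \<omega>)) \<and>
     (\<forall>t\<in>{0..T}. Z t \<in> borel_measurable (F t)) \<and>
     (AE \<omega> in M. set_integrable lborel {0..T} (\<lambda>s. a (Z s \<omega>))) \<and>
     (\<forall>t\<in>{0..T}. \<forall>b\<in>Basis.
        has_ito_integral M F W (\<lambda>s \<omega>. \<sigma> (Z s \<omega>) \<bullet> b) t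
          (\<lambda>\<omega>. (Z t \<omega> - Z 0 \<omega> - (LINT s:{0..t}|lborel. a (Z s \<omega>))) \<bullet> b))"

text \<open>\<open>R\<close> is the output of one Strang step of length \<open>h\<close> started from the deterministic state \<open>z\<close>. Each
  evolution runs on its own clock starting at 0, with its own filtration; the driver of an evolution
  is a Brownian motion for that filtration, hence independent of the initial state of the evolution.\<close>

definition strang_step ::
    "'a measure \<Rightarrow> real \<Rightarrow> 'b::euclidean_space sde_system \<Rightarrow> 'b sde_system \<Rightarrow> 'b \<Rightarrow> ('a \<Rightarrow> 'b) \<Rightarrow> bool"
  where
  "strang_step M h S1 S2 z R \<longleftrightarrow>
     (\<exists>(F :: nat \<Rightarrow> real \<Rightarrow> 'a measure) (B :: nat \<Rightarrow> real \<Rightarrow> 'a \<Rightarrow> real) (Z :: nat \<Rightarrow> real \<Rightarrow> 'a \<Rightarrow> 'b).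
        prob_space.indep_vars M (\<lambda>_. \<Pi>\<^sub>M t\<in>{0::real..}. (borel :: real measure))
          (\<lambda>k \<omega>. \<lambda>t\<in>{0..}. B k t \<omega>) {0, 1, 2} \<and>
        sde_solution M (F 0) (B 0) (h / 2) S1 (Z 0) \<and>
        sde_solution M (F 1) (B 1) h S2 (Z 1) \<and>
        sde_solution M (F 2) (B 2) (h / 2) S1 (Z 2) \<and>
        (AE \<omega> in M. Z 0 0 \<omega> = z) \<and>
        (AE \<omega> in M. Z 1 0 \<omega> = Z 0 (h / 2) \<omega>) \<and>
        (AE \<omega> in M. Z 2 0 \<omega> = Z 1 h \<omega>) \<and>
        R = Z 2 (h / 2))"

section \<open>The Hull-White stochastic volatility model\<close>

text \<open>States are pairs \<open>(x, v)\<close> of log-price and variance. Recall that \<open>sqrt v = - sqrt (- v)\<close> for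
  \<open>v < 0\<close>, so all coefficients are total and continuous.\<close>

definition hw_drift :: "real \<Rightarrow> real \<Rightarrow> real \<times> real \<Rightarrow> real \<times> real" where
  "hw_drift \<mu> r = (\<lambda>(x, v). (r - v / 2, \<mu> * v))"

definition hw_diffusion :: "real \<Rightarrow> real \<Rightarrow> real \<times> real \<Rightarrow> real \<times> real" where
  "hw_diffusion \<xi> \<rho> = (\<lambda>(x, v). (\<rho> * sqrt v, \<xi> * v))"

definition hw_diffusion_perp :: "real \<Rightarrow> real \<times> real \<Rightarrow> real \<times> real" where
  "hw_diffusion_perp \<rho> = (\<lambda>(x, v). (sqrt (1 - \<rho>\<^sup>2) * sqrt v, 0))"

text \<open>System (1) is driven by \<open>W\<^sup>\<bottom>\<close>, system (2) by \<open>W\<close>.\<close>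

definition hw_system1 :: "real \<Rightarrow> real \<Rightarrow> real \<Rightarrow> real \<Rightarrow> (real \<times> real) sde_system" where
  "hw_system1 \<mu> r \<xi> \<rho> =
     (\<lambda>(x, v). (r - v / 2, (\<mu> - \<xi>\<^sup>2 / 4) * v),
      \<lambda>(x, v). (sqrt (1 - \<rho>\<^sup>2) * sqrt v, 0))"

definition hw_system2 :: "real \<Rightarrow> real \<Rightarrow> (real \<times> real) sde_system" where
  "hw_system2 \<xi> \<rho> =
     (\<lambda>(x, v). (0, \<xi>\<^sup>2 / 4 * v),
      \<lambda>(x, v). (\<rho> * sqrt v, \<xi> * v))"

lemma hw_splitting:
  "hw_drift \<mu> r z = fst (hw_system1 \<mu> r \<xi> \<rho>) z + fst (hw_system2 \<xi> \<rho>) z"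
  "hw_diffusion_perp \<rho> = snd (hw_system1 \<mu> r \<xi> \<rho>)"
  "hw_diffusion \<xi> \<rho> = snd (hw_system2 \<xi> \<rho>)"
  by (auto simp: hw_drift_def hw_diffusion_def hw_diffusion_perp_def hw_system1_def hw_system2_def
      algebra_simps split: prod.splits)

end

theory Submission
  imports Defs
begin

text \<open>By a Chebyshev bound with truncated coefficients, the Ito integral of a continuous adapted
  integrand is the limit in probability of its left Riemann sums on uniform grids, so an equation
  determines its solution through these sums. The variance equations are linear: the difference
  of a solution and of the explicit one has, once localised, a second moment that vanishes by a
  Gronwall estimate with an exponential weight. In system (2), the increments of \<open>sqrt V\<close> are
  \<open>\<xi> / 2 * sqrt V * \<Delta>W\<close> up to an error that is orthogonal over the grid, which gives \<open>X\<close> explicitly. In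
  system (1), \<open>V\<close> is an exponential and the stochastic integral in \<open>X\<close> is \<open>sqrt V\<^sub>0\<close> times a Wiener
  integral of a smooth function. The resulting \<open>B\<^sub>h\<close> and the two Wiener integrals depend on different
  Brownian paths, hence are independent.\<close>

section \<open>Centred normal laws\<close>

text \<open>A solution carries no moment bound, and its definition supplies, for each time
  separately, only some approximating sequence of simple integrands. Hence identities come from
  uniqueness of limits in probability along one common family of Riemann sums, and second moments
  are taken only after truncation. Localisation works without stopping times: an indicator of an
  event in \<open>F t\<close> that shrinks with \<open>t\<close>, up to null sets, keeps
  coefficients adapted and leaves the sums unchanged on that event.

  The variances come before the log-prices, because only then are the integrands
  \<open>sqrt V\<close> explicit. The drift \<xi>^2/4 of system (2) is exactly the one for which
  \<open>sqrt V\<close> has no drift: d sqrt V = (\<xi>/2) sqrt V dW, whence the factor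
  2\<rho>/\<xi>.

  The first half step leaves a deterministic variance, the last one starts from the random V2. Given
  V2, the two Wiener integrals are independent with common variance A, the integral of e^(cs) over
  [0, h/2], and have coefficients sqrt(1-\<rho>^2) sqrt(V_t) and sqrt(1-\<rho>^2) sqrt(V2). Their
  variances add up to (1-\<rho>^2)(V_t + V2) A, which is the stated variance for c = 0 as for c
  nonzero.\<close>

lemma normal_law_std: "normal_law 0 1 = density lborel (\<lambda>x. ennreal (std_normal_density x))"
  by (simp add: normal_law_def)

lemma prob_space_std_normal: "prob_space (normal_law 0 1)"
  by (simp add: normal_law_std prob_space_normal_density)

lemma sets_normal_law [simp, measurable_cong]: "sets (normal_law m s) = sets borel"
  by (simp add: normal_law_def)

lemma space_normal_law [simp]: "space (normal_law m s) = UNIV"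
  by (simp add: normal_law_def)

text \<open>Scaling a standard normal variable covers the Dirac case \<open>s = 0\<close> as well,
  so moments and characteristic functions need no case distinction later. The absolute value makes
  the identity hold for every real \<open>s\<close>: the density depends only on the square of its
  scale parameter, and \<open>sqrt s\<close> squares to \<open>\<bar>s\<bar>\<close>. This matters
  where a variance is a function of a variable that ranges over all reals.\<close>

lemma normal_law_eq_distr:
  "normal_law 0 s = distr (normal_law 0 1) borel (\<lambda>z. sqrt \<bar>s\<bar> * z)"
proof (cases "s = 0")
  case True
  then show ?thesis
    using prob_space.distr_const[OF prob_space_std_normal, of "0::real" borel] by (simp add: normal_law_def[of 0 0])
next
  case False
  interpret prob_space "normal_law 0 1" by (rule prob_space_std_normal)
  have "distributed (normal_law 0 1) lborel (\<lambda>z. z) (normal_density 0 1)"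
    by (auto simp: distributed_def normal_law_std distr_id2 intro!: distr_id2)
  then have "distributed (normal_law 0 1) lborel (\<lambda>z. 0 + sqrt \<bar>s\<bar> * z)
      (normal_density (0 + sqrt \<bar>s\<bar> * 0) (\<bar>sqrt \<bar>s\<bar>\<bar> * 1))"
    by (rule normal_density_affine) (use False in auto)
  moreover have "normal_density 0 (sqrt \<bar>s\<bar>) = normal_density 0 (sqrt s)"
  proof -
    have "(sqrt \<bar>s\<bar>)\<^sup>2 = (sqrt s)\<^sup>2"
      by (simp add: power2_eq_square real_sqrt_mult[symmetric])
    then show ?thesis by (simp add: normal_density_def fun_eq_iff)
  qed
  ultimately have "distr (normal_law 0 1) lborel (\<lambda>z. sqrt \<bar>s\<bar> * z) = normal_law 0 s"
    using False by (simp add: distributed_def normal_law_def)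
  moreover have "distr (normal_law 0 1) lborel (\<lambda>z. sqrt \<bar>s\<bar> * z) = distr (normal_law 0 1) borel (\<lambda>z. sqrt \<bar>s\<bar> * z)"
    by (intro distr_cong) auto
  ultimately show ?thesis by simp
qed

lemma prob_space_normal_law: "prob_space (normal_law 0 s)"
  unfolding normal_law_eq_distr[of s]
  by (intro prob_space.prob_space_distr prob_space_std_normal) simp

lemma real_distribution_normal_law: "real_distribution (normal_law 0 s)"
  using prob_space_normal_law by (auto simp: real_distribution_def real_distribution_axioms_def)

lemma char_normal_law: "char (normal_law 0 s) \<theta> = exp (- complex_of_real (\<bar>s\<bar> * \<theta>\<^sup>2 / 2))"
proof -
  have "char (normal_law 0 s) \<theta> = char std_normal_distribution (sqrt \<bar>s\<bar> * \<theta>)"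
    unfolding normal_law_eq_distr[of s] normal_law_std
    by (simp add: char_def integral_distr mult_ac)
  also have "\<dots> = exp (- complex_of_real (\<bar>s\<bar> * \<theta>\<^sup>2 / 2))"
    by (simp add: char_std_normal_distribution power_mult_distrib exp_of_real[symmetric] flip: of_real_power)
  finally show ?thesis .
qed

section \<open>Moments of the standard normal law and of its exponential tilts\<close>

lemma std_normal_has_integral_iff:
  fixes f :: "real \<Rightarrow> real"
  assumes "f \<in> borel_measurable borel"
  shows "has_bochner_integral (normal_law 0 1) f x
    \<longleftrightarrow> has_bochner_integral lborel (\<lambda>z. std_normal_density z * f z) x"
  using assms by (simp add: has_bochner_integral_iff normal_law_std integral_density integrable_density)

lemma std_normal_first_moment: "has_bochner_integral (normal_law 0 1) (\<lambda>z. z) 0"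
  using std_normal_moment_odd[of 0] by (subst std_normal_has_integral_iff) auto

lemma std_normal_second_moment: "has_bochner_integral (normal_law 0 1) (\<lambda>z. z\<^sup>2) 1"
  using std_normal_moment_even[of 1] by (subst std_normal_has_integral_iff) auto

text \<open>Completing the square: the weight \<open>exp (\<beta> * z)\<close> moves the centre of
  the Gaussian to \<beta>, which turns exponential moments into moments of a shifted normal
  law.\<close>

lemma std_normal_density_tilt:
  "std_normal_density z * exp (\<beta> * z) = exp (\<beta>\<^sup>2 / 2) * normal_density \<beta> 1 z"
proof -
  have "exp (- z\<^sup>2 / 2) * exp (\<beta> * z) = exp (\<beta>\<^sup>2 / 2) * exp (- (z - \<beta>)\<^sup>2 / 2)"
    unfolding exp_add[symmetric] by (simp add: power2_eq_square algebra_simps diff_divide_distrib add_divide_distrib)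
  then show ?thesis by (simp add: normal_density_def)
qed

lemma std_normal_exp_moment: "has_bochner_integral (normal_law 0 1) (\<lambda>z. exp (\<beta> * z)) (exp (\<beta>\<^sup>2 / 2))"
proof -
  have "has_bochner_integral lborel (\<lambda>z. exp (\<beta>\<^sup>2 / 2) * normal_density \<beta> 1 z) (exp (\<beta>\<^sup>2 / 2) * 1)"
    by (intro has_bochner_integral_mult_right) (auto simp: has_bochner_integral_iff)
  then show ?thesis
    by (subst std_normal_has_integral_iff) (auto simp: std_normal_density_tilt)
qed

lemma std_normal_tilted_mean:
  "has_bochner_integral (normal_law 0 1) (\<lambda>z. z * exp (\<beta> * z)) (\<beta> * exp (\<beta>\<^sup>2 / 2))"
proof -
  have "has_bochner_integral lborel (\<lambda>z. exp (\<beta>\<^sup>2 / 2) * (normal_density \<beta> 1 z * z)) (exp (\<beta>\<^sup>2 / 2) * \<beta>)"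
    by (intro has_bochner_integral_mult_right normal_moment_nz_1) auto
  moreover have "std_normal_density z * (z * exp (\<beta> * z)) = exp (\<beta>\<^sup>2 / 2) * (normal_density \<beta> 1 z * z)" for z
    using std_normal_density_tilt[of z \<beta>] by (metis mult.assoc mult.commute)
  ultimately show ?thesis
    by (subst std_normal_has_integral_iff) (simp_all only: mult.commute[of _ "exp (\<beta>\<^sup>2 / 2)"], measurable)
qed

lemma has_bochner_integral_normal_law:
  fixes f :: "real \<Rightarrow> real"
  assumes "f \<in> borel_measurable borel"
    and "has_bochner_integral (normal_law 0 1) (\<lambda>z. f (sqrt s * z)) x" and "s \<ge> 0"
  shows "has_bochner_integral (normal_law 0 s) f x"
  using assms unfolding normal_law_eq_distr[of s]
  by (intro has_bochner_integral_distr) auto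

lemma normal_law_first_moment: "s \<ge> 0 \<Longrightarrow> has_bochner_integral (normal_law 0 s) (\<lambda>x. x) 0"
  using has_bochner_integral_mult_right[OF std_normal_first_moment, of "sqrt s"]
    has_bochner_integral_normal_law[of "\<lambda>x. x" s 0] by simp

lemma normal_law_second_moment: "s \<ge> 0 \<Longrightarrow> has_bochner_integral (normal_law 0 s) (\<lambda>x. x\<^sup>2) s"
  using has_bochner_integral_mult_right[OF std_normal_second_moment, of s]
    has_bochner_integral_normal_law[of "\<lambda>x. x\<^sup>2" s s] by (simp add: power_mult_distrib)

text \<open>The error of replacing the increment of the exponential martingale
  \<open>exp (\<alpha> W - \<alpha>\<^sup>2 t / 2)\<close> by its stochastic differential.\<close>

definition exp_remainder :: "real \<Rightarrow> real \<Rightarrow> real \<Rightarrow> real" where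
  "exp_remainder \<alpha> s x = exp (\<alpha> * x - \<alpha>\<^sup>2 * s / 2) - 1 - \<alpha> * x"

lemma measurable_exp_remainder [measurable]: "exp_remainder \<alpha> s \<in> borel_measurable borel"
  unfolding exp_remainder_def by measurable

text \<open>The normalised exponential has mean one and the linear term is centred. Zero mean is
  what makes these errors orthogonal over the cells of a grid.\<close>

lemma exp_remainder_mean:
  assumes "s \<ge> 0"
  shows "has_bochner_integral (normal_law 0 s) (exp_remainder \<alpha> s) 0"
proof (rule has_bochner_integral_normal_law)
  interpret prob_space "normal_law 0 1" by (rule prob_space_std_normal)
  define \<beta> where "\<beta> = \<alpha> * sqrt s"
  have b: "\<beta>\<^sup>2 = \<alpha>\<^sup>2 * s" using assms by (simp add: \<beta>_def power_mult_distrib)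
  have 1: "has_bochner_integral (normal_law 0 1) (\<lambda>z. 1::real) 1"
    using prob_space by (auto simp: has_bochner_integral_iff)
  have "has_bochner_integral (normal_law 0 1) (\<lambda>z. exp (- \<beta>\<^sup>2 / 2) * exp (\<beta> * z) - 1 - \<beta> * z)
     (exp (- \<beta>\<^sup>2 / 2) * exp (\<beta>\<^sup>2 / 2) - 1 - \<beta> * 0)"
    by (intro has_bochner_integral_diff has_bochner_integral_mult_right std_normal_exp_moment
        std_normal_first_moment 1)
  moreover have "exp (- \<beta>\<^sup>2 / 2) * exp (\<beta>\<^sup>2 / 2) - 1 - \<beta> * 0 = 0"
    by (simp add: exp_add[symmetric])
  moreover have "exp (- \<beta>\<^sup>2 / 2) * exp (\<beta> * z) - 1 - \<beta> * z = exp_remainder \<alpha> s (sqrt s * z)" for z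
    by (simp add: exp_remainder_def b[symmetric] exp_add[symmetric]) (simp add: \<beta>_def mult_ac)
  ultimately show "has_bochner_integral (normal_law 0 1) (\<lambda>z. exp_remainder \<alpha> s (sqrt s * z)) 0"
    by simp
qed (use assms in auto)

text \<open>With y = \<alpha>^2 s the value e^y - 1 - y is of order s^2. Over n cells of length T/n
  the orthogonal errors therefore have total variance of order 1/n, which is why they disappear in
  the limit.\<close>

lemma exp_remainder_variance:
  assumes "s \<ge> 0"
  shows "has_bochner_integral (normal_law 0 s) (\<lambda>x. (exp_remainder \<alpha> s x)\<^sup>2) (exp (\<alpha>\<^sup>2 * s) - 1 - \<alpha>\<^sup>2 * s)"
proof (rule has_bochner_integral_normal_law)
  interpret prob_space "normal_law 0 1" by (rule prob_space_std_normal)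
  define \<beta> where "\<beta> = \<alpha> * sqrt s"
  have b: "\<beta>\<^sup>2 = \<alpha>\<^sup>2 * s" using assms by (simp add: \<beta>_def power_mult_distrib)
  have 1: "has_bochner_integral (normal_law 0 1) (\<lambda>z. 1::real) 1"
    using prob_space by (auto simp: has_bochner_integral_iff)
  let ?e = "exp (- \<beta>\<^sup>2 / 2)"
  \<comment> \<open>The square of \<open>?e * exp (\<beta> * z) - 1 - \<beta> * z\<close>, expanded
    so that each term is a multiple of one of the moments above.\<close>
  let ?f = "\<lambda>z. ?e\<^sup>2 * exp ((2 * \<beta>) * z) + 1 + \<beta>\<^sup>2 * z\<^sup>2 - (2 * ?e) * exp (\<beta> * z)
      - (2 * \<beta> * ?e) * (z * exp (\<beta> * z)) + (2 * \<beta>) * z"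
  have I: "has_bochner_integral (normal_law 0 1) ?f
     (?e\<^sup>2 * exp ((2 * \<beta>)\<^sup>2 / 2) + 1 + \<beta>\<^sup>2 * 1 - (2 * ?e) * exp (\<beta>\<^sup>2 / 2)
      - (2 * \<beta> * ?e) * (\<beta> * exp (\<beta>\<^sup>2 / 2)) + (2 * \<beta>) * 0)"
    by (intro has_bochner_integral_diff has_bochner_integral_add has_bochner_integral_mult_right
        std_normal_exp_moment std_normal_first_moment std_normal_second_moment std_normal_tilted_mean 1)
  have e: "?e * exp (\<beta>\<^sup>2 / 2) = 1" "?e\<^sup>2 * exp ((2 * \<beta>)\<^sup>2 / 2) = exp (\<beta>\<^sup>2)"
    by (simp_all add: exp_add[symmetric] power_mult_distrib flip: exp_double)
  have V: "?e\<^sup>2 * exp ((2 * \<beta>)\<^sup>2 / 2) + 1 + \<beta>\<^sup>2 * 1 - (2 * ?e) * exp (\<beta>\<^sup>2 / 2)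
      - (2 * \<beta> * ?e) * (\<beta> * exp (\<beta>\<^sup>2 / 2)) + (2 * \<beta>) * 0 = exp (\<beta>\<^sup>2) - 1 - \<beta>\<^sup>2"
    using e by algebra
  have P: "?f z = (exp_remainder \<alpha> s (sqrt s * z))\<^sup>2" for z
  proof -
    have "exp_remainder \<alpha> s (sqrt s * z) = ?e * exp (\<beta> * z) - 1 - \<beta> * z"
      by (simp add: exp_remainder_def b[symmetric] exp_add[symmetric]) (simp add: \<beta>_def mult_ac)
    moreover have "exp ((2 * \<beta>) * z) = (exp (\<beta> * z))\<^sup>2"
      by (simp add: power2_eq_square exp_add[symmetric])
    ultimately show ?thesis by (simp only: power2_eq_square) (simp add: algebra_simps)
  qed
  show "has_bochner_integral (normal_law 0 1) (\<lambda>z. (exp_remainder \<alpha> s (sqrt s * z))\<^sup>2) (exp (\<alpha>\<^sup>2 * s) - 1 - \<alpha>\<^sup>2 * s)"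
    using I unfolding V P unfolding b .
qed (use assms in auto)

section \<open>Convergence in probability\<close>

text \<open>The mean of the truncated distance metrises convergence in probability. It is always
  finite, satisfies a triangle inequality, and lets dominated convergence apply without further
  integrability.\<close>

definition conv_prob :: "'a measure \<Rightarrow> (nat \<Rightarrow> 'a \<Rightarrow> real) \<Rightarrow> ('a \<Rightarrow> real) \<Rightarrow> bool" where
  "conv_prob M X Y \<longleftrightarrow> (\<forall>n. X n \<in> borel_measurable M) \<and> Y \<in> borel_measurable M \<and>
     (\<lambda>n. \<integral>\<omega>. min 1 \<bar>X n \<omega> - Y \<omega>\<bar> \<partial>M) \<longlonglongrightarrow> 0"

context prob_space
begin

lemma integrable_min_1_abs [simp]:
  "f \<in> borel_measurable M \<Longrightarrow> integrable M (\<lambda>\<omega>. min 1 \<bar>f \<omega> :: real\<bar>)"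
  by (rule integrable_const_bound[where B = 1]) auto

lemma conv_prob_AE:
  assumes [measurable]: "\<And>n. X n \<in> borel_measurable M" "Y \<in> borel_measurable M"
    and lim: "AE \<omega> in M. (\<lambda>n. X n \<omega>) \<longlonglongrightarrow> Y \<omega>"
  shows "conv_prob M X Y"
proof -
  have "(\<lambda>n. \<integral>\<omega>. min 1 \<bar>X n \<omega> - Y \<omega>\<bar> \<partial>M) \<longlonglongrightarrow> (\<integral>\<omega>. 0 \<partial>M)"
  proof (rule integral_dominated_convergence[where w = "\<lambda>_. 1"])
    show "AE \<omega> in M. (\<lambda>n. min 1 \<bar>X n \<omega> - Y \<omega>\<bar>) \<longlonglongrightarrow> 0"
      using lim
    proof eventually_elim
      case (elim \<omega>)
      then have "(\<lambda>n. min 1 \<bar>X n \<omega> - Y \<omega>\<bar>) \<longlonglongrightarrow> min 1 \<bar>Y \<omega> - Y \<omega>\<bar>"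
        by (intro tendsto_intros)
      then show ?case by simp
    qed
  qed auto
  then show ?thesis by (simp add: conv_prob_def)
qed

lemma conv_prob_squeeze:
  assumes "\<And>n. X n \<in> borel_measurable M" "Y \<in> borel_measurable M"
    and "\<And>n. (\<integral>\<omega>. min 1 \<bar>X n \<omega> - Y \<omega>\<bar> \<partial>M) \<le> b n" and "b \<longlonglongrightarrow> 0"
  shows "conv_prob M X Y"
proof -
  have "(\<lambda>n. \<integral>\<omega>. min 1 \<bar>X n \<omega> - Y \<omega>\<bar> \<partial>M) \<longlonglongrightarrow> 0"
  proof (rule tendsto_sandwich[of "\<lambda>_. 0" _ _ b])
    show "\<forall>\<^sub>F n in sequentially. 0 \<le> (\<integral>\<omega>. min 1 \<bar>X n \<omega> - Y \<omega>\<bar> \<partial>M)"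
      by (intro always_eventually allI integral_nonneg_AE) auto
  qed (use assms in auto)
  then show ?thesis using assms by (auto simp: conv_prob_def)
qed

lemma conv_prob_add:
  assumes "conv_prob M X Y" "conv_prob M X' Y'"
  shows "conv_prob M (\<lambda>n \<omega>. X n \<omega> + X' n \<omega>) (\<lambda>\<omega>. Y \<omega> + Y' \<omega>)"
proof (rule conv_prob_squeeze)
  have [measurable]: "X n \<in> borel_measurable M" "Y \<in> borel_measurable M"
     "X' n \<in> borel_measurable M" "Y' \<in> borel_measurable M" for n
    using assms by (auto simp: conv_prob_def)
  show "(\<integral>\<omega>. min 1 \<bar>X n \<omega> + X' n \<omega> - (Y \<omega> + Y' \<omega>)\<bar> \<partial>M)
      \<le> (\<integral>\<omega>. min 1 \<bar>X n \<omega> - Y \<omega>\<bar> \<partial>M) + (\<integral>\<omega>. min 1 \<bar>X' n \<omega> - Y' \<omega>\<bar> \<partial>M)" for n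
  proof (subst Bochner_Integration.integral_add[symmetric])
    show "(\<integral>\<omega>. min 1 \<bar>X n \<omega> + X' n \<omega> - (Y \<omega> + Y' \<omega>)\<bar> \<partial>M)
      \<le> (\<integral>\<omega>. min 1 \<bar>X n \<omega> - Y \<omega>\<bar> + min 1 \<bar>X' n \<omega> - Y' \<omega>\<bar> \<partial>M)"
      by (intro integral_mono Bochner_Integration.integrable_add integrable_min_1_abs) (auto simp: min_def)
  qed auto
  show "(\<lambda>n. (\<integral>\<omega>. min 1 \<bar>X n \<omega> - Y \<omega>\<bar> \<partial>M) + (\<integral>\<omega>. min 1 \<bar>X' n \<omega> - Y' \<omega>\<bar> \<partial>M)) \<longlonglongrightarrow> 0"
    using assms by (auto simp: conv_prob_def intro: tendsto_add_zero)
qed (use assms in \<open>auto simp: conv_prob_def intro!: borel_measurable_add borel_measurable_times\<close>)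

lemma conv_prob_cmult:
  assumes "conv_prob M X Y"
  shows "conv_prob M (\<lambda>n \<omega>. c * X n \<omega>) (\<lambda>\<omega>. c * Y \<omega> :: real)"
proof (rule conv_prob_squeeze)
  have [measurable]: "X n \<in> borel_measurable M" "Y \<in> borel_measurable M" for n
    using assms by (auto simp: conv_prob_def)
  show "(\<integral>\<omega>. min 1 \<bar>c * X n \<omega> - c * Y \<omega>\<bar> \<partial>M) \<le> (1 + \<bar>c\<bar>) * (\<integral>\<omega>. min 1 \<bar>X n \<omega> - Y \<omega>\<bar> \<partial>M)" for n
  proof (subst integral_mult_right_zero[symmetric], intro integral_mono)
    fix \<omega>
    have "\<bar>c * X n \<omega> - c * Y \<omega>\<bar> = \<bar>c\<bar> * \<bar>X n \<omega> - Y \<omega>\<bar>"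
      by (simp add: right_diff_distrib[symmetric] abs_mult)
    then show "min 1 \<bar>c * X n \<omega> - c * Y \<omega>\<bar> \<le> (1 + \<bar>c\<bar>) * min 1 \<bar>X n \<omega> - Y \<omega>\<bar>"
      by (auto simp: min_def algebra_simps)
  qed auto
  show "(\<lambda>n. (1 + \<bar>c\<bar>) * (\<integral>\<omega>. min 1 \<bar>X n \<omega> - Y \<omega>\<bar> \<partial>M)) \<longlonglongrightarrow> 0"
    using assms by (auto simp: conv_prob_def intro: tendsto_mult_right_zero)
qed (use assms in \<open>auto simp: conv_prob_def intro!: borel_measurable_add borel_measurable_times\<close>)

lemma conv_prob_diff:
  assumes "conv_prob M X Y" "conv_prob M X' Y'"
  shows "conv_prob M (\<lambda>n \<omega>. X n \<omega> - X' n \<omega>) (\<lambda>\<omega>. Y \<omega> - Y' \<omega>)"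
  using conv_prob_add[OF assms(1) conv_prob_cmult[OF assms(2), of "-1"]] by simp

lemma conv_prob_cong_AE:
  assumes "conv_prob M X Y" "\<And>n. X' n \<in> borel_measurable M" "Y' \<in> borel_measurable M"
    and "\<And>n. AE \<omega> in M. X' n \<omega> = X n \<omega>" and "AE \<omega> in M. Y' \<omega> = Y \<omega>"
  shows "conv_prob M X' Y'"
proof (rule conv_prob_squeeze)
  have [measurable]: "X n \<in> borel_measurable M" "Y \<in> borel_measurable M" for n
    using assms by (auto simp: conv_prob_def)
  note [measurable] = assms(2,3)
  show "(\<integral>\<omega>. min 1 \<bar>X' n \<omega> - Y' \<omega>\<bar> \<partial>M) \<le> (\<integral>\<omega>. min 1 \<bar>X n \<omega> - Y \<omega>\<bar> \<partial>M)" for n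
  proof (rule eq_refl, rule integral_cong_AE)
    show "AE \<omega> in M. min 1 \<bar>X' n \<omega> - Y' \<omega>\<bar> = min 1 \<bar>X n \<omega> - Y \<omega>\<bar>"
      using assms(4)[of n] assms(5) by eventually_elim simp
  qed auto
qed (use assms in \<open>auto simp: conv_prob_def intro!: borel_measurable_add borel_measurable_times\<close>)

text \<open>Two evaluations of the limit of the same Riemann sums thereby become an almost sure
  identity. The difference of the sequence with itself is zero and has limit
  \<open>Y - Y'\<close>.\<close>

lemma conv_prob_unique:
  assumes "conv_prob M X Y" "conv_prob M X Y'"
  shows "AE \<omega> in M. Y \<omega> = Y' \<omega>"
proof -
  have [measurable]: "Y \<in> borel_measurable M" "Y' \<in> borel_measurable M"
    using assms by (auto simp: conv_prob_def)
  have "conv_prob M (\<lambda>n \<omega>. X n \<omega> - X n \<omega>) (\<lambda>\<omega>. Y \<omega> - Y' \<omega>)"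
    by (rule conv_prob_diff[OF assms])
  then have "(\<lambda>n. \<integral>\<omega>. min 1 \<bar>Y \<omega> - Y' \<omega>\<bar> \<partial>M) \<longlonglongrightarrow> 0"
    by (simp add: conv_prob_def abs_minus_commute)
  then have "(\<integral>\<omega>. min 1 \<bar>Y \<omega> - Y' \<omega>\<bar> \<partial>M) = 0"
    by (simp add: LIMSEQ_const_iff)
  then have "AE \<omega> in M. min 1 \<bar>Y \<omega> - Y' \<omega>\<bar> = 0"
    by (subst (asm) integral_nonneg_eq_0_iff_AE) auto
  then show ?thesis by eventually_elim (auto simp: min_def split: if_splits)
qed

lemma conv_prob_AE_subseq:
  assumes "conv_prob M X Y"
  shows "\<exists>r. strict_mono r \<and> (AE \<omega> in M. (\<lambda>n. X (r n) \<omega>) \<longlonglongrightarrow> Y \<omega>)"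
proof -
  have [measurable]: "X n \<in> borel_measurable M" "Y \<in> borel_measurable M" for n
    using assms by (auto simp: conv_prob_def)
  have "(\<lambda>n. \<integral>\<omega>. norm (min 1 \<bar>X n \<omega> - Y \<omega>\<bar>) \<partial>M) \<longlonglongrightarrow> 0"
    using assms by (simp add: conv_prob_def)
  from tendsto_L1_AE_subseq[OF _ this] obtain r where r: "strict_mono r"
    "AE \<omega> in M. (\<lambda>n. min 1 \<bar>X (r n) \<omega> - Y \<omega>\<bar>) \<longlonglongrightarrow> 0" by auto
  have "AE \<omega> in M. (\<lambda>n. X (r n) \<omega>) \<longlonglongrightarrow> Y \<omega>"
    using r(2)
  proof eventually_elim
    case (elim \<omega>)
    then have "\<forall>\<^sub>F n in sequentially. min 1 \<bar>X (r n) \<omega> - Y \<omega>\<bar> < 1"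
      by (rule order_tendstoD) simp
    then have "\<forall>\<^sub>F n in sequentially. min 1 \<bar>X (r n) \<omega> - Y \<omega>\<bar> = \<bar>X (r n) \<omega> - Y \<omega>\<bar>"
      by eventually_elim auto
    from Lim_transform_eventually[OF elim this] show ?case
      by (simp add: LIM_zero_iff tendsto_rabs_zero_iff)
  qed
  with r show ?thesis by auto
qed

text \<open>The link to \<open>null_in_prob\<close>. One direction is Markov's inequality; for the
  other, the mean is at most e/2 plus the probability that the distance exceeds e/2.\<close>

lemma conv_prob_iff_prob:
  assumes [measurable]: "\<And>n. X n \<in> borel_measurable M" "Y \<in> borel_measurable M"
  shows "conv_prob M X Y \<longleftrightarrow> (\<forall>\<epsilon>>0. (\<lambda>n. prob {\<omega> \<in> space M. \<epsilon> < \<bar>X n \<omega> - Y \<omega>\<bar>}) \<longlonglongrightarrow> 0)"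
proof (intro iffI allI impI)
  fix \<epsilon> :: real assume "0 < \<epsilon>" and c: "conv_prob M X Y"
  show "(\<lambda>n. prob {\<omega> \<in> space M. \<epsilon> < \<bar>X n \<omega> - Y \<omega>\<bar>}) \<longlonglongrightarrow> 0"
  proof (rule tendsto_sandwich[of "\<lambda>_. 0"])
    show "\<forall>\<^sub>F n in sequentially. prob {\<omega> \<in> space M. \<epsilon> < \<bar>X n \<omega> - Y \<omega>\<bar>}
        \<le> (\<integral>\<omega>. min 1 \<bar>X n \<omega> - Y \<omega>\<bar> \<partial>M) / min 1 \<epsilon>"
    proof (intro always_eventually allI)
      fix n
      have "prob {\<omega> \<in> space M. \<epsilon> < \<bar>X n \<omega> - Y \<omega>\<bar>} \<le> prob {\<omega> \<in> space M. min 1 \<bar>X n \<omega> - Y \<omega>\<bar> \<ge> min 1 \<epsilon>}"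
        by (rule finite_measure_mono) auto
      also have "\<dots> \<le> (\<integral>\<omega>. min 1 \<bar>X n \<omega> - Y \<omega>\<bar> \<partial>M) / min 1 \<epsilon>"
        by (rule integral_Markov_inequality_measure[where A = "{}"]) (use \<open>0 < \<epsilon>\<close> in auto)
      finally show "prob {\<omega> \<in> space M. \<epsilon> < \<bar>X n \<omega> - Y \<omega>\<bar>} \<le> (\<integral>\<omega>. min 1 \<bar>X n \<omega> - Y \<omega>\<bar> \<partial>M) / min 1 \<epsilon>" .
    qed
    show "(\<lambda>n. (\<integral>\<omega>. min 1 \<bar>X n \<omega> - Y \<omega>\<bar> \<partial>M) / min 1 \<epsilon>) \<longlonglongrightarrow> 0"
      using c by (auto simp: conv_prob_def intro: tendsto_divide_zero)
  qed auto
next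
  assume *: "\<forall>\<epsilon>>0. (\<lambda>n. prob {\<omega> \<in> space M. \<epsilon> < \<bar>X n \<omega> - Y \<omega>\<bar>}) \<longlonglongrightarrow> 0"
  have "(\<lambda>n. \<integral>\<omega>. min 1 \<bar>X n \<omega> - Y \<omega>\<bar> \<partial>M) \<longlonglongrightarrow> 0"
  proof (rule LIMSEQ_I)
    fix e :: real assume "0 < e"
    then have "\<forall>\<^sub>F n in sequentially. prob {\<omega> \<in> space M. e/2 < \<bar>X n \<omega> - Y \<omega>\<bar>} < e/2"
      using *[rule_format, of "e/2"] by (intro order_tendstoD(2)[of _ 0]) simp_all
    then obtain N where N: "\<And>n. n \<ge> N \<Longrightarrow> prob {\<omega> \<in> space M. e/2 < \<bar>X n \<omega> - Y \<omega>\<bar>} < e/2"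
      by (auto simp: eventually_sequentially)
    show "\<exists>no. \<forall>n\<ge>no. norm ((\<integral>\<omega>. min 1 \<bar>X n \<omega> - Y \<omega>\<bar> \<partial>M) - 0) < e"
    proof (intro exI[of _ N] allI impI)
      fix n assume n: "N \<le> n"
      define A where "A = {\<omega> \<in> space M. e/2 < \<bar>X n \<omega> - Y \<omega>\<bar>}"
      have [simp]: "A \<in> events" unfolding A_def by measurable
      have "(\<integral>\<omega>. min 1 \<bar>X n \<omega> - Y \<omega>\<bar> \<partial>M) \<le> (\<integral>\<omega>. e/2 + indicator A \<omega> \<partial>M)"
        by (rule integral_mono)
          (use \<open>0 < e\<close> in \<open>auto simp: emeasure_eq_measure, auto simp: A_def min_def indicator_def\<close>)
      also have "\<dots> = e/2 + prob A"
        by (subst Bochner_Integration.integral_add) (auto simp: prob_space emeasure_eq_measure)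
      also have "\<dots> < e" using N[OF n] by (simp add: A_def)
      finally show "norm ((\<integral>\<omega>. min 1 \<bar>X n \<omega> - Y \<omega>\<bar> \<partial>M) - 0) < e"
        by (auto intro!: integral_nonneg_AE abs_less_iff[THEN iffD2] less_le_trans[OF neg_less_0_iff_less[THEN iffD2, OF \<open>0 < e\<close>]])
    qed
  qed
  then show "conv_prob M X Y" by (simp add: conv_prob_def)
qed

text \<open>Dominated convergence for indicators. The index from which a path avoids the events may
  depend on the path, so pathwise estimates without uniformity are enough.\<close>

lemma AE_imp_prob_tendsto_0:
  assumes [measurable]: "\<And>n. E n \<in> events" and "AE \<omega> in M. \<forall>\<^sub>F n in sequentially. \<omega> \<notin> E n"
  shows "(\<lambda>n. prob (E n)) \<longlonglongrightarrow> 0"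
proof -
  have "(\<lambda>n. \<integral>\<omega>. indicator (E n) \<omega> \<partial>M) \<longlonglongrightarrow> (\<integral>\<omega>. (0::real) \<partial>M)"
  proof (rule integral_dominated_convergence[where w = "\<lambda>_. 1"])
    show "AE \<omega> in M. (\<lambda>n. indicator (E n) \<omega> :: real) \<longlonglongrightarrow> 0"
      using assms(2)
    proof eventually_elim
      case (elim \<omega>)
      then have "\<forall>\<^sub>F n in sequentially. indicator (E n) \<omega> = (0::real)" by eventually_elim simp
      then show ?case by (rule tendsto_eventually)
    qed
  qed auto
  then show ?thesis by simp
qed

text \<open>Fatou's lemma along an almost surely convergent subsequence.\<close>

lemma conv_prob_second_moment:
  assumes c: "conv_prob M X Y" and i: "\<And>n. integrable M (\<lambda>\<omega>. (X n \<omega>)\<^sup>2)"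
    and b: "\<And>n. (\<integral>\<omega>. (X n \<omega>)\<^sup>2 \<partial>M) \<le> B"
  shows "(\<integral>\<omega>. (Y \<omega>)\<^sup>2 \<partial>M) \<le> B"
proof -
  have [measurable]: "X n \<in> borel_measurable M" "Y \<in> borel_measurable M" for n
    using c by (auto simp: conv_prob_def)
  have B: "0 \<le> B" by (rule order_trans[OF _ b[of 0]]) auto
  obtain r where r: "strict_mono r" "AE \<omega> in M. (\<lambda>n. X (r n) \<omega>) \<longlonglongrightarrow> Y \<omega>"
    using conv_prob_AE_subseq[OF c] by auto
  have "(\<integral>\<^sup>+\<omega>. ennreal ((Y \<omega>)\<^sup>2) \<partial>M) = (\<integral>\<^sup>+\<omega>. liminf (\<lambda>n. ennreal ((X (r n) \<omega>)\<^sup>2)) \<partial>M)"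
  proof (rule nn_integral_cong_AE)
    show "AE \<omega> in M. ennreal ((Y \<omega>)\<^sup>2) = liminf (\<lambda>n. ennreal ((X (r n) \<omega>)\<^sup>2))"
      using r(2)
    proof eventually_elim
      case (elim \<omega>)
      then have "(\<lambda>n. ennreal ((X (r n) \<omega>)\<^sup>2)) \<longlonglongrightarrow> ennreal ((Y \<omega>)\<^sup>2)"
        by (intro tendsto_ennrealI tendsto_power)
      then show ?case by (metis lim_imp_Liminf trivial_limit_sequentially)
    qed
  qed
  also have "\<dots> \<le> liminf (\<lambda>n. \<integral>\<^sup>+\<omega>. ennreal ((X (r n) \<omega>)\<^sup>2) \<partial>M)"
    by (rule nn_integral_liminf) auto
  also have "\<dots> \<le> liminf (\<lambda>n::nat. ennreal B)"
    by (intro Liminf_mono always_eventually allI)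
      (simp add: nn_integral_eq_integral[OF i] b ennreal_leI)
  also have "\<dots> = ennreal B" by (simp add: Liminf_const)
  finally have "(\<integral>\<^sup>+\<omega>. ennreal ((Y \<omega>)\<^sup>2) \<partial>M) \<le> ennreal B" .
  then show ?thesis using B
    by (subst integral_eq_nn_integral) (auto simp: enn2real_leI)
qed

end

section \<open>Sums over Brownian increments\<close>

lemma (in prob_space) integrable_mult_square:
  fixes f g :: "'a \<Rightarrow> real"
  assumes [measurable]: "f \<in> borel_measurable M" "g \<in> borel_measurable M"
    and "integrable M (\<lambda>\<omega>. (f \<omega>)\<^sup>2)" "integrable M (\<lambda>\<omega>. (g \<omega>)\<^sup>2)"
  shows "integrable M (\<lambda>\<omega>. f \<omega> * g \<omega>)"
proof (rule Bochner_Integration.integrable_bound)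
  show "integrable M (\<lambda>\<omega>. (f \<omega>)\<^sup>2 + (g \<omega>)\<^sup>2)" using assms by auto
  have "norm (x * y) \<le> norm (x\<^sup>2 + y\<^sup>2)" for x y :: real
  proof -
    have "2 * (\<bar>x\<bar> * \<bar>y\<bar>) \<le> x\<^sup>2 + y\<^sup>2" "0 \<le> \<bar>x\<bar> * \<bar>y\<bar>"
      using sum_squares_bound[of "\<bar>x\<bar>" "\<bar>y\<bar>"] by (simp_all add: mult.assoc)
    then have "\<bar>x\<bar> * \<bar>y\<bar> \<le> x\<^sup>2 + y\<^sup>2" by linarith
    then show ?thesis by (simp add: abs_mult)
  qed
  then show "AE \<omega> in M. norm (f \<omega> * g \<omega>) \<le> norm ((f \<omega>)\<^sup>2 + (g \<omega>)\<^sup>2)" by simp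
qed auto

section \<open>Law, independence and orthogonality of Brownian increments\<close>

locale brownian =
  fixes M :: "'a measure" and F :: "real \<Rightarrow> 'a measure" and W :: "real \<Rightarrow> 'a \<Rightarrow> real"
  assumes bm: "brownian_motion M F W"
begin

sublocale prob_space M
  using bm by (simp add: brownian_motion_def filtered_prob_space_def)

lemma space_F [simp]: "space (F t) = space M"
  and sets_F_mono: "s \<le> t \<Longrightarrow> sets (F s) \<subseteq> sets (F t)"
  and sets_F: "sets (F t) \<subseteq> events"
  using bm by (auto simp: brownian_motion_def filtered_prob_space_def filtration_def subalgebra_def)

lemma measurable_F_mono: "f \<in> measurable (F s) N \<Longrightarrow> s \<le> t \<Longrightarrow> f \<in> measurable (F t) N"
  using sets_F_mono[of s t] by (auto simp: measurable_def)

lemma measurable_F: "f \<in> measurable (F s) N \<Longrightarrow> f \<in> measurable M N"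
  using sets_F[of s] by (auto simp: measurable_def)

lemma W_adapted: "0 \<le> t \<Longrightarrow> W t \<in> borel_measurable (F t)"
  using bm by (simp add: brownian_motion_def)

lemma W_measurable [measurable]: "0 \<le> t \<Longrightarrow> W t \<in> borel_measurable M"
  using W_adapted measurable_F by blast

lemma W_0: "AE \<omega> in M. W 0 \<omega> = 0"
  and W_continuous: "AE \<omega> in M. continuous_on {0..} (\<lambda>t. W t \<omega>)"
  using bm by (simp_all add: brownian_motion_def)

lemma increment_law:
  assumes "0 \<le> s" "s \<le> t"
  shows "distr M borel (\<lambda>\<omega>. W t \<omega> - W s \<omega>) = normal_law 0 (t - s)"
proof (cases "s = t")
  case True
  then show ?thesis by (simp add: normal_law_def)
next
  case False
  with assms bm show ?thesis by (simp add: brownian_motion_def)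
qed

text \<open>The degenerate case \<open>s = t\<close> is included because partitions may repeat a
  point and a uniform grid of \<open>{0..0}\<close> has cells of length zero. There the increment is
  constant, so it generates the trivial sigma-algebra.\<close>

lemma increment_indep:
  assumes st: "0 \<le> s" "s \<le> t" and u: "u \<in> borel_measurable (F s)" and p: "\<phi> \<in> borel_measurable borel"
  shows "indep_var borel u borel (\<lambda>\<omega>. \<phi> (W t \<omega> - W s \<omega>))"
proof (cases "s = t")
  case True
  have "indep_set (sigma_sets (space M) {u -` A \<inter> space M |A. A \<in> sets borel})
     (sigma_sets (space M) {(\<lambda>\<omega>. \<phi> 0) -` A \<inter> space M |A. A \<in> sets borel})"
    (is "indep_set ?A ?B")
  proof (rule indep_setI)
    have "?B \<subseteq> {{}, space M}"
      by (rule sigma_algebra.sigma_sets_subset) (auto simp: sigma_algebra_trivial)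
    then have B: "b = {} \<or> b = space M" if "b \<in> ?B" for b using that by auto
    show A: "?A \<subseteq> events" "?B \<subseteq> events"
      using measurable_F[OF u] by (auto intro!: sets.sigma_sets_subset)
    show "prob (a \<inter> b) = prob a * prob b" if "a \<in> ?A" "b \<in> ?B" for a b
      using B[OF that(2)] A(1) that(1) by (auto simp: prob_space Int_absorb2 dest: sets.sets_into_space)
  qed
  then show ?thesis using True measurable_F[OF u] by (simp add: indep_var_eq)
next
  case False
  then have "indep_set (sets (F s)) (sets (vimage_algebra (space M) (\<lambda>\<omega>. W t \<omega> - W s \<omega>) borel))"
    using bm st by (simp add: brownian_motion_def)
  moreover have m: "(\<lambda>\<omega>. W t \<omega> - W s \<omega>) \<in> borel_measurable M" using st by simp
  have "sigma_sets (space M) {u -` A \<inter> space M |A. A \<in> sets borel} \<subseteq> sets (F s)"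
    using measurable_sets[OF u] by (intro sets.sigma_sets_subset[of _ "F s", simplified]) auto
  moreover have "sigma_sets (space M) {(\<lambda>\<omega>. \<phi> (W t \<omega> - W s \<omega>)) -` A \<inter> space M |A. A \<in> sets borel}
     \<subseteq> sets (vimage_algebra (space M) (\<lambda>\<omega>. W t \<omega> - W s \<omega>) borel)"
  proof -
    have "(\<lambda>\<omega>. \<phi> (W t \<omega> - W s \<omega>)) \<in> borel_measurable (vimage_algebra (space M) (\<lambda>\<omega>. W t \<omega> - W s \<omega>) borel)"
      by (rule measurable_compose[OF measurable_vimage_algebra1 p]) simp
    from measurable_sets[OF this] show ?thesis
      by (intro sets.sigma_sets_subset[of _ "vimage_algebra (space M) (\<lambda>\<omega>. W t \<omega> - W s \<omega>) borel",
            unfolded space_vimage_algebra]) auto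
  qed
  ultimately have "indep_set (sigma_sets (space M) {u -` A \<inter> space M |A. A \<in> sets borel})
     (sigma_sets (space M) {(\<lambda>\<omega>. \<phi> (W t \<omega> - W s \<omega>)) -` A \<inter> space M |A. A \<in> sets borel})"
    unfolding indep_set_def by (elim indep_sets_mono_sets) (auto split: bool.splits)
  then show ?thesis
    using measurable_F[OF u] measurable_compose[OF m p] by (simp add: indep_var_eq)
qed

lemma increment_integral:
  fixes \<phi> :: "real \<Rightarrow> real"
  assumes "0 \<le> s" "s \<le> t" and "has_bochner_integral (normal_law 0 (t - s)) \<phi> x"
  shows "has_bochner_integral M (\<lambda>\<omega>. \<phi> (W t \<omega> - W s \<omega>)) x"
proof -
  have "\<phi> \<in> borel_measurable borel" using assms(3) by (auto simp: has_bochner_integral_iff dest: borel_measurable_integrable)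
  moreover have "(\<lambda>\<omega>. W t \<omega> - W s \<omega>) \<in> borel_measurable M"
    using assms by (intro borel_measurable_diff W_measurable) auto
  ultimately show ?thesis
    using assms(3) unfolding increment_law[OF assms(1,2), symmetric] has_bochner_integral_iff
    by (metis integrable_distr_eq integral_distr)
qed

lemma increment_sum_adapted:
  fixes u :: "nat \<Rightarrow> 'a \<Rightarrow> real" and \<phi> :: "nat \<Rightarrow> real \<Rightarrow> real"
  assumes "0 \<le> \<tau> 0" "\<And>i. i < n \<Longrightarrow> \<tau> i \<le> \<tau> (Suc i)"
    and "\<And>i. i < n \<Longrightarrow> u i \<in> borel_measurable (F (\<tau> i))"
    and "\<And>i. i < n \<Longrightarrow> \<phi> i \<in> borel_measurable borel"
  shows "0 \<le> \<tau> n" "(\<lambda>\<omega>. \<Sum>i<n. u i \<omega> * \<phi> i (W (\<tau> (Suc i)) \<omega> - W (\<tau> i) \<omega>)) \<in> borel_measurable (F (\<tau> n))"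
proof -
  have "0 \<le> \<tau> n \<and> (\<lambda>\<omega>. \<Sum>i<n. u i \<omega> * \<phi> i (W (\<tau> (Suc i)) \<omega> - W (\<tau> i) \<omega>)) \<in> borel_measurable (F (\<tau> n))"
    using assms
  proof (induction n)
    case (Suc n)
    then have IH: "0 \<le> \<tau> n" "\<tau> n \<le> \<tau> (Suc n)"
      "(\<lambda>\<omega>. \<Sum>i<n. u i \<omega> * \<phi> i (W (\<tau> (Suc i)) \<omega> - W (\<tau> i) \<omega>)) \<in> borel_measurable (F (\<tau> n))"
      "u n \<in> borel_measurable (F (\<tau> n))" and [measurable]: "\<phi> n \<in> borel_measurable borel"
      by (auto simp: less_Suc_eq)
    note [measurable] = W_adapted[OF order_trans[OF IH(1,2)]] measurable_F_mono[OF W_adapted[OF IH(1)] IH(2)]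
    have "(\<lambda>\<omega>. \<phi> n (W (\<tau> (Suc n)) \<omega> - W (\<tau> n) \<omega>)) \<in> borel_measurable (F (\<tau> (Suc n)))"
      by measurable
    then have "(\<lambda>\<omega>. (\<Sum>i<n. u i \<omega> * \<phi> i (W (\<tau> (Suc i)) \<omega> - W (\<tau> i) \<omega>))
        + u n \<omega> * \<phi> n (W (\<tau> (Suc n)) \<omega> - W (\<tau> n) \<omega>)) \<in> borel_measurable (F (\<tau> (Suc n)))"
      using measurable_F_mono[OF IH(3,2)] measurable_F_mono[OF IH(4,2)]
      by (intro borel_measurable_add borel_measurable_times)
    then show ?case using order_trans[OF IH(1,2)] by simp
  qed simp
  then show "0 \<le> \<tau> n" "(\<lambda>\<omega>. \<Sum>i<n. u i \<omega> * \<phi> i (W (\<tau> (Suc i)) \<omega> - W (\<tau> i) \<omega>)) \<in> borel_measurable (F (\<tau> n))"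
    by auto
qed

text \<open>The newest increment is independent of everything known at its left end point and
  \<open>\<phi> n\<close> is centred, so the mixed term has mean zero and the squares factorise. For
  the identity as \<open>\<phi>\<close> this is the discrete Ito isometry; general
  \<open>\<phi>\<close> admits \<open>exp_remainder\<close>.\<close>

lemma increment_sum_isometry:
  fixes u :: "nat \<Rightarrow> 'a \<Rightarrow> real" and \<phi> :: "nat \<Rightarrow> real \<Rightarrow> real"
  assumes "0 \<le> \<tau> 0" "\<And>i. i < n \<Longrightarrow> \<tau> i \<le> \<tau> (Suc i)"
    and "\<And>i. i < n \<Longrightarrow> u i \<in> borel_measurable (F (\<tau> i))"
    and "\<And>i. i < n \<Longrightarrow> integrable M (\<lambda>\<omega>. (u i \<omega>)\<^sup>2)"
    and "\<And>i. i < n \<Longrightarrow> has_bochner_integral (normal_law 0 (\<tau> (Suc i) - \<tau> i)) (\<phi> i) 0"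
    and "\<And>i. i < n \<Longrightarrow> has_bochner_integral (normal_law 0 (\<tau> (Suc i) - \<tau> i)) (\<lambda>x. (\<phi> i x)\<^sup>2) (q i)"
  shows "has_bochner_integral M (\<lambda>\<omega>. (\<Sum>i<n. u i \<omega> * \<phi> i (W (\<tau> (Suc i)) \<omega> - W (\<tau> i) \<omega>))\<^sup>2)
    (\<Sum>i<n. (\<integral>\<omega>. (u i \<omega>)\<^sup>2 \<partial>M) * q i)"
  using assms
proof (induction n)
  case 0
  then show ?case by (simp add: has_bochner_integral_iff)
next
  case (Suc n)
  define S where "S = (\<lambda>\<omega>. \<Sum>i<n. u i \<omega> * \<phi> i (W (\<tau> (Suc i)) \<omega> - W (\<tau> i) \<omega>))"
  define Z where "Z = (\<lambda>\<omega>. \<phi> n (W (\<tau> (Suc n)) \<omega> - W (\<tau> n) \<omega>))"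
  have p: "\<phi> i \<in> borel_measurable borel" if "i < Suc n" for i
    using Suc.prems(5)[OF that] by (auto simp: has_bochner_integral_iff dest: borel_measurable_integrable)
  have t0: "0 \<le> \<tau> n" and S_ad: "S \<in> borel_measurable (F (\<tau> n))"
    using increment_sum_adapted[of \<tau> n u \<phi>] Suc.prems(1-3) p by (simp_all add: S_def)
  have t1: "\<tau> n \<le> \<tau> (Suc n)" and u_ad: "u n \<in> borel_measurable (F (\<tau> n))"
    and u_int: "integrable M (\<lambda>\<omega>. (u n \<omega>)\<^sup>2)" using Suc.prems by auto
  have IH: "has_bochner_integral M (\<lambda>\<omega>. (S \<omega>)\<^sup>2) (\<Sum>i<n. (\<integral>\<omega>. (u i \<omega>)\<^sup>2 \<partial>M) * q i)"
    unfolding S_def using Suc.prems by (intro Suc.IH) auto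
  have [measurable]: "S \<in> borel_measurable M" "u n \<in> borel_measurable M"
    using S_ad u_ad measurable_F by auto
  have Z1: "has_bochner_integral M Z 0" unfolding Z_def
    by (rule increment_integral[OF t0 t1]) (use Suc.prems(5)[of n] in simp)
  have Z2: "has_bochner_integral M (\<lambda>\<omega>. (Z \<omega>)\<^sup>2) (q n)" unfolding Z_def
    by (rule increment_integral[OF t0 t1, where \<phi> = "\<lambda>x. (\<phi> n x)\<^sup>2"]) (use Suc.prems(6)[of n] in simp)
  have Su: "integrable M (\<lambda>\<omega>. S \<omega> * u n \<omega>)"
    using IH u_int by (intro integrable_mult_square) (auto simp: has_bochner_integral_iff)
  have ad: "(\<lambda>\<omega>. S \<omega> * u n \<omega>) \<in> borel_measurable (F (\<tau> n))" "(\<lambda>\<omega>. (u n \<omega>)\<^sup>2) \<in> borel_measurable (F (\<tau> n))"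
    using S_ad u_ad by auto
  have i1: "indep_var borel (\<lambda>\<omega>. S \<omega> * u n \<omega>) borel Z"
    unfolding Z_def by (rule increment_indep[OF t0 t1 ad(1)]) (use p in auto)
  have i2: "indep_var borel (\<lambda>\<omega>. (u n \<omega>)\<^sup>2) borel (\<lambda>\<omega>. (Z \<omega>)\<^sup>2)"
    unfolding Z_def by (rule increment_indep[OF t0 t1 ad(2), where \<phi> = "\<lambda>x. (\<phi> n x)\<^sup>2"]) (use p in auto)
  have "has_bochner_integral M (\<lambda>\<omega>. S \<omega> * u n \<omega> * Z \<omega>) 0"
    using indep_var_integrable[OF i1 Su] indep_var_lebesgue_integral[OF i1 Su] Z1
    by (auto simp: has_bochner_integral_iff)
  moreover have "has_bochner_integral M (\<lambda>\<omega>. (u n \<omega>)\<^sup>2 * (Z \<omega>)\<^sup>2) ((\<integral>\<omega>. (u n \<omega>)\<^sup>2 \<partial>M) * q n)"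
    using indep_var_integrable[OF i2 u_int] indep_var_lebesgue_integral[OF i2 u_int] Z2
    by (auto simp: has_bochner_integral_iff)
  ultimately have "has_bochner_integral M (\<lambda>\<omega>. (S \<omega>)\<^sup>2 + 2 * (S \<omega> * u n \<omega> * Z \<omega>) + (u n \<omega>)\<^sup>2 * (Z \<omega>)\<^sup>2)
     ((\<Sum>i<n. (\<integral>\<omega>. (u i \<omega>)\<^sup>2 \<partial>M) * q i) + 2 * 0 + (\<integral>\<omega>. (u n \<omega>)\<^sup>2 \<partial>M) * q n)"
    by (intro has_bochner_integral_add has_bochner_integral_mult_right IH)
  moreover have "(\<Sum>i<Suc n. u i \<omega> * \<phi> i (W (\<tau> (Suc i)) \<omega> - W (\<tau> i) \<omega>))\<^sup>2
     = (S \<omega>)\<^sup>2 + 2 * (S \<omega> * u n \<omega> * Z \<omega>) + (u n \<omega>)\<^sup>2 * (Z \<omega>)\<^sup>2" for \<omega>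
    unfolding S_def Z_def by (simp add: power2_eq_square algebra_simps)
  ultimately show ?case by simp
qed

text \<open>The coefficients are switched off once the running sum of \<open>u\<^sub>i\<^sup>2 q\<^sub>i\<close> exceeds \<open>\<delta>\<close>; the truncated
  sum has second moment at most \<open>\<delta>\<close>.\<close>

lemma increment_sum_tail:
  fixes u :: "nat \<Rightarrow> 'a \<Rightarrow> real" and \<phi> :: "nat \<Rightarrow> real \<Rightarrow> real"
  assumes t: "0 \<le> \<tau> 0" "\<And>i. i < n \<Longrightarrow> \<tau> i \<le> \<tau> (Suc i)"
    and u: "\<And>i. i < n \<Longrightarrow> u i \<in> borel_measurable (F (\<tau> i))"
    and p: "\<And>i. i < n \<Longrightarrow> has_bochner_integral (normal_law 0 (\<tau> (Suc i) - \<tau> i)) (\<phi> i) 0"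
    and q: "\<And>i. i < n \<Longrightarrow> has_bochner_integral (normal_law 0 (\<tau> (Suc i) - \<tau> i)) (\<lambda>x. (\<phi> i x)\<^sup>2) (q i)"
    and pos: "0 < \<epsilon>" "0 < \<delta>"
  shows "prob {\<omega> \<in> space M. \<epsilon> < \<bar>\<Sum>i<n. u i \<omega> * \<phi> i (W (\<tau> (Suc i)) \<omega> - W (\<tau> i) \<omega>)\<bar>}
    \<le> prob {\<omega> \<in> space M. \<delta> < (\<Sum>i<n. (u i \<omega>)\<^sup>2 * q i)} + \<delta> / \<epsilon>\<^sup>2"
proof -
  let ?Z = "\<lambda>i \<omega>. \<phi> i (W (\<tau> (Suc i)) \<omega> - W (\<tau> i) \<omega>)"
  have q0: "0 \<le> q i" if "i < n" for i
    using q[OF that] integral_nonneg_AE[of "\<lambda>x. (\<phi> i x)\<^sup>2" "normal_law 0 (\<tau> (Suc i) - \<tau> i)"]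
    by (auto simp: has_bochner_integral_iff)
  have pm: "\<phi> i \<in> borel_measurable borel" if "i < n" for i
    using p[OF that] by (auto simp: has_bochner_integral_iff dest: borel_measurable_integrable)
  have mono: "\<tau> i \<le> \<tau> j" if "i \<le> j" "j \<le> n" for i j
    using that by (induction rule: dec_induct) (auto intro: order_trans[OF _ t(2)])
  have tp: "0 \<le> \<tau> i" if "i \<le> n" for i using mono[of 0 i] t(1) that by simp
  \<comment> \<open>The running sum includes the index \<open>i\<close> itself: this term is already
    known at time \<open>\<tau> i\<close>, so the switch is adapted, and the truncated sum never
    overshoots \<delta>.\<close>
  define A where "A = (\<lambda>i. {\<omega> \<in> space M. (\<Sum>j\<le>i. (u j \<omega>)\<^sup>2 * q j) \<le> \<delta>})"
  \<comment> \<open>For \<open>q i = 0\<close> a bound on the product with \<open>q i\<close> says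
    nothing about the coefficient, whose square need not be integrable; it is therefore replaced by
    0.\<close>
  define v where "v = (\<lambda>i \<omega>. if q i = 0 then 0 else u i \<omega> * indicator (A i) \<omega>)"
  have A: "A i \<in> sets (F (\<tau> i))" if "i < n" for i
  proof -
    have [measurable]: "u j \<in> borel_measurable (F (\<tau> i))" if "j \<le> i" for j
      using measurable_F_mono[OF u mono] that \<open>i < n\<close> by auto
    have "{\<omega> \<in> space (F (\<tau> i)). (\<Sum>j\<le>i. (u j \<omega>)\<^sup>2 * q j) \<le> \<delta>} \<in> sets (F (\<tau> i))"
      by measurable
    then show ?thesis by (simp add: A_def)
  qed
  have v_ad: "v i \<in> borel_measurable (F (\<tau> i))" if "i < n" for i
    using A[OF that] u[OF that] unfolding v_def by (cases "q i = 0") auto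
  have sum_v: "(\<Sum>i<n. (v i \<omega>)\<^sup>2 * q i) \<le> \<delta>" if \<omega>: "\<omega> \<in> space M" for \<omega>
  proof -
    \<comment> \<open>The comparison with \<open>u\<close> is carried through the induction because,
      when a switch is on, it is the sum formed with \<open>u\<close> that is known to be at most
      \<delta>.\<close>
    have "(\<Sum>i<m. (v i \<omega>)\<^sup>2 * q i) \<le> \<delta> \<and> (\<Sum>i<m. (v i \<omega>)\<^sup>2 * q i) \<le> (\<Sum>i<m. (u i \<omega>)\<^sup>2 * q i)"
      if "m \<le> n" for m
      using that
    proof (induction m)
      case (Suc m)
      then have IH: "(\<Sum>i<m. (v i \<omega>)\<^sup>2 * q i) \<le> \<delta>" "(\<Sum>i<m. (v i \<omega>)\<^sup>2 * q i) \<le> (\<Sum>i<m. (u i \<omega>)\<^sup>2 * q i)" by auto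
      have "(v m \<omega>)\<^sup>2 * q m \<le> (u m \<omega>)\<^sup>2 * q m"
        using q0[of m] Suc.prems by (auto simp: v_def indicator_def)
      moreover have "(\<Sum>i<Suc m. (v i \<omega>)\<^sup>2 * q i) \<le> \<delta>"
      proof (cases "\<omega> \<in> A m")
        case True
        then have "(\<Sum>j<m. (u j \<omega>)\<^sup>2 * q j) + (u m \<omega>)\<^sup>2 * q m \<le> \<delta>"
          by (simp add: A_def lessThan_Suc_atMost[symmetric])
        then show ?thesis using IH(2) calculation by simp
      next
        case False
        then show ?thesis using IH(1) by (simp add: v_def)
      qed
      ultimately show ?case using IH by simp
    qed (use pos in simp)
    then show ?thesis by blast
  qed
  have v_bd: "(v i \<omega>)\<^sup>2 * q i \<le> \<delta>" if "i < n" "\<omega> \<in> space M" for i \<omega>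
  proof -
    have "(v i \<omega>)\<^sup>2 * q i \<le> (\<Sum>i<n. (v i \<omega>)\<^sup>2 * q i)"
      by (rule member_le_sum) (use that q0 in auto)
    then show ?thesis using sum_v[OF that(2)] by simp
  qed
  have v_int: "integrable M (\<lambda>\<omega>. (v i \<omega>)\<^sup>2)" if i: "i < n" for i
  proof (cases "q i = 0")
    case False
    then have "0 < q i" using q0[OF i] by simp
    then show ?thesis
      using v_bd[OF i] measurable_F[OF v_ad[OF i]]
      by (intro integrable_const_bound[where B = "\<delta> / q i"]) (auto simp: field_simps)
  qed (simp add: v_def)
  define S where "S = (\<lambda>\<omega>. \<Sum>i<n. v i \<omega> * ?Z i \<omega>)"
  have S2: "has_bochner_integral M (\<lambda>\<omega>. (S \<omega>)\<^sup>2) (\<Sum>i<n. (\<integral>\<omega>. (v i \<omega>)\<^sup>2 \<partial>M) * q i)"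
    unfolding S_def by (rule increment_sum_isometry) (use t v_ad v_int p q in auto)
  have "(\<Sum>i<n. (\<integral>\<omega>. (v i \<omega>)\<^sup>2 \<partial>M) * q i) = (\<integral>\<omega>. (\<Sum>i<n. (v i \<omega>)\<^sup>2 * q i) \<partial>M)"
    using v_int by simp
  also have "\<dots> \<le> (\<integral>\<omega>. \<delta> \<partial>M)"
    using v_int sum_v by (intro integral_mono Bochner_Integration.integrable_sum) auto
  finally have S2_le: "(\<integral>\<omega>. (S \<omega>)\<^sup>2 \<partial>M) \<le> \<delta>"
    using S2 by (simp add: has_bochner_integral_iff prob_space)
  have [measurable]: "S \<in> borel_measurable M"
    using increment_sum_adapted(2)[of \<tau> n v \<phi>] t v_ad pm measurable_F unfolding S_def by blast
  have U: "(\<lambda>\<omega>. \<Sum>i<n. u i \<omega> * ?Z i \<omega>) \<in> borel_measurable M"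
    using increment_sum_adapted(2)[of \<tau> n u \<phi>] t u pm measurable_F by blast
  have um: "u i \<in> borel_measurable M" if "i < n" for i using measurable_F u that by blast
  \<comment> \<open>A random variable with zero second moment vanishes almost surely, so the
    coefficients dropped for \<open>q i = 0\<close> do not change the sum.\<close>
  have Z0: "AE \<omega> in M. \<forall>i\<in>{i. i < n \<and> q i = 0}. ?Z i \<omega> = 0"
  proof (rule AE_finite_allI)
    fix i assume "i \<in> {i. i < n \<and> q i = 0}"
    then have i: "i < n" "q i = 0" by auto
    have "has_bochner_integral M (\<lambda>\<omega>. (?Z i \<omega>)\<^sup>2) 0"
      by (rule increment_integral[where \<phi> = "\<lambda>x. (\<phi> i x)\<^sup>2"]) (use tp t(2) q[of i] i in auto)
    then show "AE \<omega> in M. ?Z i \<omega> = 0"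
      by (auto simp: has_bochner_integral_iff integral_nonneg_eq_0_iff_AE)
  qed simp
  let ?B = "{\<omega> \<in> space M. \<delta> < (\<Sum>i<n. (u i \<omega>)\<^sup>2 * q i)}"
  let ?C = "{\<omega> \<in> space M. \<epsilon>\<^sup>2 \<le> (S \<omega>)\<^sup>2}"
  have ev: "?B \<in> events" "?C \<in> events" using um by measurable
  have "prob {\<omega> \<in> space M. \<epsilon> < \<bar>\<Sum>i<n. u i \<omega> * ?Z i \<omega>\<bar>} \<le> prob (?B \<union> ?C)"
  proof (rule finite_measure_mono_AE)
    show "AE \<omega> in M. \<omega> \<in> {\<omega> \<in> space M. \<epsilon> < \<bar>\<Sum>i<n. u i \<omega> * ?Z i \<omega>\<bar>} \<longrightarrow> \<omega> \<in> ?B \<union> ?C"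
      using Z0
    proof (eventually_elim, intro impI)
      fix \<omega> assume Z: "\<forall>i\<in>{i. i < n \<and> q i = 0}. ?Z i \<omega> = 0"
        and "\<omega> \<in> {\<omega> \<in> space M. \<epsilon> < \<bar>\<Sum>i<n. u i \<omega> * ?Z i \<omega>\<bar>}"
      then have \<omega>: "\<omega> \<in> space M" "\<epsilon> < \<bar>\<Sum>i<n. u i \<omega> * ?Z i \<omega>\<bar>" by auto
      show "\<omega> \<in> ?B \<union> ?C"
      proof (cases "\<omega> \<in> ?B")
        case False
        then have le: "(\<Sum>i<n. (u i \<omega>)\<^sup>2 * q i) \<le> \<delta>" using \<omega> by auto
        \<comment> \<open>Outside \<open>?B\<close> even the full sum stays below \<delta>, so all
          switches are on and truncation changes nothing.\<close>
        have "\<omega> \<in> A i" if "i < n" for i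
        proof -
          have "(\<Sum>j\<le>i. (u j \<omega>)\<^sup>2 * q j) \<le> (\<Sum>i<n. (u i \<omega>)\<^sup>2 * q i)"
            by (rule sum_mono2) (use that q0 in auto)
          then show ?thesis using le \<omega> by (simp add: A_def)
        qed
        then have "S \<omega> = (\<Sum>i<n. u i \<omega> * ?Z i \<omega>)"
          unfolding S_def using Z by (intro sum.cong) (auto simp: v_def)
        then have "\<epsilon>\<^sup>2 \<le> (S \<omega>)\<^sup>2"
          using \<omega>(2) pos by (metis abs_of_pos power2_abs power_mono less_imp_le)
        then show ?thesis using \<omega> by auto
      qed simp
    qed
  qed (use ev in auto)
  also have "\<dots> \<le> prob ?B + prob ?C" using ev by (rule measure_Un_le)
  also have "prob ?C \<le> (\<integral>\<omega>. (S \<omega>)\<^sup>2 \<partial>M) / \<epsilon>\<^sup>2"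
    using S2 pos by (intro integral_Markov_inequality_measure[where A = "{}"]) (auto simp: has_bochner_integral_iff)
  also have "\<dots> \<le> \<delta> / \<epsilon>\<^sup>2" using S2_le by (simp add: divide_right_mono)
  finally show ?thesis by simp
qed

end

section \<open>Ito integrals of continuous integrands are limits of Riemann sums\<close>

lemma ex_cell:
  fixes \<tau> :: "nat \<Rightarrow> real"
  assumes "\<tau> 0 < s" "s \<le> \<tau> n"
  shows "\<exists>k<n. \<tau> k < s \<and> s \<le> \<tau> (Suc k)"
  using assms
proof (induction n)
  case (Suc n)
  then show ?case by (cases "s \<le> \<tau> n") (auto intro: less_SucI)
qed simp

lemma steps_mono:
  fixes \<tau> :: "nat \<Rightarrow> real"
  assumes "\<And>i. i < n \<Longrightarrow> \<tau> i \<le> \<tau> (Suc i)" "i \<le> j" "j \<le> n"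
  shows "\<tau> i \<le> \<tau> j"
  using assms(2,3) by (induction rule: dec_induct) (auto intro: order_trans[OF _ assms(1)])

lemma steps_strict_mono:
  fixes \<tau> :: "nat \<Rightarrow> real"
  assumes "\<And>i. i < n \<Longrightarrow> \<tau> i < \<tau> (Suc i)" "i < j" "j \<le> n"
  shows "\<tau> i < \<tau> j"
proof -
  have "\<tau> i < \<tau> (Suc i)" using assms by auto
  also have "\<tau> (Suc i) \<le> \<tau> j" by (rule steps_mono[of n]) (use assms in \<open>auto intro: less_imp_le\<close>)
  finally show ?thesis .
qed

lemma simple_value_cell:
  assumes m: "\<And>i. i < n \<Longrightarrow> \<tau> i \<le> \<tau> (Suc i)" and k: "k < n" "\<tau> k < s" "s \<le> \<tau> (Suc k)"
  shows "simple_value (n, \<tau>, \<eta>) s \<omega> = \<eta> k \<omega>"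
proof -
  have "\<eta> i \<omega> * indicator {\<tau> i<..\<tau> (Suc i)} s = (if i = k then \<eta> k \<omega> else 0)" if "i < n" for i
  proof (cases i k rule: linorder_cases)
    case less
    then have "\<tau> (Suc i) \<le> \<tau> k" using steps_mono[of n \<tau> "Suc i" k] m k that by auto
    then show ?thesis using less k by (simp add: indicator_def)
  next
    case greater
    then have "\<tau> (Suc k) \<le> \<tau> i" using steps_mono[of n \<tau> "Suc k" i] m k that by auto
    then show ?thesis using greater k by (simp add: indicator_def)
  qed (use k in simp)
  then show ?thesis using k by simp
qed

text \<open>Refining a simple integrand to a finer grid \<open>\<rho>\<close>: its coefficient on a cell of \<open>\<rho>\<close> is its value
  at the right end point, since the cells exclude the left one.\<close>

lemma simple_value_refine:
  assumes \<rho>: "\<And>j. j < N \<Longrightarrow> \<rho> j < \<rho> (Suc j)" and sub: "\<tau> ` {..n} \<subseteq> \<rho> ` {..N}"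
    and j: "j < N" "\<rho> j < s" "s \<le> \<rho> (Suc j)"
  shows "simple_value (n, \<tau>, \<eta>) s \<omega> = simple_value (n, \<tau>, \<eta>) (\<rho> (Suc j)) \<omega>"
proof -
  have "\<tau> i < s \<longleftrightarrow> \<tau> i < \<rho> (Suc j)" "s \<le> \<tau> i \<longleftrightarrow> \<rho> (Suc j) \<le> \<tau> i" if "i \<le> n" for i
  proof -
    have "\<tau> i \<in> \<rho> ` {..N}" using sub that by auto
    then obtain p where p: "p \<le> N" "\<tau> i = \<rho> p" by auto
    consider "p \<le> j" | "Suc j \<le> p" by linarith
    then have "\<tau> i < s \<and> \<tau> i < \<rho> (Suc j) \<or> s \<le> \<tau> i \<and> \<rho> (Suc j) \<le> \<tau> i"
    proof cases
      case 1
      then have "\<rho> p \<le> \<rho> j" using steps_mono[of N \<rho> p j] \<rho> j by (auto intro: less_imp_le)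
      then show ?thesis using p j by auto
    next
      case 2
      then have "\<rho> (Suc j) \<le> \<rho> p" using steps_mono[of N \<rho> "Suc j" p] \<rho> p by (auto intro: less_imp_le)
      then show ?thesis using p j by auto
    qed
    then show "\<tau> i < s \<longleftrightarrow> \<tau> i < \<rho> (Suc j)" "s \<le> \<tau> i \<longleftrightarrow> \<rho> (Suc j) \<le> \<tau> i" by linarith+
  qed
  then show ?thesis by (auto simp: indicator_def intro!: sum.cong)
qed

lemma ennreal_double_sum:
  "0 \<le> x \<Longrightarrow> 0 \<le> y \<Longrightarrow> ennreal (2 * x + 2 * y) = 2 * ennreal x + 2 * ennreal y"
  by (simp add: ennreal_plus ennreal_mult)

lemma simple_predictableD:
  assumes "simple_predictable F T (n, \<tau>, \<eta>)"
  shows "i < n \<Longrightarrow> \<tau> i \<le> \<tau> (Suc i)" "i < n \<Longrightarrow> \<eta> i \<in> borel_measurable (F (\<tau> i))"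
    "i \<le> n \<Longrightarrow> 0 \<le> \<tau> i" "i \<le> n \<Longrightarrow> \<tau> i \<le> T"
proof -
  show *: "i < n \<Longrightarrow> \<tau> i \<le> \<tau> (Suc i)" "i < n \<Longrightarrow> \<eta> i \<in> borel_measurable (F (\<tau> i))" for i
    using assms by simp_all
  show "i \<le> n \<Longrightarrow> 0 \<le> \<tau> i"
    using steps_mono[of n \<tau> 0 i] * assms by (auto intro: order_trans[of _ "\<tau> 0"])
  show "i \<le> n \<Longrightarrow> \<tau> i \<le> T"
    using steps_mono[of n \<tau> i n] * assms by (auto intro: order_trans[of _ "\<tau> n"])
qed

text \<open>An increment of \<open>W\<close> over an old cell telescopes over the new cells inside
  it. Strict monotonicity of \<open>\<rho>\<close> identifies these cells by their indices, after
  which the two sums are exchanged.\<close>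

lemma simple_integral_refine:
  assumes m: "\<And>i. i < n \<Longrightarrow> \<tau> i \<le> \<tau> (Suc i)"
    and \<rho>: "\<And>j. j < N \<Longrightarrow> \<rho> j < \<rho> (Suc j)" and sub: "\<tau> ` {..n} \<subseteq> \<rho> ` {..N}"
  shows "simple_integral_wrt (n, \<tau>, \<eta>) W \<omega>
    = (\<Sum>j<N. simple_value (n, \<tau>, \<eta>) (\<rho> (Suc j)) \<omega> * (W (\<rho> (Suc j)) \<omega> - W (\<rho> j) \<omega>))"
proof -
  let ?d = "\<lambda>j. W (\<rho> (Suc j)) \<omega> - W (\<rho> j) \<omega>"
  have *: "W (\<tau> (Suc i)) \<omega> - W (\<tau> i) \<omega> = (\<Sum>j<N. indicator {\<tau> i<..\<tau> (Suc i)} (\<rho> (Suc j)) * ?d j)"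
    if i: "i < n" for i
  proof -
    obtain p q where pq: "p \<le> N" "\<tau> i = \<rho> p" "q \<le> N" "\<tau> (Suc i) = \<rho> q"
    proof -
      have "\<tau> i \<in> \<rho> ` {..N}" "\<tau> (Suc i) \<in> \<rho> ` {..N}" using sub i by auto
      then show ?thesis using that by auto
    qed
    have less: "\<rho> a < \<rho> b \<longleftrightarrow> a < b" if "a \<le> N" "b \<le> N" for a b
      using steps_strict_mono[of N \<rho> a b] steps_strict_mono[of N \<rho> b a] \<rho> that
      by (cases a b rule: linorder_cases) (auto simp: not_less)
    have "p \<le> q" using m[OF i] less[of q p] pq by (auto simp: not_less[symmetric])
    have "(\<Sum>j<N. indicator {\<tau> i<..\<tau> (Suc i)} (\<rho> (Suc j)) * ?d j)
        = (\<Sum>j<N. if j \<in> {p..<q} then ?d j else 0)"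
    proof (intro sum.cong refl)
      fix j assume "j \<in> {..<N}"
      then have "\<rho> p < \<rho> (Suc j) \<longleftrightarrow> p \<le> j" "\<rho> (Suc j) \<le> \<rho> q \<longleftrightarrow> j < q"
        using less[of p "Suc j"] less[of q "Suc j"] pq by (auto simp: not_less[symmetric])
      then show "indicator {\<tau> i<..\<tau> (Suc i)} (\<rho> (Suc j)) * ?d j = (if j \<in> {p..<q} then ?d j else 0)"
        using pq by (auto simp: indicator_def)
    qed
    also have "\<dots> = (\<Sum>j\<in>{p..<q}. ?d j)"
      using pq by (subst sum.inter_restrict[symmetric]) (auto intro!: sum.cong)
    also have "\<dots> = W (\<rho> q) \<omega> - W (\<rho> p) \<omega>"
      using \<open>p \<le> q\<close> by (rule sum_Suc_diff')
    finally show ?thesis using pq by simp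
  qed
  have "simple_integral_wrt (n, \<tau>, \<eta>) W \<omega>
      = (\<Sum>i<n. \<Sum>j<N. \<eta> i \<omega> * indicator {\<tau> i<..\<tau> (Suc i)} (\<rho> (Suc j)) * ?d j)"
    unfolding simple_integral_wrt.simps
    by (intro sum.cong refl) (simp only: * lessThan_iff sum_distrib_left mult.assoc)
  also have "\<dots> = (\<Sum>j<N. simple_value (n, \<tau>, \<eta>) (\<rho> (Suc j)) \<omega> * ?d j)"
    by (subst sum.swap) (simp only: simple_value.simps sum_distrib_right)
  finally show ?thesis .
qed

text \<open>Applied to the union of the points of two partitions, this gives their common refinement
  without repeated points.\<close>

lemma ex_strict_grid:
  fixes A :: "real set"
  assumes "finite A" "A \<noteq> {}"
  shows "\<exists>N \<rho>. (\<forall>j<N. \<rho> j < \<rho> (Suc j)) \<and> \<rho> ` {..N} = A"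
proof (intro exI conjI)
  let ?L = "sorted_list_of_set A"
  have len: "length ?L = card A" "card A > 0" using assms by (auto simp: card_gt_0_iff)
  show "\<forall>j<card A - 1. ?L ! j < ?L ! Suc j"
    using len strict_sorted_list_of_set[of A] sorted_wrt_nth_less[of "(<)" ?L] by simp
  have "{..card A - 1} = {..<length ?L}" using len by auto
  moreover have "(!) ?L ` {..<length ?L} = set ?L" by (auto simp: set_conv_nth)
  ultimately show "(!) ?L ` {..card A - 1} = A" using assms(1) by simp
qed

context brownian
begin

text \<open>The value on a cell, read at its right end point, is known at the left one: an old
  interval that contains the right end point starts at a point of \<open>\<rho>\<close> that is
  strictly smaller, hence at \<open>\<rho> j\<close> or before.\<close>

lemma simple_value_adapted:
  assumes A: "simple_predictable F T (n, \<tau>, \<eta>)"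
    and \<rho>: "\<And>j. j < N \<Longrightarrow> \<rho> j < \<rho> (Suc j)" and sub: "\<tau> ` {..n} \<subseteq> \<rho> ` {..N}" and j: "j < N"
  shows "simple_value (n, \<tau>, \<eta>) (\<rho> (Suc j)) \<in> borel_measurable (F (\<rho> j))"
proof -
  have "(\<lambda>\<omega>. \<eta> i \<omega> * indicator {\<tau> i<..\<tau> (Suc i)} (\<rho> (Suc j))) \<in> borel_measurable (F (\<rho> j))"
    if i: "i < n" for i
  proof (cases "\<tau> i < \<rho> (Suc j)")
    case True
    have "\<tau> i \<in> \<rho> ` {..N}" using sub i by auto
    then obtain p where p: "p \<le> N" "\<tau> i = \<rho> p" by auto
    have "p \<le> j"
      using steps_mono[of N \<rho> "Suc j" p] True p \<rho> by (cases "p \<le> j") (auto simp: not_less_eq_eq less_imp_le)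
    then have "\<tau> i \<le> \<rho> j" using steps_mono[of N \<rho> p j] p \<rho> j by (auto intro: less_imp_le)
    moreover have "\<eta> i \<in> borel_measurable (F (\<tau> i))" using A i by simp
    ultimately have "\<eta> i \<in> borel_measurable (F (\<rho> j))" using measurable_F_mono by blast
    then show ?thesis by measurable
  qed (simp add: indicator_def)
  then have "(\<lambda>\<omega>. \<Sum>i<n. \<eta> i \<omega> * indicator {\<tau> i<..\<tau> (Suc i)} (\<rho> (Suc j))) \<in> borel_measurable (F (\<rho> j))"
    by (intro borel_measurable_sum) simp
  moreover have "simple_value (n, \<tau>, \<eta>) (\<rho> (Suc j))
      = (\<lambda>\<omega>. \<Sum>i<n. \<eta> i \<omega> * indicator {\<tau> i<..\<tau> (Suc i)} (\<rho> (Suc j)))" by (rule ext) simp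
  ultimately show ?thesis by metis
qed

lemma simple_integral_measurable:
  assumes "simple_predictable F T S"
  shows "simple_integral_wrt S W \<in> borel_measurable M"
proof -
  obtain n \<tau> \<eta> where S: "S = (n, \<tau>, \<eta>)" by (cases S) auto
  note D = simple_predictableD[OF assms[unfolded S]]
  have "simple_integral_wrt S W = (\<lambda>\<omega>. \<Sum>i<n. \<eta> i \<omega> * (W (\<tau> (Suc i)) \<omega> - W (\<tau> i) \<omega>))"
    unfolding S by (rule ext) simp
  then show ?thesis
    using D(2)[THEN measurable_F] D(3)
    by (auto intro!: borel_measurable_sum borel_measurable_times borel_measurable_diff W_measurable)
qed

text \<open>Progressive measurability at time \<open>T\<close> is joint measurability in time and
  outcome; integrating out the time then preserves measurability by Tonelli. This makes the tail
  sets of the distance genuine events.\<close>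

lemma ito_distance_measurable:
  assumes S: "simple_predictable F T S" and H: "progressively_measurable F T H" and T: "0 \<le> T"
  shows "(\<lambda>\<omega>. \<integral>\<^sup>+s\<in>{0..T}. ennreal ((simple_value S s \<omega> - H s \<omega>)\<^sup>2) \<partial>lborel) \<in> borel_measurable M"
proof -
  obtain n \<tau> \<eta> where [simp]: "S = (n, \<tau>, \<eta>)" by (cases S) auto
  let ?R = "restrict_space lborel {0..T}"
  interpret R: sigma_finite_measure ?R
    by (rule sigma_finite_measure_restrict_space) (auto intro: sigma_finite_lborel)
  have [measurable]: "\<eta> i \<in> borel_measurable M" if "i < n" for i
    using simple_predictableD(2)[OF S[unfolded \<open>S = (n, \<tau>, \<eta>)\<close>], THEN measurable_F] that by blast
  have id: "(\<lambda>s. s) \<in> borel_measurable ?R" by (rule measurable_restrict_space1) simp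
  have "(\<lambda>(s, \<omega>). H s \<omega>) \<in> borel_measurable (restrict_space borel {0..T} \<Otimes>\<^sub>M F T)"
    using H T by (simp add: progressively_measurable_def)
  moreover have "(\<lambda>(\<omega>, s). (s, \<omega>)) \<in> measurable (M \<Otimes>\<^sub>M ?R) (restrict_space borel {0..T} \<Otimes>\<^sub>M F T)"
  proof (rule measurable_pair)
    have "snd \<in> measurable (M \<Otimes>\<^sub>M ?R) (restrict_space borel {0..T})"
      by (subst measurable_cong_sets[OF refl, of _ ?R]) (auto simp: sets_restrict_space)
    then show "fst \<circ> (\<lambda>(\<omega>, s). (s, \<omega>)) \<in> measurable (M \<Otimes>\<^sub>M ?R) (restrict_space borel {0..T})"
      by (simp add: comp_def case_prod_beta')
    have "(\<lambda>x. x) \<in> measurable M (F T)" using sets_F[of T] by (auto simp: measurable_def Int_absorb2 dest: sets.sets_into_space)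
    then have "fst \<in> measurable (M \<Otimes>\<^sub>M ?R) (F T)" using measurable_compose[OF measurable_fst] by blast
    then show "snd \<circ> (\<lambda>(\<omega>, s). (s, \<omega>)) \<in> measurable (M \<Otimes>\<^sub>M ?R) (F T)"
      by (simp add: comp_def case_prod_beta')
  qed
  ultimately have Hm: "(\<lambda>(\<omega>, s). H s \<omega>) \<in> borel_measurable (M \<Otimes>\<^sub>M ?R)"
    using measurable_compose[of "\<lambda>(\<omega>, s). (s, \<omega>)" "M \<Otimes>\<^sub>M ?R" _ "\<lambda>(s, \<omega>). H s \<omega>" borel]
    by (simp add: case_prod_beta')
  have "(\<lambda>(\<omega>, s). simple_value S s \<omega>) \<in> borel_measurable (M \<Otimes>\<^sub>M ?R)"
  proof -
    have "(\<lambda>x. \<eta> i (fst x) * indicator {\<tau> i<..\<tau> (Suc i)} (snd x)) \<in> borel_measurable (M \<Otimes>\<^sub>M ?R)" if "i < n" for i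
    proof (intro borel_measurable_times measurable_compose[OF measurable_fst])
      show "(\<lambda>x. indicator {\<tau> i<..\<tau> (Suc i)} (snd x) :: real) \<in> borel_measurable (M \<Otimes>\<^sub>M ?R)"
        by (rule measurable_compose[OF measurable_compose[OF measurable_snd id]]) auto
    qed (use that in simp)
    then have "(\<lambda>x. \<Sum>i<n. \<eta> i (fst x) * indicator {\<tau> i<..\<tau> (Suc i)} (snd x)) \<in> borel_measurable (M \<Otimes>\<^sub>M ?R)"
      by (intro borel_measurable_sum) simp
    then show ?thesis
      unfolding \<open>S = (n, \<tau>, \<eta>)\<close> simple_value.simps case_prod_beta' .
  qed
  with Hm have "(\<lambda>(\<omega>, s). ennreal ((simple_value S s \<omega> - H s \<omega>)\<^sup>2)) \<in> borel_measurable (M \<Otimes>\<^sub>M ?R)"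
    by (simp add: case_prod_beta' del: simple_value.simps)
  then have "(\<lambda>\<omega>. \<integral>\<^sup>+s. ennreal ((simple_value S s \<omega> - H s \<omega>)\<^sup>2) \<partial>?R) \<in> borel_measurable M"
    by (rule R.borel_measurable_nn_integral)
  then show ?thesis by (subst (asm) nn_integral_restrict_space) auto
qed

lemma ito_distance_event:
  assumes "simple_predictable F T S" "progressively_measurable F T H" "0 \<le> T"
  shows "{\<omega> \<in> space M. c < (\<integral>\<^sup>+s\<in>{0..T}. ennreal ((simple_value S s \<omega> - H s \<omega>)\<^sup>2) \<partial>lborel)} \<in> events"
proof -
  have "{\<omega> \<in> space M. c < f \<omega>} \<in> events" if "f \<in> borel_measurable M" for f :: "'a \<Rightarrow> ennreal"
    using that by measurable
  from this[OF ito_distance_measurable[OF assms]] show ?thesis .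
qed

text \<open>On a common refinement the difference is a single sum over Brownian increments, to which
  \<open>increment_sum_tail\<close> applies. The squared distance between \<open>A\<close> and
  \<open>B\<close> is at most twice the sum of their squared distances to \<open>H\<close>, so it
  can exceed \<delta> only if one of these exceeds \<delta>/4.\<close>

lemma simple_integral_diff_tail:
  assumes A: "simple_predictable F T A" and B: "simple_predictable F T B"
    and H: "progressively_measurable F T H" and T: "0 \<le> T" and pos: "0 < \<epsilon>" "0 < \<delta>"
  shows "prob {\<omega> \<in> space M. \<epsilon> < \<bar>simple_integral_wrt A W \<omega> - simple_integral_wrt B W \<omega>\<bar>}
    \<le> prob {\<omega> \<in> space M. ennreal (\<delta> / 4) < (\<integral>\<^sup>+s\<in>{0..T}. ennreal ((simple_value A s \<omega> - H s \<omega>)\<^sup>2) \<partial>lborel)}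
     + prob {\<omega> \<in> space M. ennreal (\<delta> / 4) < (\<integral>\<^sup>+s\<in>{0..T}. ennreal ((simple_value B s \<omega> - H s \<omega>)\<^sup>2) \<partial>lborel)}
     + \<delta> / \<epsilon>\<^sup>2"
    (is "_ \<le> prob {\<omega> \<in> _. _ < ?dA \<omega>} + prob {\<omega> \<in> _. _ < ?dB \<omega>} + _")
proof -
  obtain n \<tau> \<eta> where Aeq: "A = (n, \<tau>, \<eta>)" by (cases A) auto
  obtain m \<sigma> \<theta> where Beq: "B = (m, \<sigma>, \<theta>)" by (cases B) auto
  obtain N \<rho> where \<rho>: "\<And>j. j < N \<Longrightarrow> \<rho> j < \<rho> (Suc j)" and rng: "\<rho> ` {..N} = \<tau> ` {..n} \<union> \<sigma> ` {..m}"
    using ex_strict_grid[of "\<tau> ` {..n} \<union> \<sigma> ` {..m}"] by auto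
  have \<rho>le: "\<rho> i \<le> \<rho> j" if "i \<le> j" "j \<le> N" for i j
    using steps_mono[of N \<rho> i j] \<rho> that by (auto intro: less_imp_le)
  have range: "0 \<le> \<rho> j \<and> \<rho> j \<le> T" if "j \<le> N" for j
  proof -
    have "\<rho> j \<in> \<tau> ` {..n} \<union> \<sigma> ` {..m}" using rng that by auto
    then show ?thesis
      using simple_predictableD(3,4)[OF A[unfolded Aeq]] simple_predictableD(3,4)[OF B[unfolded Beq]] by auto
  qed
  define a where "a = (\<lambda>j \<omega>. simple_value A (\<rho> (Suc j)) \<omega>)"
  define b where "b = (\<lambda>j \<omega>. simple_value B (\<rho> (Suc j)) \<omega>)"
  have subA: "\<tau> ` {..n} \<subseteq> \<rho> ` {..N}" and subB: "\<sigma> ` {..m} \<subseteq> \<rho> ` {..N}" using rng by auto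
  have a_ad: "a j \<in> borel_measurable (F (\<rho> j))" and b_ad: "b j \<in> borel_measurable (F (\<rho> j))" if "j < N" for j
    using simple_value_adapted[OF A[unfolded Aeq] \<rho> subA that] simple_value_adapted[OF B[unfolded Beq] \<rho> subB that]
    unfolding a_def b_def Aeq Beq by (simp_all del: simple_value.simps)
  have diff: "simple_integral_wrt A W \<omega> - simple_integral_wrt B W \<omega>
      = (\<Sum>j<N. (a j \<omega> - b j \<omega>) * (W (\<rho> (Suc j)) \<omega> - W (\<rho> j) \<omega>))" for \<omega>
    using simple_integral_refine[of n \<tau> N \<rho> \<eta> W \<omega>, OF _ \<rho> subA]
      simple_integral_refine[of m \<sigma> N \<rho> \<theta> W \<omega>, OF _ \<rho> subB] A B
    unfolding a_def b_def Aeq Beq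
    by (simp del: simple_value.simps simple_integral_wrt.simps add: left_diff_distrib sum_subtractf)
  have le: "ennreal (\<Sum>j<N. (a j \<omega> - b j \<omega>)\<^sup>2 * (\<rho> (Suc j) - \<rho> j)) \<le> 2 * ?dA \<omega> + 2 * ?dB \<omega>"
    if \<omega>: "\<omega> \<in> space M" for \<omega>
  proof -
    let ?g = "\<lambda>s. (\<Sum>j<N. (a j \<omega> - b j \<omega>)\<^sup>2 * indicator {\<rho> j<..\<rho> (Suc j)} s) :: real"
    have "(\<Sum>j<N. (a j \<omega> - b j \<omega>)\<^sup>2 * (\<rho> (Suc j) - \<rho> j)) = (\<integral>s. ?g s \<partial>lborel)"
      using \<rho> by (subst Bochner_Integration.integral_sum) (auto intro!: sum.cong simp: less_imp_le)
    moreover have "integrable lborel ?g"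
      by (intro Bochner_Integration.integrable_sum integrable_mult_right integrable_real_indicator)
        (use \<rho> in \<open>auto simp: less_imp_le\<close>)
    ultimately have "ennreal (\<Sum>j<N. (a j \<omega> - b j \<omega>)\<^sup>2 * (\<rho> (Suc j) - \<rho> j)) = (\<integral>\<^sup>+s. ennreal (?g s) \<partial>lborel)"
      by (subst nn_integral_eq_integral) (auto intro!: sum_nonneg)
    also have "\<dots> \<le> (\<integral>\<^sup>+s. 2 * (ennreal ((simple_value A s \<omega> - H s \<omega>)\<^sup>2) * indicator {0..T} s)
        + 2 * (ennreal ((simple_value B s \<omega> - H s \<omega>)\<^sup>2) * indicator {0..T} s) \<partial>lborel)"
    proof (rule nn_integral_mono)
      fix s
      show "ennreal (?g s) \<le> 2 * (ennreal ((simple_value A s \<omega> - H s \<omega>)\<^sup>2) * indicator {0..T} s)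
        + 2 * (ennreal ((simple_value B s \<omega> - H s \<omega>)\<^sup>2) * indicator {0..T} s)"
      proof (cases "\<rho> 0 < s \<and> s \<le> \<rho> N")
        case True
        then obtain k where k: "k < N" "\<rho> k < s" "s \<le> \<rho> (Suc k)" using ex_cell[of \<rho> s N] by auto
        have "?g s = (a k \<omega> - b k \<omega>)\<^sup>2"
          using simple_value_cell[of N \<rho> k s "\<lambda>j \<omega>. (a j \<omega> - b j \<omega>)\<^sup>2" \<omega>] \<rho> k by (simp add: less_imp_le)
        moreover have "a k \<omega> = simple_value A s \<omega>" "b k \<omega> = simple_value B s \<omega>"
          unfolding a_def b_def Aeq Beq
          using simple_value_refine[OF \<rho> subA k] simple_value_refine[OF \<rho> subB k] by metis+
        moreover have "(x - y)\<^sup>2 \<le> 2 * (x - z)\<^sup>2 + 2 * (y - z)\<^sup>2" for x y z :: real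
          using zero_le_power2[of "(x - z) + (y - z)"] by (simp add: power2_eq_square algebra_simps)
        ultimately have le: "?g s \<le> 2 * (simple_value A s \<omega> - H s \<omega>)\<^sup>2 + 2 * (simple_value B s \<omega> - H s \<omega>)\<^sup>2"
          by metis
        have "s \<in> {0..T}" using range[of k] range[of "Suc k"] k by auto
        with ennreal_leI[OF le] show ?thesis
          using ennreal_double_sum[of "(simple_value A s \<omega> - H s \<omega>)\<^sup>2" "(simple_value B s \<omega> - H s \<omega>)\<^sup>2"]
          by (simp only: indicator_simps mult_1_right zero_le_power2 simp_thms)
      next
        case False
        have "indicator {\<rho> j<..\<rho> (Suc j)} s = (0::real)" if "j < N" for j
          using False \<rho>le[of 0 j] \<rho>le[of "Suc j" N] that by (auto simp: indicator_def)
        then show ?thesis by simp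
      qed
    qed
    also have "\<dots> = 2 * ?dA \<omega> + 2 * ?dB \<omega>"
    proof -
      \<comment> \<open>Splitting the integral of the sum requires measurability in time for fixed
        \<open>\<omega>\<close>, which is a section of the joint measurability at
        \<open>T\<close>.\<close>
      have Hs: "(\<lambda>s. H s \<omega>) \<in> borel_measurable (restrict_space borel {0..T})"
      proof -
        have "(\<lambda>(s, \<omega>). H s \<omega>) \<in> borel_measurable (restrict_space borel {0..T} \<Otimes>\<^sub>M F T)"
          using H T by (simp add: progressively_measurable_def)
        from measurable_compose[OF measurable_Pair2'[of \<omega> "F T"] this] show ?thesis
          using \<omega> by simp
      qed
      have "(\<lambda>s. ennreal ((simple_value C s \<omega> - H s \<omega>)\<^sup>2) * indicator {0..T} s) \<in> borel_measurable borel" for C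
      proof -
        have "(\<lambda>s. simple_value C s \<omega>) \<in> borel_measurable borel"
          by (cases C) (simp only: simple_value.simps, measurable)
        then have "(\<lambda>s. ennreal ((simple_value C s \<omega> - H s \<omega>)\<^sup>2)) \<in> borel_measurable (restrict_space borel {0..T})"
          using borel_measurable_diff[OF measurable_restrict_space1 Hs, of "\<lambda>s. simple_value C s \<omega>"] by simp
        then show ?thesis by (subst (asm) borel_measurable_restrict_space_iff_ennreal) auto
      qed
      then show ?thesis by (subst nn_integral_add) (auto simp: nn_integral_cmult)
    qed
    finally show ?thesis .
  qed
  have q: "has_bochner_integral (normal_law 0 (\<rho> (Suc i) - \<rho> i)) (\<lambda>x. x) 0"
    "has_bochner_integral (normal_law 0 (\<rho> (Suc i) - \<rho> i)) (\<lambda>x. x\<^sup>2) (\<rho> (Suc i) - \<rho> i)" if "i < N" for i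
    using \<rho>[OF that] by (intro normal_law_first_moment normal_law_second_moment; simp)+
  have "prob {\<omega> \<in> space M. \<epsilon> < \<bar>\<Sum>j<N. (a j \<omega> - b j \<omega>) * (W (\<rho> (Suc j)) \<omega> - W (\<rho> j) \<omega>)\<bar>}
    \<le> prob {\<omega> \<in> space M. \<delta> < (\<Sum>j<N. (a j \<omega> - b j \<omega>)\<^sup>2 * (\<rho> (Suc j) - \<rho> j))} + \<delta> / \<epsilon>\<^sup>2"
  proof (rule increment_sum_tail[where \<phi> = "\<lambda>_ x. x" and u = "\<lambda>j \<omega>. a j \<omega> - b j \<omega>"])
    show "0 \<le> \<rho> 0" using range[of 0] by simp
    show "\<rho> i \<le> \<rho> (Suc i)" if "i < N" for i using \<rho>[OF that] by simp
    show "(\<lambda>\<omega>. a i \<omega> - b i \<omega>) \<in> borel_measurable (F (\<rho> i))" if "i < N" for i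
      using a_ad[OF that] b_ad[OF that] by (rule borel_measurable_diff)
  qed (fact q pos)+
  also have "prob {\<omega> \<in> space M. \<delta> < (\<Sum>j<N. (a j \<omega> - b j \<omega>)\<^sup>2 * (\<rho> (Suc j) - \<rho> j))}
      \<le> prob ({\<omega> \<in> space M. ennreal (\<delta> / 4) < ?dA \<omega>} \<union> {\<omega> \<in> space M. ennreal (\<delta> / 4) < ?dB \<omega>})"
  proof (rule finite_measure_mono)
    show "{\<omega> \<in> space M. \<delta> < (\<Sum>j<N. (a j \<omega> - b j \<omega>)\<^sup>2 * (\<rho> (Suc j) - \<rho> j))}
      \<subseteq> {\<omega> \<in> space M. ennreal (\<delta> / 4) < ?dA \<omega>} \<union> {\<omega> \<in> space M. ennreal (\<delta> / 4) < ?dB \<omega>}"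
    proof (intro subsetI, rule ccontr)
      fix \<omega> assume w: "\<omega> \<in> {\<omega> \<in> space M. \<delta> < (\<Sum>j<N. (a j \<omega> - b j \<omega>)\<^sup>2 * (\<rho> (Suc j) - \<rho> j))}"
        and "\<omega> \<notin> {\<omega> \<in> space M. ennreal (\<delta> / 4) < ?dA \<omega>} \<union> {\<omega> \<in> space M. ennreal (\<delta> / 4) < ?dB \<omega>}"
      then have "?dA \<omega> \<le> ennreal (\<delta> / 4)" "?dB \<omega> \<le> ennreal (\<delta> / 4)" by (auto simp: not_less)
      then have "2 * ?dA \<omega> + 2 * ?dB \<omega> \<le> 2 * ennreal (\<delta> / 4) + 2 * ennreal (\<delta> / 4)"
        by (intro add_mono mult_left_mono) auto
      also have "\<dots> = ennreal \<delta>"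
        using pos ennreal_double_sum[of "\<delta> / 4" "\<delta> / 4"] by simp
      finally show False using le[of \<omega>] w pos by (auto simp: ennreal_le_iff dest: order_trans)
    qed
    show "{\<omega> \<in> space M. ennreal (\<delta> / 4) < ?dA \<omega>} \<union> {\<omega> \<in> space M. ennreal (\<delta> / 4) < ?dB \<omega>} \<in> events"
      by (intro sets.Un ito_distance_event[OF A H T] ito_distance_event[OF B H T])
  qed
  also have "\<dots> \<le> prob {\<omega> \<in> space M. ennreal (\<delta> / 4) < ?dA \<omega>} + prob {\<omega> \<in> space M. ennreal (\<delta> / 4) < ?dB \<omega>}"
    by (intro measure_Un_le ito_distance_event[OF A H T] ito_distance_event[OF B H T])
  finally show ?thesis unfolding diff by simp
qed

end

section \<open>Uniform grids\<close>

definition grid :: "real \<Rightarrow> nat \<Rightarrow> nat \<Rightarrow> real" where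
  "grid T n i = T * real i / real n"

text \<open>For \<open>n = 0\<close> division by zero puts all points at 0, so the step formula and
  the bounds hold for every \<open>n\<close>; sums over \<open>i<n\<close> are then empty.\<close>

lemma grid_0 [simp]: "grid T n 0 = 0"
  and grid_end [simp]: "0 < n \<Longrightarrow> grid T n n = T"
  and grid_step: "grid T n (Suc i) - grid T n i = T / real n"
  by (auto simp: grid_def distrib_left add_divide_distrib)

lemma grid_nonneg: "0 \<le> T \<Longrightarrow> 0 \<le> grid T n i"
  by (simp add: grid_def)

lemma grid_Suc_le: "0 \<le> T \<Longrightarrow> grid T n i \<le> grid T n (Suc i)"
  using grid_step[of T n i] by (metis diff_ge_0_iff_ge divide_nonneg_nonneg of_nat_0_le_iff)

lemma grid_le: "0 \<le> T \<Longrightarrow> i \<le> n \<Longrightarrow> grid T n i \<le> T"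
  using steps_mono[of n "grid T n" i n] grid_Suc_le[of T n] by (cases "n = 0") auto

lemma grid_mem: "0 \<le> T \<Longrightarrow> i \<le> n \<Longrightarrow> grid T n i \<in> {0..T}"
  using grid_nonneg grid_le by simp

lemma uniform_on_grid:
  fixes u :: "real \<Rightarrow> real"
  assumes u: "continuous_on {0..T} u" and T: "0 \<le> T" and e: "0 < e"
  shows "\<forall>\<^sub>F n in sequentially. \<forall>i<n. \<forall>s\<in>{grid T n i..grid T n (Suc i)}. \<forall>s'\<in>{grid T n i..grid T n (Suc i)}.
      \<bar>u s - u s'\<bar> < e"
proof -
  have "uniformly_continuous_on {0..T} u"
    using u by (intro compact_uniformly_continuous) auto
  then obtain d where d: "0 < d" "\<And>x y. x \<in> {0..T} \<Longrightarrow> y \<in> {0..T} \<Longrightarrow> dist y x < d \<Longrightarrow> dist (u y) (u x) < e"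
    using e unfolding uniformly_continuous_on_def by metis
  have "(\<lambda>n. T / real n) \<longlonglongrightarrow> 0" by (rule lim_const_over_n)
  then have "\<forall>\<^sub>F n in sequentially. T / real n < d" using d(1) by (rule order_tendstoD)
  then show ?thesis
  proof eventually_elim
    case (elim n)
    show ?case
    proof (intro allI impI ballI)
      fix i s s' assume i: "i < n" and s: "s \<in> {grid T n i..grid T n (Suc i)}" "s' \<in> {grid T n i..grid T n (Suc i)}"
      have "s \<in> {0..T}" "s' \<in> {0..T}"
        using s grid_nonneg[OF T, of n i] grid_le[OF T, of "Suc i" n] i by auto
      moreover have "dist s s' < d" using s elim grid_step[of T n i] by (auto simp: dist_real_def)
      ultimately show "\<bar>u s - u s'\<bar> < e" using d(2) by (auto simp: dist_real_def)
    qed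
  qed
qed

section \<open>Left Riemann sums approximate the Ito integral\<close>

context brownian
begin

definition riemann_sum :: "(real \<Rightarrow> 'a \<Rightarrow> real) \<Rightarrow> real \<Rightarrow> nat \<Rightarrow> 'a \<Rightarrow> real" where
  "riemann_sum H T n \<omega> = (\<Sum>i<n. H (grid T n i) \<omega> * (W (grid T n (Suc i)) \<omega> - W (grid T n i) \<omega>))"

lemma progressively_measurable_adapted:
  assumes "progressively_measurable F T H" "t \<in> {0..T}"
  shows "H t \<in> borel_measurable (F t)"
proof -
  have "(\<lambda>(s, \<omega>). H s \<omega>) \<in> borel_measurable (restrict_space borel {0..t} \<Otimes>\<^sub>M F t)"
    using assms by (simp add: progressively_measurable_def)
  from measurable_compose[OF measurable_Pair1'[of t "restrict_space borel {0..t}" "F t"] this] show ?thesis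
    using assms by (simp add: space_restrict_space)
qed

lemma riemann_sum_measurable:
  assumes "\<And>t. t \<in> {0..T} \<Longrightarrow> H t \<in> borel_measurable (F t)" "0 \<le> T"
  shows "riemann_sum H T n \<in> borel_measurable M"
proof -
  have "H (grid T n i) \<in> borel_measurable M" if "i < n" for i
    using assms(1)[OF grid_mem, THEN measurable_F] assms(2) that by auto
  moreover have "W (grid T n i) \<in> borel_measurable M" for i
    using grid_nonneg[OF assms(2)] by (intro W_measurable)
  ultimately show ?thesis
    unfolding riemann_sum_def[abs_def]
    by (intro borel_measurable_sum borel_measurable_times borel_measurable_diff) auto
qed

text \<open>The step functions of a continuous integrand and the given sequence both approach
  \<open>H\<close> in L^2[0, T] in probability, so their integrals have vanishing distance and share
  the limit \<open>I\<close>.\<close>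

lemma has_ito_integral_riemann_sum:
  assumes I: "has_ito_integral M F W H T I" and T: "0 \<le> T"
    and cont: "AE \<omega> in M. continuous_on {0..T} (\<lambda>t. H t \<omega>)"
  shows "conv_prob M (riemann_sum H T) I"
proof -
  obtain S where S: "\<And>k. simple_predictable F T (S k)"
    and dS: "null_in_prob M (\<lambda>k \<omega>. \<integral>\<^sup>+s\<in>{0..T}. ennreal ((simple_value (S k) s \<omega> - H s \<omega>)\<^sup>2) \<partial>lborel)"
    and lim: "null_in_prob M (\<lambda>k \<omega>. ennreal \<bar>simple_integral_wrt (S k) W \<omega> - I \<omega>\<bar>)"
    and H: "progressively_measurable F T H" and [measurable]: "I \<in> borel_measurable M"
    using I unfolding has_ito_integral_def by blast
  have H_ad: "H t \<in> borel_measurable (F t)" if "t \<in> {0..T}" for t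
    using progressively_measurable_adapted[OF H that] .
  \<comment> \<open>Simple integrands need bounded coefficients, whereas \<open>H\<close> is only
    bounded path by path. Clamping at level \<open>n\<close> is adapted and, for each continuous
    path, inactive from some \<open>n\<close> on.\<close>
  define clamp where "clamp = (\<lambda>n x. max (- real n) (min (real n) x))"
  define C where "C = (\<lambda>n. (n, grid T n, \<lambda>i \<omega>. clamp n (H (grid T n i) \<omega>)))"
  have C: "simple_predictable F T (C n)" for n
    unfolding C_def simple_predictable.simps
  proof (intro conjI allI impI)
    fix i assume "i < n"
    then have [measurable]: "H (grid T n i) \<in> borel_measurable (F (grid T n i))"
      using grid_mem[OF T] by (intro H_ad) auto
    show "(\<lambda>\<omega>. clamp n (H (grid T n i) \<omega>)) \<in> borel_measurable (F (grid T n i))"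
      unfolding clamp_def by measurable
    show "\<exists>K. \<forall>\<omega>\<in>space (F (grid T n i)). \<bar>clamp n (H (grid T n i) \<omega>)\<bar> \<le> K"
      by (intro exI[of _ "real n"]) (auto simp: clamp_def)
  qed (use T grid_Suc_le[OF T] grid_le[OF T, of n n] in auto)
  have clamp_eq: "\<forall>\<^sub>F n in sequentially. \<forall>s\<in>{0..T}. clamp n (H s \<omega>) = H s \<omega>"
    if "continuous_on {0..T} (\<lambda>t. H t \<omega>)" for \<omega>
  proof -
    have "bounded ((\<lambda>t. H t \<omega>) ` {0..T})"
      using that by (intro compact_imp_bounded compact_continuous_image) auto
    then obtain B where B: "\<And>s. s \<in> {0..T} \<Longrightarrow> \<bar>H s \<omega>\<bar> \<le> B"
      unfolding bounded_iff real_norm_def by (metis imageI)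
    obtain m where "B \<le> real m" using real_arch_simple by blast
    then show ?thesis
      unfolding eventually_sequentially clamp_def using B by (intro exI[of _ m]) force
  qed
  let ?d = "\<lambda>A \<omega>. \<integral>\<^sup>+s\<in>{0..T}. ennreal ((simple_value A s \<omega> - H s \<omega>)\<^sup>2) \<partial>lborel"
  have dC: "(\<lambda>n. prob {\<omega> \<in> space M. ennreal \<delta> < ?d (C n) \<omega>}) \<longlonglongrightarrow> 0" if "0 < \<delta>" for \<delta>
  proof (rule AE_imp_prob_tendsto_0)
    show "{\<omega> \<in> space M. ennreal \<delta> < ?d (C n) \<omega>} \<in> events" for n
      by (rule ito_distance_event[OF C H T])
    show "AE \<omega> in M. \<forall>\<^sub>F n in sequentially. \<omega> \<notin> {\<omega> \<in> space M. ennreal \<delta> < ?d (C n) \<omega>}"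
      using cont
    proof eventually_elim
      case (elim \<omega>)
      \<comment> \<open>An oscillation of at most \<open>e\<close> per cell costs
        \<open>e\<^sup>2 * T\<close> in squared distance; the summand 1 covers
        \<open>T = 0\<close>.\<close>
      define e where "e = sqrt (\<delta> / (T + 1))"
      have e: "0 < e" "e\<^sup>2 * T \<le> \<delta>" using T that by (auto simp: e_def field_simps)
      show ?case using uniform_on_grid[OF elim T e(1)] clamp_eq[OF elim] eventually_gt_at_top[of 0]
      proof eventually_elim
        case (elim n)
        have "?d (C n) \<omega> \<le> (\<integral>\<^sup>+s. ennreal (e\<^sup>2) * indicator {0..T} s \<partial>lborel)"
        proof (rule nn_integral_mono_AE)
          show "AE s in lborel. ennreal ((simple_value (C n) s \<omega> - H s \<omega>)\<^sup>2) * indicator {0..T} s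
            \<le> ennreal (e\<^sup>2) * indicator {0..T} s"
            \<comment> \<open>The cells exclude their left end points, so the time 0 lies in none of
              them.\<close>
            using AE_lborel_singleton[of 0]
          proof eventually_elim
            case (elim s)
            show ?case
            proof (cases "s \<in> {0..T}")
              case True
              then have "grid T n 0 < s" "s \<le> grid T n n" using elim \<open>0 < n\<close> by auto
              then obtain k where k: "k < n" "grid T n k < s" "s \<le> grid T n (Suc k)"
                using ex_cell[of "grid T n" s n] by auto
              have "simple_value (C n) s \<omega> = clamp n (H (grid T n k) \<omega>)"
                unfolding C_def by (rule simple_value_cell) (use k grid_Suc_le[OF T] in auto)
              also have "\<dots> = H (grid T n k) \<omega>"
                using \<open>\<forall>s\<in>{0..T}. clamp n (H s \<omega>) = H s \<omega>\<close> grid_mem[OF T, of k n] k by auto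
              finally have "\<bar>simple_value (C n) s \<omega> - H s \<omega>\<bar> \<le> e"
                using \<open>\<forall>i<n. _ i\<close>[rule_format, of k "grid T n k" s] k by auto
              then have "(simple_value (C n) s \<omega> - H s \<omega>)\<^sup>2 \<le> e\<^sup>2"
                by (metis abs_ge_zero power2_abs power_mono)
              then show ?thesis using True by (simp add: ennreal_leI del: simple_value.simps)
            qed simp
          qed
        qed
        also have "\<dots> = ennreal (e\<^sup>2 * T)"
          using T by (simp add: nn_integral_cmult ennreal_mult)
        also have "\<dots> \<le> ennreal \<delta>" using e by (intro ennreal_leI)
        finally show ?case by (simp add: not_less)
      qed
    qed
  qed
  have dS': "(\<lambda>k. prob {\<omega> \<in> space M. ennreal \<delta> < ?d (S k) \<omega>}) \<longlonglongrightarrow> 0" if "0 < \<delta>" for \<delta>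
    using dS that by (simp add: null_in_prob_def)
  have mC [measurable]: "simple_integral_wrt (C n) W \<in> borel_measurable M"
    and mS [measurable]: "simple_integral_wrt (S n) W \<in> borel_measurable M" for n
    using simple_integral_measurable C S by auto
  have "conv_prob M (\<lambda>n \<omega>. simple_integral_wrt (C n) W \<omega> - simple_integral_wrt (S n) W \<omega>) (\<lambda>\<omega>. 0)"
  proof (subst conv_prob_iff_prob)
    show "\<forall>\<epsilon>>0. (\<lambda>n. prob {\<omega> \<in> space M. \<epsilon> < \<bar>simple_integral_wrt (C n) W \<omega> - simple_integral_wrt (S n) W \<omega> - 0\<bar>}) \<longlonglongrightarrow> 0"
    proof (intro allI impI LIMSEQ_I)
      fix \<epsilon> r :: real assume pos: "0 < \<epsilon>" "0 < r"
      \<comment> \<open>Half of the allowance \<open>r\<close> goes to the Chebyshev term, the other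
        half to the two distances.\<close>
      define \<delta> where "\<delta> = \<epsilon>\<^sup>2 * r / 2"
      have \<delta>: "0 < \<delta>" "\<delta> / \<epsilon>\<^sup>2 = r / 2" using pos by (auto simp: \<delta>_def)
      have "(\<lambda>n. prob {\<omega> \<in> space M. ennreal (\<delta> / 4) < ?d (C n) \<omega>} + prob {\<omega> \<in> space M. ennreal (\<delta> / 4) < ?d (S n) \<omega>}) \<longlonglongrightarrow> 0 + 0"
        using \<delta> by (intro tendsto_add dC dS') auto
      then have "\<forall>\<^sub>F n in sequentially. prob {\<omega> \<in> space M. ennreal (\<delta> / 4) < ?d (C n) \<omega>} + prob {\<omega> \<in> space M. ennreal (\<delta> / 4) < ?d (S n) \<omega>} < r / 2"
        using pos by (intro order_tendstoD) auto
      then have "\<forall>\<^sub>F n in sequentially. prob {\<omega> \<in> space M. \<epsilon> < \<bar>simple_integral_wrt (C n) W \<omega> - simple_integral_wrt (S n) W \<omega>\<bar>} < r"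
      proof eventually_elim
        case (elim n)
        then show ?case
          using simple_integral_diff_tail[OF C S H T pos(1) \<delta>(1), of n n] \<delta>(2) by linarith
      qed
      then show "\<exists>no. \<forall>n\<ge>no. norm (prob {\<omega> \<in> space M. \<epsilon> < \<bar>simple_integral_wrt (C n) W \<omega> - simple_integral_wrt (S n) W \<omega> - 0\<bar>} - 0) < r"
        by (auto simp: eventually_sequentially)
    qed
  qed auto
  moreover have "conv_prob M (\<lambda>n. simple_integral_wrt (S n) W) I"
    using lim by (subst conv_prob_iff_prob) (auto simp: null_in_prob_def ennreal_less_iff)
  ultimately have CI: "conv_prob M (\<lambda>n. simple_integral_wrt (C n) W) I"
    using conv_prob_add by fastforce
  have mR [measurable]: "riemann_sum H T n \<in> borel_measurable M" for n
    using H_ad T by (rule riemann_sum_measurable)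
  have "conv_prob M (\<lambda>n \<omega>. riemann_sum H T n \<omega> - simple_integral_wrt (C n) W \<omega>) (\<lambda>\<omega>. 0)"
  proof (rule conv_prob_AE)
    show "AE \<omega> in M. (\<lambda>n. riemann_sum H T n \<omega> - simple_integral_wrt (C n) W \<omega>) \<longlonglongrightarrow> 0"
      using cont
    proof eventually_elim
      case (elim \<omega>)
      have "\<forall>\<^sub>F n in sequentially. riemann_sum H T n \<omega> - simple_integral_wrt (C n) W \<omega> = 0"
        using clamp_eq[OF elim]
      proof eventually_elim
        case (elim n)
        then show ?case using grid_mem[OF T, of _ n] by (simp add: riemann_sum_def C_def)
      qed
      then show ?case by (rule tendsto_eventually)
    qed
  qed auto
  from conv_prob_add[OF this CI] show ?thesis by simp
qed

end

section \<open>Riemann--Stieltjes sums and the exponential martingale\<close>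

lemma integral_grid_sum:
  fixes v :: "real \<Rightarrow> real"
  assumes v: "v integrable_on {0..T}" and T: "0 \<le> T" and n: "0 < n"
  shows "integral {0..T} v = (\<Sum>i<n. integral {grid T n i..grid T n (Suc i)} v)"
proof -
  have "integral {0..grid T n m} v = (\<Sum>i<m. integral {grid T n i..grid T n (Suc i)} v)" if "m \<le> n" for m
    using that
  proof (induction m)
    case (Suc m)
    have "v integrable_on {0..grid T n (Suc m)}"
      by (rule integrable_on_subinterval[OF v]) (use grid_le[OF T, of "Suc m" n] Suc.prems in auto)
    then have "integral {0..grid T n (Suc m)} v = integral {0..grid T n m} v + integral {grid T n m..grid T n (Suc m)} v"
      using grid_nonneg[OF T] grid_Suc_le[OF T]
      by (intro Henstock_Kurzweil_Integration.integral_combine[symmetric]) auto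
    with Suc show ?case by simp
  qed simp
  from this[of n] n show ?thesis by simp
qed

text \<open>On each cell the increment of \<open>f\<close> is the integral of \<open>f'\<close>, so
  the error is the integral of \<open>(u (c n i) - u s) * f' s\<close>, small by uniform continuity
  of \<open>u\<close>. The evaluation points are free because means use left end points and
  summation by parts uses right ones; \<open>u\<close> needs no bounded variation.\<close>

lemma stieltjes_sum_tendsto:
  fixes u f f' :: "real \<Rightarrow> real"
  assumes u: "continuous_on {0..T} u" and T: "0 \<le> T"
    and f: "\<And>x. (f has_real_derivative f' x) (at x)" and f': "continuous_on UNIV f'"
    and c: "\<And>n i. i < n \<Longrightarrow> c n i \<in> {grid T n i..grid T n (Suc i)}"
  shows "(\<lambda>n. \<Sum>i<n. u (c n i) * (f (grid T n (Suc i)) - f (grid T n i)))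
    \<longlonglongrightarrow> integral {0..T} (\<lambda>s. u s * f' s)"
proof (rule LIMSEQ_I)
  fix r :: real assume r: "0 < r"
  have "bounded (f' ` {0..T})"
    by (intro compact_imp_bounded compact_continuous_image continuous_on_subset[OF f']) auto
  then obtain K where K: "\<And>s. s \<in> {0..T} \<Longrightarrow> \<bar>f' s\<bar> \<le> K"
    unfolding bounded_iff real_norm_def by (metis imageI)
  have K0: "0 \<le> K" using K[of 0] T by auto
  \<comment> \<open>The errors of all cells add up to at most \<open>e * K * T\<close>, which this
    choice keeps below \<open>r\<close> even if \<open>K * T\<close> is zero.\<close>
  define e where "e = r / (K * T + 1)"
  have "0 < K * T + 1" using K0 T by (simp add: add_nonneg_pos)
  then have e: "0 < e" "e * K * T < r"
    using r by (auto simp: e_def field_simps)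
  have cont: "continuous_on {0..T} (\<lambda>s. u s * f' s)"
    by (intro continuous_on_mult u continuous_on_subset[OF f']) auto
  have "\<forall>\<^sub>F n in sequentially. norm ((\<Sum>i<n. u (c n i) * (f (grid T n (Suc i)) - f (grid T n i)))
      - integral {0..T} (\<lambda>s. u s * f' s)) < r"
    using uniform_on_grid[OF u T e(1)] eventually_gt_at_top[of 0]
  proof eventually_elim
    case (elim n)
    let ?I = "\<lambda>i. {grid T n i..grid T n (Suc i)}"
    have sub: "?I i \<subseteq> {0..T}" if "i < n" for i
      using grid_nonneg[OF T, of n i] grid_le[OF T, of "Suc i" n] that by auto
    have cell: "\<bar>u (c n i) * (f (grid T n (Suc i)) - f (grid T n i)) - integral (?I i) (\<lambda>s. u s * f' s)\<bar> \<le> e * K * (T / n)"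
      if i: "i < n" for i
    proof -
      have ftc: "(f' has_integral (f (grid T n (Suc i)) - f (grid T n i))) (?I i)"
        using grid_Suc_le[OF T]
        by (intro fundamental_theorem_of_calculus)
          (auto intro!: has_field_derivative_at_within f simp flip: has_real_derivative_iff_has_vector_derivative)
      have int: "(\<lambda>s. u s * f' s) integrable_on ?I i"
        by (intro integrable_continuous_real continuous_on_subset[OF cont sub[OF i]])
      have "((\<lambda>s. u (c n i) * f' s - u s * f' s) has_integral
          (u (c n i) * (f (grid T n (Suc i)) - f (grid T n i)) - integral (?I i) (\<lambda>s. u s * f' s))) (?I i)"
        by (intro has_integral_diff has_integral_mult_right ftc integrable_integral int)
      moreover have "norm (u (c n i) * f' s - u s * f' s) \<le> e * K" if s: "s \<in> ?I i" for s
      proof -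
        have "\<bar>u (c n i) - u s\<bar> \<le> e" using elim(1) i s c[OF i] by (auto intro: less_imp_le)
        moreover have "\<bar>f' s\<bar> \<le> K" using K sub[OF i] s by blast
        ultimately have "\<bar>u (c n i) - u s\<bar> * \<bar>f' s\<bar> \<le> e * K" using e by (intro mult_mono) auto
        then show ?thesis by (simp add: abs_mult flip: left_diff_distrib)
      qed
      ultimately have "norm (u (c n i) * (f (grid T n (Suc i)) - f (grid T n i)) - integral (?I i) (\<lambda>s. u s * f' s))
          \<le> e * K * measure lborel (?I i)"
        using e K0 by (intro has_integral_bound_real[of "e * K" "{}"]) auto
      then show ?thesis using grid_Suc_le[OF T, of n i] grid_step[of T n i] by simp
    qed
    have "\<bar>(\<Sum>i<n. u (c n i) * (f (grid T n (Suc i)) - f (grid T n i))) - integral {0..T} (\<lambda>s. u s * f' s)\<bar>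
       = \<bar>\<Sum>i<n. u (c n i) * (f (grid T n (Suc i)) - f (grid T n i)) - integral (?I i) (\<lambda>s. u s * f' s)\<bar>"
      using integral_grid_sum[OF integrable_continuous_real[OF cont] T elim(2)] by (simp add: sum_subtractf)
    also have "\<dots> \<le> (\<Sum>i<n. e * K * (T / n))"
      by (rule order_trans[OF sum_abs]) (intro sum_mono, use cell in auto)
    also have "\<dots> = e * K * T" using elim(2) by simp
    finally show ?case using e by simp
  qed
  then show "\<exists>no. \<forall>n\<ge>no. norm ((\<Sum>i<n. u (c n i) * (f (grid T n (Suc i)) - f (grid T n i)))
      - integral {0..T} (\<lambda>s. u s * f' s)) < r"
    by (simp add: eventually_sequentially)
qed

lemma riemann_mean_tendsto:
  fixes u :: "real \<Rightarrow> real"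
  assumes "continuous_on {0..T} u" "0 \<le> T"
  shows "(\<lambda>n. T / real n * (\<Sum>i<n. u (grid T n i))) \<longlonglongrightarrow> integral {0..T} u"
proof -
  have "(\<lambda>n. \<Sum>i<n. u (grid T n i) * (grid T n (Suc i) - grid T n i)) \<longlonglongrightarrow> integral {0..T} (\<lambda>s. u s * 1)"
    using assms grid_Suc_le[of T] by (intro stieltjes_sum_tendsto[where c = "grid T"]) (auto intro!: derivative_eq_intros)
  then show ?thesis by (simp add: grid_step sum_distrib_left mult.commute)
qed

section \<open>The exponential martingale and geometric Brownian motion\<close>

context brownian
begin

text \<open>The coefficients have no moments, so the isometry alone is not enough. Each path of
  \<open>u\<close> is bounded and \<open>q n\<close> is of order n^(-2), hence the sum of
  \<open>u\<^sup>2 * q\<close> tends to 0 pathwise, and the tail bound carries this over to the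
  remainder sum.\<close>

lemma exp_remainder_sum_tendsto_0:
  assumes ad: "\<And>t. t \<in> {0..T} \<Longrightarrow> u t \<in> borel_measurable (F t)" and T: "0 \<le> T"
    and cont: "AE \<omega> in M. continuous_on {0..T} (\<lambda>t. u t \<omega> :: real)"
  shows "conv_prob M (\<lambda>n \<omega>. \<Sum>i<n. u (grid T n i) \<omega>
      * exp_remainder \<alpha> (T / n) (W (grid T n (Suc i)) \<omega> - W (grid T n i) \<omega>)) (\<lambda>\<omega>. 0)"
    (is "conv_prob M ?R _")
proof -
  define q where "q = (\<lambda>n. exp (\<alpha>\<^sup>2 * (T / real n)) - 1 - \<alpha>\<^sup>2 * (T / real n))"
  have step: "0 \<le> T / real n" for n using T by simp
  have ug: "u (grid T n i) \<in> borel_measurable (F (grid T n i))" if "i < n" for n i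
    using grid_mem[OF T] that by (intro ad) auto
  have ugM: "u (grid T n i) \<in> borel_measurable M" if "i < n" for n i
    using ug[OF that] by (rule measurable_F)
  have Wg: "W (grid T n i) \<in> borel_measurable M" for n i using grid_nonneg[OF T] by (intro W_measurable)
  have R: "?R n \<in> borel_measurable M" for n
    by (intro borel_measurable_sum borel_measurable_times measurable_compose[OF _ measurable_exp_remainder]
        borel_measurable_diff Wg) (use ugM in auto)
  have lim: "(\<lambda>n. prob {\<omega> \<in> space M. \<delta> < (\<Sum>i<n. (u (grid T n i) \<omega>)\<^sup>2 * q n)}) \<longlonglongrightarrow> 0" if \<delta>: "0 < \<delta>" for \<delta>
  proof (rule AE_imp_prob_tendsto_0)
    have "(\<lambda>\<omega>. \<Sum>i<n. (u (grid T n i) \<omega>)\<^sup>2 * q n) \<in> borel_measurable M" for n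
      by (intro borel_measurable_sum borel_measurable_times borel_measurable_power) (use ugM in auto)
    then show "{\<omega> \<in> space M. \<delta> < (\<Sum>i<n. (u (grid T n i) \<omega>)\<^sup>2 * q n)} \<in> events" for n
      by measurable
    show "AE \<omega> in M. \<forall>\<^sub>F n in sequentially. \<omega> \<notin> {\<omega> \<in> space M. \<delta> < (\<Sum>i<n. (u (grid T n i) \<omega>)\<^sup>2 * q n)}"
      using cont
    proof eventually_elim
      case (elim \<omega>)
      have "bounded ((\<lambda>t. u t \<omega>) ` {0..T})"
        using elim by (intro compact_imp_bounded compact_continuous_image) auto
      then obtain B where B: "\<And>s. s \<in> {0..T} \<Longrightarrow> \<bar>u s \<omega>\<bar> \<le> B"
        unfolding bounded_iff real_norm_def by (metis imageI)
      have "(\<lambda>n. \<alpha>\<^sup>2 * T / real n) \<longlonglongrightarrow> 0" "(\<lambda>n. B\<^sup>2 * (\<alpha>\<^sup>2 * T)\<^sup>2 / real n) \<longlonglongrightarrow> 0"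
        by (rule lim_const_over_n)+
      then have "\<forall>\<^sub>F n in sequentially. \<alpha>\<^sup>2 * T / real n < 1" "\<forall>\<^sub>F n in sequentially. B\<^sup>2 * (\<alpha>\<^sup>2 * T)\<^sup>2 / real n < \<delta>"
        using \<delta> by (auto intro: order_tendstoD)
      then show ?case using eventually_gt_at_top[of 0]
      proof eventually_elim
        case (elim n)
        \<comment> \<open>From 1 + x \<le> e^x \<le> 1 + x + x^2 on [0, 1]; the mesh is already fine
          enough for x \<le> 1.\<close>
        have q: "0 \<le> q n" "q n \<le> (\<alpha>\<^sup>2 * T / n)\<^sup>2"
        proof -
          define x where "x = \<alpha>\<^sup>2 * T / n"
          have x: "0 \<le> x" "x \<le> 1" "q n = exp x - 1 - x" using elim(1) T by (auto simp: x_def q_def)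
          show "0 \<le> q n" "q n \<le> (\<alpha>\<^sup>2 * T / n)\<^sup>2"
            using exp_ge_add_one_self[of x] exp_bound[OF x(1,2)] x(3) unfolding x_def[symmetric] by linarith+
        qed
        have "(\<Sum>i<n. (u (grid T n i) \<omega>)\<^sup>2 * q n) \<le> (\<Sum>i<n. B\<^sup>2 * (\<alpha>\<^sup>2 * T / n)\<^sup>2)"
        proof (intro sum_mono mult_mono q)
          fix i assume "i \<in> {..<n}"
          then have "\<bar>u (grid T n i) \<omega>\<bar> \<le> B" using grid_mem[OF T, of i n] by (intro B) auto
          then show "(u (grid T n i) \<omega>)\<^sup>2 \<le> B\<^sup>2" by (metis abs_ge_zero power2_abs power_mono)
        qed auto
        also have "\<dots> = B\<^sup>2 * (\<alpha>\<^sup>2 * T)\<^sup>2 / real n"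
          using elim(3) by (simp add: power2_eq_square field_simps)
        also have "\<dots> < \<delta>" by (fact elim)
        finally show ?case by simp
      qed
    qed
  qed
  have tail: "prob {\<omega> \<in> space M. \<epsilon> < \<bar>?R n \<omega>\<bar>}
      \<le> prob {\<omega> \<in> space M. \<delta> < (\<Sum>i<n. (u (grid T n i) \<omega>)\<^sup>2 * q n)} + \<delta> / \<epsilon>\<^sup>2" if "0 < \<epsilon>" "0 < \<delta>" for \<epsilon> \<delta> n
  proof (rule increment_sum_tail[where u = "\<lambda>i. u (grid T n i)" and \<phi> = "\<lambda>_. exp_remainder \<alpha> (T / n)"
        and q = "\<lambda>_. q n" and \<tau> = "grid T n"])
    show "has_bochner_integral (normal_law 0 (grid T n (Suc i) - grid T n i)) (exp_remainder \<alpha> (T / n)) 0" for i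
      unfolding grid_step by (rule exp_remainder_mean[OF step])
    show "has_bochner_integral (normal_law 0 (grid T n (Suc i) - grid T n i)) (\<lambda>x. (exp_remainder \<alpha> (T / n) x)\<^sup>2) (q n)" for i
      unfolding grid_step q_def by (rule exp_remainder_variance[OF step])
  qed (use that ug grid_Suc_le[OF T] in auto)
  show ?thesis
  proof (subst conv_prob_iff_prob[OF R borel_measurable_const], intro allI impI LIMSEQ_I)
    fix \<epsilon> r :: real assume pos: "0 < \<epsilon>" "0 < r"
    define \<delta> where "\<delta> = \<epsilon>\<^sup>2 * r / 2"
    have \<delta>: "0 < \<delta>" "\<delta> / \<epsilon>\<^sup>2 = r / 2" using pos by (auto simp: \<delta>_def)
    have "\<forall>\<^sub>F n in sequentially. prob {\<omega> \<in> space M. \<delta> < (\<Sum>i<n. (u (grid T n i) \<omega>)\<^sup>2 * q n)} < r / 2"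
      using lim[OF \<delta>(1)] pos by (intro order_tendstoD(2)) auto
    then have "\<forall>\<^sub>F n in sequentially. prob {\<omega> \<in> space M. \<epsilon> < \<bar>?R n \<omega>\<bar>} < r"
    proof eventually_elim
      case (elim n)
      then show ?case using tail[OF pos(1) \<delta>(1), of n] \<delta>(2) by linarith
    qed
    then show "\<exists>no. \<forall>n\<ge>no. norm (prob {\<omega> \<in> space M. \<epsilon> < \<bar>?R n \<omega> - 0\<bar>} - 0) < r"
      by (auto simp: eventually_sequentially)
  qed
qed

text \<open>The solution of dE = g E dt + \<alpha> E dW that starts at 1. The smooth growth factor
  and the martingale factor stay apart because their increments are treated by different
  means.\<close>

definition geometric_bm :: "real \<Rightarrow> real \<Rightarrow> real \<Rightarrow> 'a \<Rightarrow> real" where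
  "geometric_bm \<alpha> g t \<omega> = exp (g * t) * exp (\<alpha> * W t \<omega> - \<alpha>\<^sup>2 * t / 2)"

lemma geometric_bm_adapted: "0 \<le> t \<Longrightarrow> geometric_bm \<alpha> g t \<in> borel_measurable (F t)"
  using W_adapted[of t] unfolding geometric_bm_def[abs_def] by measurable

lemma geometric_bm_continuous: "AE \<omega> in M. continuous_on {0..} (\<lambda>t. geometric_bm \<alpha> g t \<omega>)"
  using W_continuous by eventually_elim (auto simp: geometric_bm_def intro!: continuous_intros)

text \<open>Ito's formula for \<open>geometric_bm\<close>: the increments of the martingale factor are \<open>\<alpha> \<Delta>W\<close> up to
  \<open>exp_remainder\<close>, and summation by parts accounts for the deterministic factor.\<close>

lemma geometric_bm_sde:
  assumes T: "0 \<le> T"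
  shows "conv_prob M (\<lambda>n \<omega>. g * (T / real n * (\<Sum>i<n. geometric_bm \<alpha> g (grid T n i) \<omega>))
      + \<alpha> * riemann_sum (geometric_bm \<alpha> g) T n \<omega>)
    (\<lambda>\<omega>. geometric_bm \<alpha> g T \<omega> - geometric_bm \<alpha> g 0 \<omega>)"
    (is "conv_prob M ?X ?Y")
proof -
  let ?E = "geometric_bm \<alpha> g"
  let ?m = "\<lambda>t \<omega>. exp (\<alpha> * W t \<omega> - \<alpha>\<^sup>2 * t / 2)"
  let ?Q = "\<lambda>n \<omega>. \<Sum>i<n. ?E (grid T n i) \<omega>
      * exp_remainder \<alpha> (T / n) (W (grid T n (Suc i)) \<omega> - W (grid T n i) \<omega>)"
  have E: "?E (grid T n i) \<in> borel_measurable M" "?E T \<in> borel_measurable M" "?E 0 \<in> borel_measurable M" for n i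
    using geometric_bm_adapted[THEN measurable_F] grid_nonneg[OF T] T by auto
  have Rm: "riemann_sum ?E T n \<in> borel_measurable M" for n
    by (rule riemann_sum_measurable[OF geometric_bm_adapted T]) simp
  have X: "?X n \<in> borel_measurable M" for n
    by (intro borel_measurable_add borel_measurable_times borel_measurable_const borel_measurable_sum E Rm)
  have Y: "?Y \<in> borel_measurable M" using E by (intro borel_measurable_diff)
  have Qc: "conv_prob M ?Q (\<lambda>\<omega>. 0)"
  proof (rule exp_remainder_sum_tendsto_0[OF _ T])
    show "AE \<omega> in M. continuous_on {0..T} (\<lambda>t. ?E t \<omega>)"
      using geometric_bm_continuous by eventually_elim (auto intro: continuous_on_subset)
  qed (simp add: geometric_bm_adapted)
  then have Q: "?Q n \<in> borel_measurable M" for n by (simp add: conv_prob_def)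
  have "conv_prob M (\<lambda>n \<omega>. ?Y \<omega> - ?X n \<omega> - ?Q n \<omega>) (\<lambda>\<omega>. 0)"
  proof (rule conv_prob_AE)
    show "(\<lambda>\<omega>. ?Y \<omega> - ?X n \<omega> - ?Q n \<omega>) \<in> borel_measurable M" for n
      by (rule borel_measurable_diff[OF borel_measurable_diff[OF Y X] Q])
    show "AE \<omega> in M. (\<lambda>n. ?Y \<omega> - ?X n \<omega> - ?Q n \<omega>) \<longlonglongrightarrow> 0"
      using W_continuous
    proof eventually_elim
      case (elim \<omega>)
      have cont: "continuous_on {0..T} (\<lambda>t. ?m t \<omega>)"
        using elim by (auto intro!: continuous_intros intro: continuous_on_subset)
      have contE: "continuous_on {0..T} (\<lambda>t. ?E t \<omega>)"
        unfolding geometric_bm_def by (intro continuous_on_mult cont continuous_intros)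
      have lim1: "(\<lambda>n. \<Sum>i<n. ?m (grid T n (Suc i)) \<omega> * (exp (g * grid T n (Suc i)) - exp (g * grid T n i)))
          \<longlonglongrightarrow> integral {0..T} (\<lambda>s. ?m s \<omega> * (g * exp (g * s)))"
        using cont T grid_Suc_le[OF T]
        by (intro stieltjes_sum_tendsto[where c = "\<lambda>n i. grid T n (Suc i)"])
          (auto intro!: derivative_eq_intros continuous_intros)
      have lim2: "(\<lambda>n. g * (T / real n * (\<Sum>i<n. ?E (grid T n i) \<omega>))) \<longlonglongrightarrow> g * integral {0..T} (\<lambda>s. ?E s \<omega>)"
        by (intro tendsto_mult_left riemann_mean_tendsto contE T)
      have "integral {0..T} (\<lambda>s. ?m s \<omega> * (g * exp (g * s))) = g * integral {0..T} (\<lambda>s. ?E s \<omega>)"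
        by (subst integral_mult_right[symmetric]) (simp add: geometric_bm_def mult_ac)
      with tendsto_diff[OF lim1 lim2] have "(\<lambda>n. (\<Sum>i<n. ?m (grid T n (Suc i)) \<omega> * (exp (g * grid T n (Suc i)) - exp (g * grid T n i)))
          - g * (T / real n * (\<Sum>i<n. ?E (grid T n i) \<omega>))) \<longlonglongrightarrow> 0"
        by (simp only: diff_self)
      moreover have "\<forall>\<^sub>F n in sequentially. (\<Sum>i<n. ?m (grid T n (Suc i)) \<omega> * (exp (g * grid T n (Suc i)) - exp (g * grid T n i)))
          - g * (T / real n * (\<Sum>i<n. ?E (grid T n i) \<omega>)) = ?Y \<omega> - ?X n \<omega> - ?Q n \<omega>"
        using eventually_gt_at_top[of 0]
      proof eventually_elim
        case (elim n)
        \<comment> \<open>Discrete product rule: m'e' - me = m'(e' - e) + e(m' - m), with m the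
          martingale factor and e the growth factor. The first term takes m at the right end point,
          which explains the choice of \<open>c\<close> in the Stieltjes sum.\<close>
        have step: "?E (grid T n (Suc i)) \<omega> - ?E (grid T n i) \<omega>
          = ?m (grid T n (Suc i)) \<omega> * (exp (g * grid T n (Suc i)) - exp (g * grid T n i))
           + \<alpha> * (?E (grid T n i) \<omega> * (W (grid T n (Suc i)) \<omega> - W (grid T n i) \<omega>))
           + ?E (grid T n i) \<omega> * exp_remainder \<alpha> (T / n) (W (grid T n (Suc i)) \<omega> - W (grid T n i) \<omega>)" for i
        proof -
          have "\<alpha> * W (grid T n (Suc i)) \<omega> - \<alpha>\<^sup>2 * grid T n (Suc i) / 2
            = (\<alpha> * W (grid T n i) \<omega> - \<alpha>\<^sup>2 * grid T n i / 2)
             + (\<alpha> * (W (grid T n (Suc i)) \<omega> - W (grid T n i) \<omega>) - \<alpha>\<^sup>2 * (T / n) / 2)"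
            unfolding grid_step[symmetric, of T n i] by (simp add: algebra_simps diff_divide_distrib)
          then have "?m (grid T n (Suc i)) \<omega> = ?m (grid T n i) \<omega>
             * exp (\<alpha> * (W (grid T n (Suc i)) \<omega> - W (grid T n i) \<omega>) - \<alpha>\<^sup>2 * (T / n) / 2)"
            by (simp only: exp_add)
          then show ?thesis unfolding geometric_bm_def exp_remainder_def by algebra
        qed
        have "?Y \<omega> = (\<Sum>i<n. ?E (grid T n (Suc i)) \<omega> - ?E (grid T n i) \<omega>)"
          using elim by (subst sum_lessThan_telescope) simp
        then show ?case
          unfolding step riemann_sum_def by (simp add: sum.distrib sum_distrib_left)
      qed
      ultimately show ?case by (rule Lim_transform_eventually)
    qed
  qed simp
  from conv_prob_add[OF this Qc] have "conv_prob M (\<lambda>n \<omega>. ?Y \<omega> - ?X n \<omega>) (\<lambda>\<omega>. 0)" by simp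
  from conv_prob_diff[OF conv_prob_AE[of "\<lambda>_. ?Y", OF Y Y] this] show ?thesis by simp
qed

end

section \<open>Uniqueness for linear equations\<close>

lemma (in prob_space) conv_prob_indicator:
  assumes c: "conv_prob M X Y" and A: "A \<in> events"
  shows "conv_prob M (\<lambda>n \<omega>. indicator A \<omega> * X n \<omega>) (\<lambda>\<omega>. indicator A \<omega> * Y \<omega>)"
proof (rule conv_prob_squeeze)
  have m [measurable]: "X n \<in> borel_measurable M" "Y \<in> borel_measurable M" for n
    using c by (auto simp: conv_prob_def)
  note [measurable] = A
  show "(\<lambda>\<omega>. indicator A \<omega> * X n \<omega>) \<in> borel_measurable M" "(\<lambda>\<omega>. indicator A \<omega> * Y \<omega>) \<in> borel_measurable M" for n
    by measurable
  show "(\<integral>\<omega>. min 1 \<bar>indicator A \<omega> * X n \<omega> - indicator A \<omega> * Y \<omega>\<bar> \<partial>M) \<le> (\<integral>\<omega>. min 1 \<bar>X n \<omega> - Y \<omega>\<bar> \<partial>M)" for n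
    by (intro integral_mono integrable_min_1_abs) (auto simp: indicator_def)
  show "(\<lambda>n. \<integral>\<omega>. min 1 \<bar>X n \<omega> - Y \<omega>\<bar> \<partial>M) \<longlonglongrightarrow> 0" using c by (simp add: conv_prob_def)
qed

text \<open>A left Riemann sum of an increasing function stays below its integral; here 1 + x \<le>
  e^x bounds each term by a telescoping difference. The gain 1/l is what makes the weighted estimate
  a contraction.\<close>

lemma exp_grid_sum_le:
  assumes t: "0 \<le> t" and l: "0 < l" and n: "0 < n"
  shows "t / real n * (\<Sum>i<n. exp (l * grid t n i)) \<le> exp (l * t) / l"
proof -
  have "t / real n * exp (l * grid t n i) \<le> (exp (l * grid t n (Suc i)) - exp (l * grid t n i)) / l" for i
  proof -
    have "l * grid t n (Suc i) = l * grid t n i + l * (t / n)"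
      using grid_step[of t n i] by (simp add: algebra_simps)
    then have "exp (l * grid t n (Suc i)) = exp (l * grid t n i) * exp (l * (t / n))"
      by (simp only: exp_add)
    moreover have "exp (l * grid t n i) * (1 + l * (t / n)) \<le> exp (l * grid t n i) * exp (l * (t / n))"
      by (intro mult_left_mono exp_ge_add_one_self) auto
    ultimately have "l * (t / real n * exp (l * grid t n i)) \<le> exp (l * grid t n (Suc i)) - exp (l * grid t n i)"
      by (simp add: algebra_simps)
    then show ?thesis using l by (simp only: pos_le_divide_eq mult.commute)
  qed
  then have "t / real n * (\<Sum>i<n. exp (l * grid t n i))
      \<le> (\<Sum>i<n. (exp (l * grid t n (Suc i)) - exp (l * grid t n i)) / l)"
    by (simp only: sum_distrib_left) (rule sum_mono)
  also have "\<dots> = (exp (l * grid t n n) - exp (l * grid t n 0)) / l"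
    using sum_lessThan_telescope[of "\<lambda>i. exp (l * grid t n i)" n] by (simp only: sum_divide_distrib[symmetric])
  also have "\<dots> \<le> exp (l * t) / l" using n l by (simp add: divide_right_mono)
  finally show ?thesis .
qed

section \<open>Second moments of linear equations and uniqueness\<close>

context brownian
begin

text \<open>After (x + y)^2 \<le> 2x^2 + 2y^2, Cauchy-Schwarz on the drift sum contributes 2a^2 T
  and the discrete isometry on the stochastic sum contributes 2b^2.\<close>

lemma linear_sum_second_moment:
  assumes t: "0 \<le> t" "t \<le> T" and u: "\<And>s. s \<in> {0..T} \<Longrightarrow> u s \<in> borel_measurable (F s)"
    and B: "\<And>s \<omega>. s \<in> {0..T} \<Longrightarrow> \<omega> \<in> space M \<Longrightarrow> \<bar>u s \<omega> :: real\<bar> \<le> B"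
  shows "integrable M (\<lambda>\<omega>. (a * (t / real n * (\<Sum>i<n. u (grid t n i) \<omega>)) + b * riemann_sum u t n \<omega>)\<^sup>2)"
    and "(\<integral>\<omega>. (a * (t / real n * (\<Sum>i<n. u (grid t n i) \<omega>)) + b * riemann_sum u t n \<omega>)\<^sup>2 \<partial>M)
      \<le> (2 * a\<^sup>2 * T + 2 * b\<^sup>2) * (t / real n * (\<Sum>i<n. \<integral>\<omega>. (u (grid t n i) \<omega>)\<^sup>2 \<partial>M))"
    (is "(\<integral>\<omega>. (?P \<omega> + ?Q \<omega>)\<^sup>2 \<partial>M) \<le> ?K")
proof -
  have g: "grid t n i \<in> {0..T}" if "i < n" for i using grid_mem[OF t(1), of i n] that t by auto
  have ug: "u (grid t n i) \<in> borel_measurable (F (grid t n i))" if "i < n" for i using u g that by blast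
  have ugM: "u (grid t n i) \<in> borel_measurable M" if "i < n" for i using measurable_F ug that by blast
  have int: "integrable M (\<lambda>\<omega>. (u (grid t n i) \<omega>)\<^sup>2)" if i: "i < n" for i
  proof (rule integrable_const_bound[where B = "B\<^sup>2"])
    have "(u (grid t n i) \<omega>)\<^sup>2 \<le> B\<^sup>2" if "\<omega> \<in> space M" for \<omega>
      using B[OF g[OF i] that] by (metis abs_ge_zero power2_abs power_mono)
    then show "AE \<omega> in M. norm ((u (grid t n i) \<omega>)\<^sup>2) \<le> B\<^sup>2" by auto
  qed (use ugM[OF i] in simp)
  have R: "has_bochner_integral M (\<lambda>\<omega>. (riemann_sum u t n \<omega>)\<^sup>2)
      (\<Sum>i<n. (\<integral>\<omega>. (u (grid t n i) \<omega>)\<^sup>2 \<partial>M) * (t / real n))"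
    unfolding riemann_sum_def
  proof (rule increment_sum_isometry[where \<phi> = "\<lambda>_ x. x" and u = "\<lambda>i. u (grid t n i)"])
    show "has_bochner_integral (normal_law 0 (grid t n (Suc i) - grid t n i)) (\<lambda>x. x) 0"
      "has_bochner_integral (normal_law 0 (grid t n (Suc i) - grid t n i)) (\<lambda>x. x\<^sup>2) (t / real n)" for i
      using normal_law_first_moment normal_law_second_moment t unfolding grid_step by simp_all
  qed (use ug int grid_Suc_le[OF t(1)] in auto)
  have Rm: "riemann_sum u t n \<in> borel_measurable M"
    using u t by (intro riemann_sum_measurable) auto
  have m: "?P \<in> borel_measurable M" "?Q \<in> borel_measurable M"
    using ugM Rm by (auto intro!: borel_measurable_times borel_measurable_sum)
  let ?S = "\<lambda>\<omega>. 2 * a\<^sup>2 * t * (t / real n) * (\<Sum>i<n. (u (grid t n i) \<omega>)\<^sup>2) + 2 * b\<^sup>2 * (riemann_sum u t n \<omega>)\<^sup>2"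
  have S: "integrable M ?S" using int R
    by (intro Bochner_Integration.integrable_add integrable_mult_right Bochner_Integration.integrable_sum)
      (auto simp: has_bochner_integral_iff)
  have le: "(?P \<omega> + ?Q \<omega>)\<^sup>2 \<le> ?S \<omega>" for \<omega>
  proof -
    have "(\<Sum>i<n. u (grid t n i) \<omega>)\<^sup>2 \<le> real n * (\<Sum>i<n. (u (grid t n i) \<omega>)\<^sup>2)"
      using sum_squared_le_sum_of_squares[of "\<lambda>i. u (grid t n i) \<omega>" "{..<n}"] by (simp add: mult.commute)
    then have "a\<^sup>2 * (t / real n)\<^sup>2 * (\<Sum>i<n. u (grid t n i) \<omega>)\<^sup>2
        \<le> a\<^sup>2 * (t / real n)\<^sup>2 * (real n * (\<Sum>i<n. (u (grid t n i) \<omega>)\<^sup>2))"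
      by (rule mult_left_mono) simp
    also have "\<dots> = a\<^sup>2 * t * (t / real n) * (\<Sum>i<n. (u (grid t n i) \<omega>)\<^sup>2)"
      by (cases "n = 0") (simp_all add: power2_eq_square)
    finally have "(?P \<omega>)\<^sup>2 \<le> a\<^sup>2 * t * (t / real n) * (\<Sum>i<n. (u (grid t n i) \<omega>)\<^sup>2)"
      by (simp only: power_mult_distrib mult.assoc)
    moreover have "(x + y)\<^sup>2 \<le> 2 * x\<^sup>2 + 2 * y\<^sup>2" for x y :: real
      using sum_squares_bound[of x y] by (simp add: power2_sum)
    from this[of "?P \<omega>" "?Q \<omega>"] have "(?P \<omega> + ?Q \<omega>)\<^sup>2 \<le> 2 * (?P \<omega>)\<^sup>2 + 2 * (b\<^sup>2 * (riemann_sum u t n \<omega>)\<^sup>2)"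
      by (simp only: power_mult_distrib)
    ultimately show ?thesis by linarith
  qed
  show I: "integrable M (\<lambda>\<omega>. (?P \<omega> + ?Q \<omega>)\<^sup>2)"
  proof (rule Bochner_Integration.integrable_bound[OF S])
    show "AE \<omega> in M. norm ((?P \<omega> + ?Q \<omega>)\<^sup>2) \<le> norm (?S \<omega>)"
      unfolding real_norm_def abs_power2 by (intro AE_I2 order_trans[OF le abs_ge_self])
  qed (intro borel_measurable_power borel_measurable_add m)
  have "(\<integral>\<omega>. (?P \<omega> + ?Q \<omega>)\<^sup>2 \<partial>M) \<le> (\<integral>\<omega>. ?S \<omega> \<partial>M)"
    by (intro integral_mono I S le)
  also have "\<dots> = 2 * a\<^sup>2 * t * (t / real n) * (\<Sum>i<n. \<integral>\<omega>. (u (grid t n i) \<omega>)\<^sup>2 \<partial>M)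
      + 2 * b\<^sup>2 * (\<Sum>i<n. (\<integral>\<omega>. (u (grid t n i) \<omega>)\<^sup>2 \<partial>M) * (t / real n))"
    using int R by (subst Bochner_Integration.integral_add)
      (auto simp: has_bochner_integral_iff intro!: Bochner_Integration.integrable_sum integrable_mult_right)
  also have "\<dots> = (2 * a\<^sup>2 * t + 2 * b\<^sup>2) * (t / real n * (\<Sum>i<n. \<integral>\<omega>. (u (grid t n i) \<omega>)\<^sup>2 \<partial>M))"
    by (simp only: sum_distrib_right[symmetric]) (simp add: algebra_simps add_divide_distrib)
  also have "\<dots> \<le> ?K"
    using t by (intro mult_right_mono add_right_mono mult_left_mono mult_nonneg_nonneg sum_nonneg) auto
  finally show "(\<integral>\<omega>. (?P \<omega> + ?Q \<omega>)\<^sup>2 \<partial>M) \<le> ?K" .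
qed

text \<open>Localisation to the event that \<open>D\<close> stays below \<open>C\<close> up to time \<open>t\<close>; only countably many times
  are tested, so that this event belongs to \<open>F t\<close>.\<close>

lemma linear_sde_unique_bounded:
  fixes D :: "real \<Rightarrow> 'a \<Rightarrow> real"
  assumes ad: "\<And>t. t \<in> {0..T} \<Longrightarrow> D t \<in> borel_measurable (F t)"
    and cont: "AE \<omega> in M. continuous_on {0..T} (\<lambda>t. D t \<omega>)"
    and sde: "\<And>t. t \<in> {0..T} \<Longrightarrow> conv_prob M
      (\<lambda>n \<omega>. a * (t / real n * (\<Sum>i<n. D (grid t n i) \<omega>)) + b * riemann_sum D t n \<omega>) (D t)"
    and t: "t \<in> {0..T}" and C: "0 \<le> C"
  shows "AE \<omega> in M. (\<forall>s\<in>{0..t}. \<bar>D s \<omega>\<bar> \<le> C) \<longrightarrow> D t \<omega> = 0"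
proof -
  \<comment> \<open>The point \<open>t\<close> is added to the rationals so that \<open>u t\<close>
    itself is bounded by \<open>C\<close>, also at irrational times.\<close>
  define R where "R = (\<lambda>t::real. insert t (\<rat> \<inter> {0..t}))"
  define A where "A = (\<lambda>t. {\<omega> \<in> space M. \<forall>s\<in>R t. \<bar>D s \<omega>\<bar> \<le> C})"
  define u where "u = (\<lambda>t \<omega>. D t \<omega> * indicator (A t) \<omega>)"
  define f where "f = (\<lambda>t. \<integral>\<omega>. (u t \<omega>)\<^sup>2 \<partial>M)"
  define K where "K = 2 * a\<^sup>2 * T + 2 * b\<^sup>2"
  \<comment> \<open>Gives \<open>K / l \<le> 1 / 2\<close>; the summand 1 keeps the weight positive
    for \<open>K = 0\<close>.\<close>
  define l where "l = 2 * K + 1"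
  \<comment> \<open>A weighted supremum norm of the second moments, finite because they are at most
    \<open>C\<^sup>2\<close>. It asks for no regularity of \<open>f\<close> in time, in contrast to
    an integral form of Gronwall.\<close>
  define G where "G = (SUP s\<in>{0..T}. f s * exp (- l * s))"
  have T: "0 \<le> T" using t by simp
  have K: "0 \<le> K" and l: "0 < l" using T by (auto simp: K_def l_def intro!: add_nonneg_pos)
  have A_ad: "A s \<in> sets (F s)" if s: "s \<in> {0..T}" for s
  proof -
    have "countable (R s)" unfolding R_def by (simp add: countable_rat)
    moreover have [measurable]: "D x \<in> borel_measurable (F s)" if "x \<in> R s" for x
      using that s by (auto simp: R_def intro!: measurable_F_mono[OF ad, of x s])
    ultimately have "{\<omega> \<in> space (F s). \<forall>x\<in>R s. \<bar>D x \<omega>\<bar> \<le> C} \<in> sets (F s)"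
      by measurable
    then show ?thesis by (simp add: A_def)
  qed
  have A_ev: "A s \<in> events" if "s \<in> {0..T}" for s using A_ad[OF that] sets_F by blast
  have u_ad: "u s \<in> borel_measurable (F s)" if "s \<in> {0..T}" for s
    using ad[OF that] A_ad[OF that] unfolding u_def by measurable
  have u_bd: "\<bar>u s \<omega>\<bar> \<le> C" if "s \<in> {0..T}" "\<omega> \<in> space M" for s \<omega>
    using C by (auto simp: u_def A_def R_def indicator_def)
  have u2_bd: "(u s \<omega>)\<^sup>2 \<le> C\<^sup>2" if "s \<in> {0..T}" "\<omega> \<in> space M" for s \<omega>
    using u_bd[OF that] by (metis abs_ge_zero power2_abs power_mono)
  have u2_int: "integrable M (\<lambda>\<omega>. (u s \<omega>)\<^sup>2)" if "s \<in> {0..T}" for s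
    using u2_bd[OF that] measurable_F[OF u_ad[OF that]]
    by (intro integrable_const_bound[where B = "C\<^sup>2"]) auto
  have f_bd: "f s \<le> C\<^sup>2" if s: "s \<in> {0..T}" for s
  proof -
    have "f s \<le> (\<integral>\<omega>. C\<^sup>2 \<partial>M)" unfolding f_def
      by (rule integral_mono[OF u2_int[OF s]]) (use u2_bd[OF s] in auto)
    then show ?thesis by (simp add: prob_space)
  qed
  have f_nonneg: "0 \<le> f s" for s unfolding f_def by simp
  have bdd: "bdd_above ((\<lambda>s. f s * exp (- l * s)) ` {0..T})"
  proof (rule bdd_aboveI2)
    fix s assume s: "s \<in> {0..T}"
    have "f s * exp (- l * s) \<le> C\<^sup>2 * 1"
      using s l f_bd[OF s] f_nonneg by (intro mult_mono) auto
    then show "f s * exp (- l * s) \<le> C\<^sup>2" by simp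
  qed
  have f_G: "f s \<le> G * exp (l * s)" if "s \<in> {0..T}" for s
  proof -
    have "f s * exp (- l * s) \<le> G" unfolding G_def by (rule cSUP_upper[OF that bdd])
    then have "f s * exp (- l * s) * exp (l * s) \<le> G * exp (l * s)" by (rule mult_right_mono) simp
    then show ?thesis by (simp add: mult.assoc flip: exp_add)
  qed
  have G0: "0 \<le> G" using f_G[of 0] f_nonneg[of 0] T by simp
  have step: "f s \<le> K * (G * (exp (l * s) / l))" if s: "s \<in> {0..T}" for s
  proof -
    let ?X = "\<lambda>n \<omega>. a * (s / real n * (\<Sum>i<n. u (grid s n i) \<omega>)) + b * riemann_sum u s n \<omega>"
    let ?Y = "\<lambda>n \<omega>. a * (s / real n * (\<Sum>i<n. D (grid s n i) \<omega>)) + b * riemann_sum D s n \<omega>"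
    have s0: "0 \<le> s" "s \<le> T" using s by auto
    have mom: "integrable M (\<lambda>\<omega>. (?X n \<omega>)\<^sup>2)"
      "(\<integral>\<omega>. (?X n \<omega>)\<^sup>2 \<partial>M) \<le> K * (s / real n * (\<Sum>i<n. f (grid s n i)))" for n
      unfolding K_def f_def by (rule linear_sum_second_moment[OF s0 u_ad u_bd]; assumption)+
    have um: "u (grid s n i) \<in> borel_measurable M" if "i < n" for n i
      using grid_mem[OF s0(1), of i n] that s0 by (intro measurable_F[OF u_ad]) auto
    have Xm: "?X n \<in> borel_measurable M" for n
    proof -
      have "riemann_sum u s n \<in> borel_measurable M"
        using u_ad s0 by (intro riemann_sum_measurable) auto
      then show ?thesis using um
        by (auto intro!: borel_measurable_add borel_measurable_times borel_measurable_sum)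
    qed
    have Dm: "D s \<in> borel_measurable M" using measurable_F[OF ad[OF s]] .
    have "conv_prob M (\<lambda>n \<omega>. indicator (A s) \<omega> * ?X n \<omega>) (u s)"
    proof (rule conv_prob_cong_AE[OF conv_prob_indicator[OF sde[OF s] A_ev[OF s]]])
      show "(\<lambda>\<omega>. indicator (A s) \<omega> * ?X n \<omega>) \<in> borel_measurable M" for n
        using Xm A_ev[OF s] by (intro borel_measurable_times borel_measurable_indicator)
      show "u s \<in> borel_measurable M" using measurable_F[OF u_ad[OF s]] .
      show "AE \<omega> in M. u s \<omega> = indicator (A s) \<omega> * D s \<omega>" by (simp add: u_def)
      \<comment> \<open>On \<open>A s\<close> the bound holds at rational times, hence by continuity
        on all of \<open>{0..s}\<close>. So \<omega> lies in \<open>A x\<close> for all earlier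
        \<open>x\<close>, and \<open>u\<close> agrees with \<open>D\<close> at every grid
        point.\<close>
      show "AE \<omega> in M. indicator (A s) \<omega> * ?X n \<omega> = indicator (A s) \<omega> * ?Y n \<omega>" for n
        using cont AE_space
      proof eventually_elim
        case (elim \<omega>)
        show ?case
        proof (cases "\<omega> \<in> A s")
          case True
          have "\<bar>D x \<omega>\<bar> \<le> C" if x: "x \<in> {0..s}" for x
          proof (cases "s = 0")
            case False
            have "closure ({0<..<s} \<inter> \<rat>) = closure {0<..<s}"
              by (intro closure_open_Int_superset) (auto simp: Rats_closure_real)
            then have "x \<in> closure ({0<..<s} \<inter> \<rat>)"
              using x False s0 by (simp add: closure_greaterThanLessThan)
            moreover have "continuous_on (closure ({0<..<s} \<inter> \<rat>)) (\<lambda>t. \<bar>D t \<omega>\<bar>)"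
            proof (intro continuous_on_rabs continuous_on_subset[OF elim(1)])
              have "closure ({0<..<s} \<inter> \<rat>) \<subseteq> closure {0..s}" by (rule closure_mono) auto
              then show "closure ({0<..<s} \<inter> \<rat>) \<subseteq> {0..T}" using s0 by auto
            qed
            moreover have "\<bar>D y \<omega>\<bar> \<le> C" if "y \<in> {0<..<s} \<inter> \<rat>" for y
              using True that by (simp add: A_def R_def)
            ultimately show ?thesis
              using continuous_le_on_closure[of "{0<..<s} \<inter> \<rat>" "\<lambda>t. \<bar>D t \<omega>\<bar>" x C] by blast
          qed (use True x in \<open>auto simp: A_def R_def\<close>)
          then have "\<omega> \<in> A x" if "x \<in> {0..s}" for x using that elim by (auto simp: A_def R_def)
          then have "u (grid s n i) \<omega> = D (grid s n i) \<omega>" if "i < n" for i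
            using grid_mem[OF s0(1), of i n] that by (auto simp: u_def)
          then show ?thesis by (simp add: riemann_sum_def)
        qed simp
      qed
    qed
    then have "f s \<le> K * (G * (exp (l * s) / l))" unfolding f_def
    proof (rule conv_prob_second_moment)
      fix n
      have le: "(indicator (A s) \<omega> * ?X n \<omega>)\<^sup>2 \<le> (?X n \<omega>)\<^sup>2" for \<omega> by (auto simp: indicator_def)
      show I: "integrable M (\<lambda>\<omega>. (indicator (A s) \<omega> * ?X n \<omega>)\<^sup>2)"
      proof (rule Bochner_Integration.integrable_bound[OF mom(1)[of n]])
        show "AE \<omega> in M. norm ((indicator (A s) \<omega> * ?X n \<omega>)\<^sup>2) \<le> norm ((?X n \<omega>)\<^sup>2)"
          unfolding real_norm_def abs_power2 by (intro AE_I2 le)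
        show "(\<lambda>\<omega>. (indicator (A s) \<omega> * ?X n \<omega>)\<^sup>2) \<in> borel_measurable M"
          by (intro borel_measurable_power borel_measurable_times[OF borel_measurable_indicator[OF A_ev[OF s]] Xm])
      qed
      have "(\<integral>\<omega>. (indicator (A s) \<omega> * ?X n \<omega>)\<^sup>2 \<partial>M) \<le> (\<integral>\<omega>. (?X n \<omega>)\<^sup>2 \<partial>M)"
        by (rule integral_mono[OF I mom(1) le])
      also have "\<dots> \<le> K * (s / real n * (\<Sum>i<n. f (grid s n i)))"
        by (rule mom(2))
      also have "\<dots> \<le> K * (s / real n * (\<Sum>i<n. G * exp (l * grid s n i)))"
      proof (intro mult_left_mono sum_mono f_G)
        show "grid s n i \<in> {0..T}" if "i \<in> {..<n}" for i
          using grid_mem[OF s0(1), of i n] that s0 by auto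
      qed (use s0 K in auto)
      also have "\<dots> = K * (G * (s / real n * (\<Sum>i<n. exp (l * grid s n i))))"
        by (simp only: sum_distrib_left[symmetric] mult_ac)
      also have "\<dots> \<le> K * (G * (exp (l * s) / l))"
      proof (cases "n = 0")
        case False
        then show ?thesis using K G0 s0 l by (intro mult_left_mono exp_grid_sum_le) auto
      qed (use K G0 l in simp)
      finally show "(\<integral>\<omega>. (indicator (A s) \<omega> * ?X n \<omega>)\<^sup>2 \<partial>M) \<le> K * (G * (exp (l * s) / l))" .
    qed
    then show ?thesis .
  qed
  \<comment> \<open>The weighted estimate bounds \<open>G\<close> by at most half of itself, so
    \<open>G\<close> vanishes.\<close>
  have "G \<le> G * (K / l)" unfolding G_def
  proof (rule cSUP_least)
    fix s assume s: "s \<in> {0..T}"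
    have "f s * exp (- l * s) \<le> K * (G * (exp (l * s) / l)) * exp (- l * s)"
      by (intro mult_right_mono step s) simp
    also have "\<dots> = G * (K / l)" by (simp add: field_simps flip: exp_add)
    finally show "f s * exp (- l * s) \<le> (SUP s\<in>{0..T}. f s * exp (- l * s)) * (K / l)"
      unfolding G_def .
  qed (use T in auto)
  also have "\<dots> \<le> G * (1 / 2)"
    using K l G0 by (intro mult_left_mono) (auto simp: l_def field_simps)
  finally have "G = 0" using G0 by simp
  then have "f t = 0" using f_G[OF t] f_nonneg[of t] by simp
  then have "AE \<omega> in M. (u t \<omega>)\<^sup>2 = 0"
    using integral_nonneg_eq_0_iff_AE[OF u2_int[OF t]] by (simp add: f_def)
  then have "AE \<omega> in M. u t \<omega> = 0" by eventually_elim simp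
  with AE_space show ?thesis
  proof eventually_elim
    case (elim \<omega>)
    show ?case
    proof
      assume "\<forall>s\<in>{0..t}. \<bar>D s \<omega>\<bar> \<le> C"
      then have "\<omega> \<in> A t" using elim t by (auto simp: A_def R_def)
      then show "D t \<omega> = 0" using elim by (simp add: u_def)
    qed
  qed
qed

text \<open>A continuous path is bounded on \<open>{0..t}\<close> by some natural number, and
  countably many exceptional null sets form a null set; this removes the localisation.\<close>

lemma linear_sde_unique:
  fixes D :: "real \<Rightarrow> 'a \<Rightarrow> real"
  assumes ad: "\<And>t. t \<in> {0..T} \<Longrightarrow> D t \<in> borel_measurable (F t)"
    and cont: "AE \<omega> in M. continuous_on {0..T} (\<lambda>t. D t \<omega>)"
    and sde: "\<And>t. t \<in> {0..T} \<Longrightarrow> conv_prob M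
      (\<lambda>n \<omega>. a * (t / real n * (\<Sum>i<n. D (grid t n i) \<omega>)) + b * riemann_sum D t n \<omega>) (D t)"
    and t: "t \<in> {0..T}"
  shows "AE \<omega> in M. D t \<omega> = 0"
proof -
  have "AE \<omega> in M. \<forall>k::nat. (\<forall>s\<in>{0..t}. \<bar>D s \<omega>\<bar> \<le> real k) \<longrightarrow> D t \<omega> = 0"
    unfolding AE_all_countable by (intro allI linear_sde_unique_bounded[OF ad cont sde t]) auto
  with cont show ?thesis
  proof eventually_elim
    case (elim \<omega>)
    have "bounded ((\<lambda>s. D s \<omega>) ` {0..t})"
      using t by (intro compact_imp_bounded compact_continuous_image continuous_on_subset[OF elim(1)]) auto
    then obtain B where B: "\<And>s. s \<in> {0..t} \<Longrightarrow> \<bar>D s \<omega>\<bar> \<le> B"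
      unfolding bounded_iff real_norm_def by (metis imageI)
    obtain k where "B \<le> real k" using real_arch_simple by blast
    then have "\<forall>s\<in>{0..t}. \<bar>D s \<omega>\<bar> \<le> real k" using B by force
    then show ?case using elim by blast
  qed
qed

end

section \<open>The two split systems\<close>

lemma set_lebesgue_integral_inner:
  fixes f :: "real \<Rightarrow> 'b::euclidean_space"
  assumes "continuous_on {0..t} f"
  shows "(LINT s:{0..t}|lborel. f s) \<bullet> b = integral {0..t} (\<lambda>s. f s \<bullet> b)"
proof -
  have "set_integrable lborel {0..t} f" "set_integrable lborel {0..t} (\<lambda>s. f s \<bullet> b)"
    by (intro borel_integrable_atLeastAtMost' assms continuous_intros)+
  then show ?thesis
    unfolding set_borel_integral_eq_integral(2)[OF \<open>set_integrable lborel {0..t} (\<lambda>s. f s \<bullet> b)\<close>, symmetric]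
    unfolding set_integrable_def set_lebesgue_integral_def
    by (subst integral_inner_left[symmetric]) auto
qed

section \<open>The integral equations in terms of Riemann sums\<close>

context brownian
begin

text \<open>The integral on the right-hand side need not be measurable, hence the version \<open>I\<close>.\<close>

lemma sde_solution_riemann_sum:
  fixes Z :: "real \<Rightarrow> 'a \<Rightarrow> 'b::euclidean_space"
  assumes sol: "sde_solution M F W T (a, \<sigma>) Z" and t: "t \<in> {0..T}" and b: "b \<in> Basis"
    and a: "continuous_on UNIV a" and \<sigma>: "continuous_on UNIV \<sigma>"
  obtains I where "conv_prob M (riemann_sum (\<lambda>s \<omega>. \<sigma> (Z s \<omega>) \<bullet> b) t) I"
    and "AE \<omega> in M. I \<omega> = (Z t \<omega> - Z 0 \<omega>) \<bullet> b - integral {0..t} (\<lambda>s. a (Z s \<omega>) \<bullet> b)"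
proof
  have cont: "AE \<omega> in M. continuous_on {0..T} (\<lambda>s. Z s \<omega>)" using sol by simp
  let ?I = "\<lambda>\<omega>. (Z t \<omega> - Z 0 \<omega> - (LINT s:{0..t}|lborel. a (Z s \<omega>))) \<bullet> b"
  have "has_ito_integral M F W (\<lambda>s \<omega>. \<sigma> (Z s \<omega>) \<bullet> b) t ?I" using sol t b by simp
  then show "conv_prob M (riemann_sum (\<lambda>s \<omega>. \<sigma> (Z s \<omega>) \<bullet> b) t) ?I"
  proof (rule has_ito_integral_riemann_sum)
    show "AE \<omega> in M. continuous_on {0..t} (\<lambda>s. \<sigma> (Z s \<omega>) \<bullet> b)"
      using cont
    proof eventually_elim
      case (elim \<omega>)
      have "continuous_on {0..t} (\<lambda>s. \<sigma> (Z s \<omega>))"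
        by (rule continuous_on_compose2[OF \<sigma> continuous_on_subset[OF elim]]) (use t in auto)
      then show ?case by (intro continuous_intros)
    qed
  qed (use t in simp)
  show "AE \<omega> in M. ?I \<omega> = (Z t \<omega> - Z 0 \<omega>) \<bullet> b - integral {0..t} (\<lambda>s. a (Z s \<omega>) \<bullet> b)"
    using cont
  proof eventually_elim
    case (elim \<omega>)
    have "continuous_on {0..t} (\<lambda>s. a (Z s \<omega>))"
      by (rule continuous_on_compose2[OF a continuous_on_subset[OF elim]]) (use t in auto)
    from set_lebesgue_integral_inner[OF this, of b] show ?case by (simp add: inner_diff_left)
  qed
qed

text \<open>Replacing the pathwise drift integral by its Riemann means puts drift and noise on the
  same grid, the form in which solutions are subtracted and \<open>linear_sde_unique\<close> is
  applied.\<close>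

lemma conv_prob_drift:
  assumes I: "conv_prob M (riemann_sum H t) I"
    and eq: "AE \<omega> in M. I \<omega> = Y \<omega> - g * integral {0..t} (\<lambda>s. V s \<omega>)"
    and V: "AE \<omega> in M. continuous_on {0..t} (\<lambda>s. V s \<omega> :: real)" and t: "0 \<le> t"
    and ad: "\<And>s. s \<in> {0..t} \<Longrightarrow> V s \<in> borel_measurable (F s)" and Y: "Y \<in> borel_measurable M"
  shows "conv_prob M (\<lambda>n \<omega>. g * (t / real n * (\<Sum>i<n. V (grid t n i) \<omega>)) + riemann_sum H t n \<omega>) Y"
proof -
  have Im: "I \<in> borel_measurable M" using I by (simp add: conv_prob_def)
  have Vm: "V (grid t n i) \<in> borel_measurable M" if "i < n" for n i
    using grid_mem[OF t, of i n] that by (intro measurable_F[OF ad]) auto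
  have "conv_prob M (\<lambda>n \<omega>. g * (t / real n * (\<Sum>i<n. V (grid t n i) \<omega>))) (\<lambda>\<omega>. Y \<omega> - I \<omega>)"
  proof (rule conv_prob_AE)
    show "(\<lambda>\<omega>. g * (t / real n * (\<Sum>i<n. V (grid t n i) \<omega>))) \<in> borel_measurable M" for n
      using Vm by (intro borel_measurable_times borel_measurable_const borel_measurable_sum) auto
    show "AE \<omega> in M. (\<lambda>n. g * (t / real n * (\<Sum>i<n. V (grid t n i) \<omega>))) \<longlonglongrightarrow> Y \<omega> - I \<omega>"
      using eq V
    proof eventually_elim
      case (elim \<omega>)
      have "(\<lambda>n. g * (t / real n * (\<Sum>i<n. V (grid t n i) \<omega>))) \<longlonglongrightarrow> g * integral {0..t} (\<lambda>s. V s \<omega>)"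
        by (intro tendsto_mult_left riemann_mean_tendsto elim t)
      then show ?case using elim by simp
    qed
  qed (use Y Im in simp)
  from conv_prob_add[OF this I] show ?thesis by simp
qed

lemma riemann_sum_cmult: "riemann_sum (\<lambda>s \<omega>. c * H s \<omega>) T n \<omega> = c * riemann_sum H T n \<omega>"
  by (simp add: riemann_sum_def sum_distrib_left mult.assoc)

lemma riemann_sum_diff:
  "riemann_sum (\<lambda>s \<omega>. H s \<omega> - G s \<omega>) T n \<omega> = riemann_sum H T n \<omega> - riemann_sum G T n \<omega>"
  by (simp add: riemann_sum_def left_diff_distrib sum_subtractf)

lemma riemann_sum_cong_AE:
  assumes "\<And>s. s \<in> {0..T} \<Longrightarrow> AE \<omega> in M. H s \<omega> = G s \<omega>" and T: "0 \<le> T"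
  shows "AE \<omega> in M. riemann_sum H T n \<omega> = riemann_sum G T n \<omega>"
proof -
  have "AE \<omega> in M. \<forall>i\<in>{..<n}. H (grid T n i) \<omega> = G (grid T n i) \<omega>"
    using grid_mem[OF T, of _ n] by (intro AE_finite_allI assms) (auto intro: less_imp_le)
  then show ?thesis by eventually_elim (simp add: riemann_sum_def)
qed

lemma geometric_bm_0: "AE \<omega> in M. geometric_bm \<alpha> g 0 \<omega> = 1"
  using W_0 by eventually_elim (simp add: geometric_bm_def)

text \<open>Halving the exponent \<xi> W - \<xi>^2 t/4 gives (\<xi>/2) W - (\<xi>/2)^2 t/2, an
  exponential martingale without growth factor.\<close>

lemma sqrt_geometric_bm: "sqrt (geometric_bm \<xi> (\<xi>\<^sup>2 / 4) t \<omega>) = geometric_bm (\<xi> / 2) 0 t \<omega>"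
  by (rule real_sqrt_unique)
    (simp_all add: geometric_bm_def power2_eq_square field_simps flip: exp_add)

lemma geometric_bm_eq: "geometric_bm \<xi> (\<xi>\<^sup>2 / 4) t \<omega> = exp (- (\<xi>\<^sup>2 / 4) * t + \<xi> * W t \<omega>)"
  by (simp add: geometric_bm_def field_simps flip: exp_add)

text \<open>The initial variance is almost surely constant, so it multiplies the explicit process as
  a scalar; in the scheme it is the variance left by the first half step. The difference from
  \<open>v0\<close> times that process solves the homogeneous linear equation with initial value
  zero.\<close>

lemma hw_system2_solution:
  assumes sol: "sde_solution M F W T (hw_system2 \<xi> \<rho>) Z" and T: "0 \<le> T" and \<xi>: "0 < \<xi>"
    and v0: "AE \<omega> in M. snd (Z 0 \<omega>) = v0"
  shows "AE \<omega> in M. snd (Z T \<omega>) = v0 * exp (- (\<xi>\<^sup>2 / 4) * T + \<xi> * W T \<omega>)"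
    and "AE \<omega> in M. fst (Z T \<omega>) = fst (Z 0 \<omega>) + 2 * \<rho> / \<xi> * (sqrt (snd (Z T \<omega>)) - sqrt v0)"
proof -
  let ?a = "\<lambda>z::real \<times> real. (0::real, \<xi>\<^sup>2 / 4 * snd z)"
  let ?\<sigma> = "\<lambda>z::real \<times> real. (\<rho> * sqrt (snd z), \<xi> * snd z)"
  have sys: "hw_system2 \<xi> \<rho> = (?a, ?\<sigma>)" by (simp add: hw_system2_def case_prod_beta')
  note sol' = sol[unfolded sys]
  have cont: "AE \<omega> in M. continuous_on {0..T} (\<lambda>t. Z t \<omega>)"
    and ad: "\<And>t. t \<in> {0..T} \<Longrightarrow> Z t \<in> borel_measurable (F t)" using sol' by simp_all
  have ca: "continuous_on UNIV ?a" and c\<sigma>: "continuous_on UNIV ?\<sigma>"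
    by (intro continuous_intros)+
  have snd_ad: "(\<lambda>\<omega>. snd (Z t \<omega>)) \<in> borel_measurable (F t)" if "t \<in> {0..T}" for t
    by (rule measurable_compose[OF ad[OF that] borel_measurable_continuous_onI]) (intro continuous_intros)
  have basis: "(0::real, 1::real) \<in> Basis" "(1::real, 0::real) \<in> Basis" by (simp_all add: Basis_prod_def)
  let ?E = "geometric_bm \<xi> (\<xi>\<^sup>2 / 4)"
  have V: "AE \<omega> in M. snd (Z t \<omega>) = v0 * ?E t \<omega>" if t: "t \<in> {0..T}" for t
  proof -
    define D where "D = (\<lambda>t \<omega>. snd (Z t \<omega>) - v0 * ?E t \<omega>)"
    have D_ad: "D t \<in> borel_measurable (F t)" if "t \<in> {0..T}" for t
      using snd_ad[OF that] geometric_bm_adapted[of t] that unfolding D_def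
      by (intro borel_measurable_diff borel_measurable_times) auto
    have "AE \<omega> in M. D t \<omega> = 0"
    proof (rule linear_sde_unique[where a = "\<xi>\<^sup>2 / 4" and b = \<xi>, OF D_ad _ _ t])
      show "AE \<omega> in M. continuous_on {0..T} (\<lambda>t. D t \<omega>)"
        using cont geometric_bm_continuous[of \<xi> "\<xi>\<^sup>2 / 4"]
        by eventually_elim (auto simp: D_def intro!: continuous_intros intro: continuous_on_subset)
      fix t assume t: "t \<in> {0..T}"
      then have t0: "0 \<le> t" by simp
      obtain I where I: "conv_prob M (riemann_sum (\<lambda>s \<omega>. ?\<sigma> (Z s \<omega>) \<bullet> (0, 1)) t) I"
        "AE \<omega> in M. I \<omega> = (Z t \<omega> - Z 0 \<omega>) \<bullet> (0, 1) - integral {0..t} (\<lambda>s. ?a (Z s \<omega>) \<bullet> (0, 1))"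
        using sde_solution_riemann_sum[OF sol' t basis(1) ca c\<sigma>] by blast
      have "conv_prob M (\<lambda>n \<omega>. \<xi>\<^sup>2 / 4 * (t / real n * (\<Sum>i<n. snd (Z (grid t n i) \<omega>)))
          + riemann_sum (\<lambda>s \<omega>. ?\<sigma> (Z s \<omega>) \<bullet> (0, 1)) t n \<omega>) (\<lambda>\<omega>. snd (Z t \<omega>) - snd (Z 0 \<omega>))"
      proof (rule conv_prob_drift[OF I(1) _ _ t0])
        show "AE \<omega> in M. I \<omega> = snd (Z t \<omega>) - snd (Z 0 \<omega>) - \<xi>\<^sup>2 / 4 * integral {0..t} (\<lambda>s. snd (Z s \<omega>))"
          using I(2) by eventually_elim (simp add: inner_prod_def)
        show "AE \<omega> in M. continuous_on {0..t} (\<lambda>s. snd (Z s \<omega>))"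
          using cont by eventually_elim (use t in \<open>auto intro!: continuous_on_snd intro: continuous_on_subset\<close>)
        show "(\<lambda>\<omega>. snd (Z t \<omega>) - snd (Z 0 \<omega>)) \<in> borel_measurable M"
          using t by (intro borel_measurable_diff measurable_F[OF snd_ad]) auto
      qed (use snd_ad t in auto)
      from conv_prob_diff[OF this conv_prob_cmult[OF geometric_bm_sde[OF t0, of "\<xi>\<^sup>2 / 4" \<xi>], of v0]]
      show "conv_prob M (\<lambda>n \<omega>. \<xi>\<^sup>2 / 4 * (t / real n * (\<Sum>i<n. D (grid t n i) \<omega>)) + \<xi> * riemann_sum D t n \<omega>) (D t)"
      proof (rule conv_prob_cong_AE)
        have "(\<xi>\<^sup>2 / 4 * (t / real n * (\<Sum>i<n. D (grid t n i) \<omega>)) + \<xi> * riemann_sum D t n \<omega>)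
          = \<xi>\<^sup>2 / 4 * (t / real n * (\<Sum>i<n. snd (Z (grid t n i) \<omega>))) + riemann_sum (\<lambda>s \<omega>. ?\<sigma> (Z s \<omega>) \<bullet> (0, 1)) t n \<omega>
           - v0 * (\<xi>\<^sup>2 / 4 * (t / real n * (\<Sum>i<n. ?E (grid t n i) \<omega>)) + \<xi> * riemann_sum ?E t n \<omega>)" for n \<omega>
          unfolding D_def riemann_sum_diff riemann_sum_cmult sum_subtractf sum_distrib_left[symmetric]
          by (simp add: riemann_sum_cmult algebra_simps diff_divide_distrib)
        then show "AE \<omega> in M. (\<xi>\<^sup>2 / 4 * (t / real n * (\<Sum>i<n. D (grid t n i) \<omega>)) + \<xi> * riemann_sum D t n \<omega>)
          = \<xi>\<^sup>2 / 4 * (t / real n * (\<Sum>i<n. snd (Z (grid t n i) \<omega>))) + riemann_sum (\<lambda>s \<omega>. ?\<sigma> (Z s \<omega>) \<bullet> (0, 1)) t n \<omega>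
           - v0 * (\<xi>\<^sup>2 / 4 * (t / real n * (\<Sum>i<n. ?E (grid t n i) \<omega>)) + \<xi> * riemann_sum ?E t n \<omega>)" for n
          by simp
        show "AE \<omega> in M. D t \<omega> = snd (Z t \<omega>) - snd (Z 0 \<omega>) - v0 * (?E t \<omega> - ?E 0 \<omega>)"
          using v0 geometric_bm_0[of \<xi> "\<xi>\<^sup>2 / 4"] by eventually_elim (simp add: D_def algebra_simps)
        show "D t \<in> borel_measurable M" using measurable_F[OF D_ad[OF t]] .
        have "D (grid t n i) \<in> borel_measurable M" if "i < n" for n i
          using grid_mem[OF t0, of i n] that t by (intro measurable_F[OF D_ad]) auto
        moreover have "riemann_sum D t n \<in> borel_measurable M" for n
          using t by (intro riemann_sum_measurable D_ad) auto
        ultimately show "(\<lambda>\<omega>. \<xi>\<^sup>2 / 4 * (t / real n * (\<Sum>i<n. D (grid t n i) \<omega>)) + \<xi> * riemann_sum D t n \<omega>) \<in> borel_measurable M" for n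
          by (intro borel_measurable_add borel_measurable_times borel_measurable_const borel_measurable_sum) auto
      qed
    qed
    then show ?thesis by eventually_elim (simp add: D_def)
  qed
  show VT: "AE \<omega> in M. snd (Z T \<omega>) = v0 * exp (- (\<xi>\<^sup>2 / 4) * T + \<xi> * W T \<omega>)"
    using V[of T] T by (simp add: geometric_bm_eq)
  let ?S = "geometric_bm (\<xi> / 2) 0"
  obtain J where J: "conv_prob M (riemann_sum (\<lambda>s \<omega>. ?\<sigma> (Z s \<omega>) \<bullet> (1, 0)) T) J"
    "AE \<omega> in M. J \<omega> = (Z T \<omega> - Z 0 \<omega>) \<bullet> (1, 0) - integral {0..T} (\<lambda>s. ?a (Z s \<omega>) \<bullet> (1, 0))"
    using sde_solution_riemann_sum[OF sol' _ basis(2) ca c\<sigma>, of T] T by auto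
  \<comment> \<open>The equation of \<open>?S\<close> has volatility \<xi>/2 and no drift. Scaling
    it by 2\<rho> sqrt(v0)/\<xi> gives the integrand \<rho> sqrt(v0) \<open>?S\<close>, which is
    \<rho> sqrt(V).\<close>
  have "conv_prob M (riemann_sum (\<lambda>s \<omega>. ?\<sigma> (Z s \<omega>) \<bullet> (1, 0)) T)
     (\<lambda>\<omega>. (2 * \<rho> * sqrt v0 / \<xi>) * (?S T \<omega> - ?S 0 \<omega>))"
  proof (rule conv_prob_cong_AE[OF conv_prob_cmult[OF geometric_bm_sde[OF T, of 0 "\<xi> / 2"], of "2 * \<rho> * sqrt v0 / \<xi>"]])
    show "riemann_sum (\<lambda>s \<omega>. ?\<sigma> (Z s \<omega>) \<bullet> (1, 0)) T n \<in> borel_measurable M" for n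
      using J(1) by (simp add: conv_prob_def)
    show "(\<lambda>\<omega>. (2 * \<rho> * sqrt v0 / \<xi>) * (?S T \<omega> - ?S 0 \<omega>)) \<in> borel_measurable M"
      using T by (intro borel_measurable_times borel_measurable_diff measurable_F[OF geometric_bm_adapted]) auto
    have "AE \<omega> in M. riemann_sum (\<lambda>s \<omega>. ?\<sigma> (Z s \<omega>) \<bullet> (1, 0)) T n \<omega>
        = riemann_sum (\<lambda>s \<omega>. (\<rho> * sqrt v0) * ?S s \<omega>) T n \<omega>" for n
    proof (rule riemann_sum_cong_AE[OF _ T])
      fix s assume "s \<in> {0..T}"
      from V[OF this] show "AE \<omega> in M. ?\<sigma> (Z s \<omega>) \<bullet> (1, 0) = (\<rho> * sqrt v0) * ?S s \<omega>"
        by eventually_elim (simp add: real_sqrt_mult sqrt_geometric_bm)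
    qed
    then show "AE \<omega> in M. riemann_sum (\<lambda>s \<omega>. ?\<sigma> (Z s \<omega>) \<bullet> (1, 0)) T n \<omega>
        = 2 * \<rho> * sqrt v0 / \<xi> * (0 * (T / real n * (\<Sum>i<n. ?S (grid T n i) \<omega>)) + \<xi> / 2 * riemann_sum ?S T n \<omega>)" for n
      by eventually_elim (use \<xi> in \<open>simp add: riemann_sum_cmult\<close>)
  qed simp
  then have "AE \<omega> in M. J \<omega> = (2 * \<rho> * sqrt v0 / \<xi>) * (?S T \<omega> - ?S 0 \<omega>)"
    by (rule conv_prob_unique[OF J(1)])
  moreover have "AE \<omega> in M. snd (Z T \<omega>) = v0 * ?E T \<omega>" using V[of T] T by simp
  ultimately show "AE \<omega> in M. fst (Z T \<omega>) = fst (Z 0 \<omega>) + 2 * \<rho> / \<xi> * (sqrt (snd (Z T \<omega>)) - sqrt v0)"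
    using J(2) geometric_bm_0[of "\<xi> / 2" 0]
  proof eventually_elim
    case (elim \<omega>)
    then have "fst (Z T \<omega>) - fst (Z 0 \<omega>) = (2 * \<rho> * sqrt v0 / \<xi>) * (?S T \<omega> - 1)"
      by (simp add: inner_prod_def)
    also have "\<dots> = 2 * \<rho> / \<xi> * (sqrt (snd (Z T \<omega>)) - sqrt v0)"
      using elim(2) by (simp add: real_sqrt_mult sqrt_geometric_bm algebra_simps)
    finally show ?case by simp
  qed
qed

end

section \<open>Wiener integrals of exponentials\<close>

definition wiener_sum :: "real \<Rightarrow> real \<Rightarrow> nat \<Rightarrow> (real \<Rightarrow> real) \<Rightarrow> real" where
  "wiener_sum c T n w = (\<Sum>i<n. exp (c * grid T n i / 2) * (w (grid T n (Suc i)) - w (grid T n i)))"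

text \<open>The integral of \<open>exp (c s / 2)\<close> against a path; it exists pathwise because the integrand is smooth.\<close>

definition wiener_integral :: "real \<Rightarrow> real \<Rightarrow> (real \<Rightarrow> real) \<Rightarrow> real" where
  "wiener_integral c T w = lim (\<lambda>n. wiener_sum c T n w)"

text \<open>Summation by parts moves the differences from the rough path to the smooth exponential,
  so a Stieltjes limit exists for every continuous path.\<close>

lemma wiener_sum_tendsto:
  assumes w: "continuous_on {0..T} w" and T: "0 \<le> T"
  shows "(\<lambda>n. wiener_sum c T n w) \<longlonglongrightarrow> wiener_integral c T w"
proof -
  let ?f = "\<lambda>x. exp (c * x / 2)"
  let ?S = "\<lambda>n. \<Sum>i<n. w (grid T n (Suc i)) * (?f (grid T n (Suc i)) - ?f (grid T n i))"
  have S: "?S \<longlonglongrightarrow> integral {0..T} (\<lambda>s. w s * (?f s * (c / 2)))"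
    using w T grid_Suc_le[OF T]
    by (intro stieltjes_sum_tendsto[where c = "\<lambda>n i. grid T n (Suc i)"])
      (auto intro!: derivative_eq_intros continuous_intros)
  have "(\<lambda>n. (?f T * w T - ?f 0 * w 0) - ?S n) \<longlonglongrightarrow> (?f T * w T - ?f 0 * w 0) - integral {0..T} (\<lambda>s. w s * (?f s * (c / 2)))"
    by (intro tendsto_diff tendsto_const S)
  moreover have "\<forall>\<^sub>F n in sequentially. (?f T * w T - ?f 0 * w 0) - ?S n = wiener_sum c T n w"
    using eventually_gt_at_top[of 0]
  proof eventually_elim
    case (elim n)
    have "(\<Sum>i<n. ?f (grid T n (Suc i)) * w (grid T n (Suc i)) - ?f (grid T n i) * w (grid T n i))
        = ?f T * w T - ?f 0 * w 0"
      using elim sum_lessThan_telescope[of "\<lambda>i. ?f (grid T n i) * w (grid T n i)" n] by simp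
    moreover have "(\<Sum>i<n. ?f (grid T n (Suc i)) * w (grid T n (Suc i)) - ?f (grid T n i) * w (grid T n i))
        = wiener_sum c T n w + ?S n"
      unfolding wiener_sum_def sum.distrib[symmetric] by (intro sum.cong refl) (simp add: algebra_simps)
    ultimately show ?case by linarith
  qed
  ultimately have "convergent (\<lambda>n. wiener_sum c T n w)"
    unfolding convergent_def by (blast intro: Lim_transform_eventually)
  then show ?thesis by (simp add: wiener_integral_def convergent_LIMSEQ_iff)
qed

lemma wiener_sum_cong: "0 \<le> T \<Longrightarrow> (\<And>t. 0 \<le> t \<Longrightarrow> w t = w' t) \<Longrightarrow> wiener_sum c T n w = wiener_sum c T n w'"
  by (simp add: wiener_sum_def grid_nonneg)

text \<open>Lets a path restricted to \<open>{0..}\<close>, which is \<open>undefined\<close> at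
  negative times, be exchanged for the original one.\<close>

lemma wiener_integral_cong: "0 \<le> T \<Longrightarrow> (\<And>t. 0 \<le> t \<Longrightarrow> w t = w' t) \<Longrightarrow> wiener_integral c T w = wiener_integral c T w'"
  unfolding wiener_integral_def using wiener_sum_cong[of T w w' c] by simp

text \<open>As a pointwise limit of functions of finitely many coordinates, the integral is a
  measurable functional on path space; independence of the paths therefore passes to the
  integrals.\<close>

lemma wiener_integral_measurable:
  assumes "0 \<le> T"
  shows "wiener_integral c T \<in> borel_measurable (\<Pi>\<^sub>M t\<in>{0::real..}. (borel :: real measure))"
  unfolding wiener_integral_def[abs_def]
proof (rule borel_measurable_lim_metric)
  show "wiener_sum c T n \<in> borel_measurable (\<Pi>\<^sub>M t\<in>{0::real..}. (borel :: real measure))" for n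
    unfolding wiener_sum_def[abs_def]
    by (intro borel_measurable_sum borel_measurable_times borel_measurable_const borel_measurable_diff
        measurable_component_singleton) (simp_all add: grid_nonneg assms)
qed

lemma integral_exp_linear:
  fixes c T :: real
  assumes "0 \<le> T"
  shows "integral {0..T} (\<lambda>s. exp (c * s)) = (if c = 0 then T else (exp (c * T) - 1) / c)"
proof (cases "c = 0")
  case False
  have "((\<lambda>s. exp (c * s)) has_integral (exp (c * T) / c - exp (c * 0) / c)) {0..T}"
    using False assms
    by (intro fundamental_theorem_of_calculus[of 0 T "\<lambda>s. exp (c * s) / c"])
      (auto intro!: derivative_eq_intros simp flip: has_real_derivative_iff_has_vector_derivative)
  then show ?thesis using False by (simp add: integral_unique diff_divide_distrib)
qed (use assms in simp)

lemma sqrt_exp: "sqrt (exp x) = exp (x / 2)"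
  by (rule real_sqrt_unique) (simp_all add: power2_eq_square flip: exp_add)

section \<open>Laws of Wiener integrals and the explicit solution of system (1)\<close>

context brownian
begin

text \<open>The last increment is independent of the preceding sum, so characteristic functions
  multiply and the exponents add.\<close>

lemma char_increment_sum:
  assumes "0 \<le> \<tau> 0" "\<And>i. i < n \<Longrightarrow> \<tau> i \<le> \<tau> (Suc i)"
  shows "char (distr M borel (\<lambda>\<omega>. \<Sum>i<n. a i * (W (\<tau> (Suc i)) \<omega> - W (\<tau> i) \<omega>))) \<theta>
    = exp (- complex_of_real ((\<Sum>i<n. (a i)\<^sup>2 * (\<tau> (Suc i) - \<tau> i)) * \<theta>\<^sup>2 / 2))"
  using assms
proof (induction n)
  case 0
  then show ?case
    by (simp add: char_def integral_return)
next
  case (Suc n)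
  define S where "S = (\<lambda>\<omega>. \<Sum>i<n. a i * (W (\<tau> (Suc i)) \<omega> - W (\<tau> i) \<omega>))"
  define X where "X = (\<lambda>\<omega>. a n * (W (\<tau> (Suc n)) \<omega> - W (\<tau> n) \<omega>))"
  have t0: "0 \<le> \<tau> n"
    by (rule increment_sum_adapted(1)[of \<tau> n "\<lambda>i _. a i" "\<lambda>_ x. x"]) (use Suc.prems in auto)
  have S_ad: "S \<in> borel_measurable (F (\<tau> n))"
    unfolding S_def by (rule increment_sum_adapted(2)[of \<tau> n "\<lambda>i _. a i" "\<lambda>_ x. x"]) (use Suc.prems in auto)
  have t1: "\<tau> n \<le> \<tau> (Suc n)" using Suc.prems by simp
  have indep: "indep_var borel S borel X"
    unfolding X_def by (rule increment_indep[OF t0 t1 S_ad, where \<phi> = "\<lambda>x. a n * x"]) simp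
  have m: "(\<lambda>\<omega>. W (\<tau> (Suc n)) \<omega> - W (\<tau> n) \<omega>) \<in> borel_measurable M"
    using t0 t1 by (intro borel_measurable_diff W_measurable) auto
  have "char (distr M borel X) \<theta> = char (distr M borel (\<lambda>\<omega>. W (\<tau> (Suc n)) \<omega> - W (\<tau> n) \<omega>)) (a n * \<theta>)"
    using m by (simp add: char_def integral_distr X_def mult_ac)
  also have "\<dots> = exp (- complex_of_real ((\<tau> (Suc n) - \<tau> n) * (a n * \<theta>)\<^sup>2 / 2))"
    using t1 by (simp add: increment_law[OF t0 t1] char_normal_law)
  finally have X: "char (distr M borel X) \<theta> = exp (- complex_of_real ((\<tau> (Suc n) - \<tau> n) * (a n * \<theta>)\<^sup>2 / 2))" .
  have "char (distr M borel (\<lambda>\<omega>. S \<omega> + X \<omega>)) \<theta> = char (distr M borel S) \<theta> * char (distr M borel X) \<theta>"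
    by (rule char_distr_add[OF indep])
  also have "char (distr M borel S) \<theta> = exp (- complex_of_real ((\<Sum>i<n. (a i)\<^sup>2 * (\<tau> (Suc i) - \<tau> i)) * \<theta>\<^sup>2 / 2))"
    unfolding S_def using Suc.prems by (intro Suc.IH) auto
  also have "\<dots> * char (distr M borel X) \<theta>
      = exp (- complex_of_real ((\<Sum>i<Suc n. (a i)\<^sup>2 * (\<tau> (Suc i) - \<tau> i)) * \<theta>\<^sup>2 / 2))"
    unfolding X exp_add[symmetric] of_real_minus[symmetric] of_real_add[symmetric]
    by (rule arg_cong[where f = "\<lambda>x. exp (complex_of_real x)"]) (simp add: power_mult_distrib field_simps)
  finally show ?case by (simp add: S_def X_def)
qed

lemma W_continuous_on: "AE \<omega> in M. continuous_on {0..T} (\<lambda>t. W t \<omega>)"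
  using W_continuous by eventually_elim (auto intro: continuous_on_subset)

lemma wiener_sum_W_measurable: "0 \<le> T \<Longrightarrow> (\<lambda>\<omega>. wiener_sum c T n (\<lambda>t. W t \<omega>)) \<in> borel_measurable M"
  unfolding wiener_sum_def
  by (intro borel_measurable_sum borel_measurable_times borel_measurable_const borel_measurable_diff
      W_measurable grid_nonneg)

lemma wiener_integral_W_measurable: "0 \<le> T \<Longrightarrow> (\<lambda>\<omega>. wiener_integral c T (\<lambda>t. W t \<omega>)) \<in> borel_measurable M"
  unfolding wiener_integral_def by (intro borel_measurable_lim_metric wiener_sum_W_measurable)

text \<open>Pathwise convergence passes to characteristic functions by dominated convergence. Those
  of the sums are Gaussian, with variances that are Riemann means of \<open>exp (c * s)\<close>; the
  limit determines the law.\<close>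

lemma wiener_integral_law:
  assumes T: "0 \<le> T"
  shows "distr M borel (\<lambda>\<omega>. wiener_integral c T (\<lambda>t. W t \<omega>)) = normal_law 0 (integral {0..T} (\<lambda>s. exp (c * s)))"
proof (rule Levy_uniqueness)
  let ?G = "\<lambda>\<omega>. wiener_integral c T (\<lambda>t. W t \<omega>)"
  let ?R = "\<lambda>n \<omega>. wiener_sum c T n (\<lambda>t. W t \<omega>)"
  let ?A = "integral {0..T} (\<lambda>s. exp (c * s))"
  note G = wiener_integral_W_measurable[OF T, of c] and R = wiener_sum_W_measurable[OF T, of c]
  show "real_distribution (distr M borel ?G)" using G by simp
  show "real_distribution (normal_law 0 ?A)" by (rule real_distribution_normal_law)
  have A0: "0 \<le> ?A" by (rule integral_nonneg) (auto intro!: integrable_continuous_real continuous_intros)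
  show "char (distr M borel ?G) = char (normal_law 0 ?A)"
  proof
    fix \<theta>
    have lim: "(\<lambda>n. char (distr M borel (?R n)) \<theta>) \<longlonglongrightarrow> char (distr M borel ?G) \<theta>"
    proof -
      have "(\<lambda>n. \<integral>\<omega>. iexp (\<theta> * ?R n \<omega>) \<partial>M) \<longlonglongrightarrow> (\<integral>\<omega>. iexp (\<theta> * ?G \<omega>) \<partial>M)"
      proof (rule integral_dominated_convergence[where w = "\<lambda>_. 1"])
        show "AE \<omega> in M. (\<lambda>n. iexp (\<theta> * ?R n \<omega>)) \<longlonglongrightarrow> iexp (\<theta> * ?G \<omega>)"
          using W_continuous_on[of T]
          by eventually_elim (intro tendsto_intros wiener_sum_tendsto T)
      qed (use G R in auto)
      then show ?thesis using G R by (simp add: char_def integral_distr)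
    qed
    have char_R: "char (distr M borel (?R n)) \<theta>
        = exp (- complex_of_real ((T / real n * (\<Sum>i<n. exp (c * grid T n i))) * \<theta>\<^sup>2 / 2))" for n
    proof -
      have e: "(exp (c * x / 2))\<^sup>2 = exp (c * x)" for x by (simp add: power2_eq_square flip: exp_add)
      have "(\<Sum>i<n. (exp (c * grid T n i / 2))\<^sup>2 * (grid T n (Suc i) - grid T n i))
          = T / real n * (\<Sum>i<n. exp (c * grid T n i))"
        by (simp only: e grid_step sum_distrib_left mult.commute[of "T / real n"])
      then show ?thesis
        using char_increment_sum[of "grid T n" n "\<lambda>i. exp (c * grid T n i / 2)" \<theta>] grid_Suc_le[OF T]
        unfolding wiener_sum_def by simp
    qed
    have "(\<lambda>n. exp (- complex_of_real ((T / real n * (\<Sum>i<n. exp (c * grid T n i))) * \<theta>\<^sup>2 / 2)))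
        \<longlonglongrightarrow> exp (- complex_of_real (?A * \<theta>\<^sup>2 / 2))"
      by (intro tendsto_exp tendsto_minus tendsto_of_real tendsto_divide tendsto_mult tendsto_const
          riemann_mean_tendsto T continuous_intros) auto
    from LIMSEQ_unique[OF lim[unfolded char_R] this]
    show "char (distr M borel ?G) \<theta> = char (normal_law 0 ?A) \<theta>"
      unfolding char_normal_law abs_of_nonneg[OF A0] .
  qed
qed

text \<open>The initial state may be random, as in the last half step. The variance equation is
  noise-free, the case \<open>b = 0\<close> of the uniqueness result. The factor
  \<open>sqrt (snd (Z 0 \<omega>))\<close> is common to all terms of the Riemann sum and comes out,
  leaving a deterministic integrand.\<close>

lemma hw_system1_solution:
  assumes sol: "sde_solution M F W T (hw_system1 \<mu> r \<xi> \<rho>) Z" and T: "0 \<le> T" and c: "c = \<mu> - \<xi>\<^sup>2 / 4"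
  shows "AE \<omega> in M. snd (Z T \<omega>) = exp (c * T) * snd (Z 0 \<omega>)"
    and "AE \<omega> in M. fst (Z T \<omega>) = fst (Z 0 \<omega>) + r * T - snd (Z 0 \<omega>) / 2 * integral {0..T} (\<lambda>s. exp (c * s))
      + sqrt (1 - \<rho>\<^sup>2) * sqrt (snd (Z 0 \<omega>)) * wiener_integral c T (\<lambda>t. W t \<omega>)"
proof -
  let ?a = "\<lambda>z::real \<times> real. (r - snd z / 2, c * snd z)"
  let ?\<sigma> = "\<lambda>z::real \<times> real. (sqrt (1 - \<rho>\<^sup>2) * sqrt (snd z), 0::real)"
  have sys: "hw_system1 \<mu> r \<xi> \<rho> = (?a, ?\<sigma>)" by (simp add: hw_system1_def case_prod_beta' c)
  note sol' = sol[unfolded sys]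
  have cont: "AE \<omega> in M. continuous_on {0..T} (\<lambda>t. Z t \<omega>)"
    and ad: "\<And>t. t \<in> {0..T} \<Longrightarrow> Z t \<in> borel_measurable (F t)" using sol' by simp_all
  have ca: "continuous_on UNIV ?a" and c\<sigma>: "continuous_on UNIV ?\<sigma>"
    by (auto intro!: continuous_intros)
  have snd_ad: "(\<lambda>\<omega>. snd (Z t \<omega>)) \<in> borel_measurable (F t)" if "t \<in> {0..T}" for t
    by (rule measurable_compose[OF ad[OF that] borel_measurable_continuous_onI]) (intro continuous_intros)
  have basis: "(0::real, 1::real) \<in> Basis" "(1::real, 0::real) \<in> Basis" by (simp_all add: Basis_prod_def)
  have exp_cont: "continuous_on {0..t} (\<lambda>s. exp (c * s))" for t by (intro continuous_intros)
  have exp_int: "c * integral {0..t} (\<lambda>s. exp (c * s)) = exp (c * t) - 1" if "0 \<le> t" for t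
    using integral_exp_linear[OF that, of c] by (cases "c = 0") auto
  have V: "AE \<omega> in M. snd (Z t \<omega>) = exp (c * t) * snd (Z 0 \<omega>)" if t: "t \<in> {0..T}" for t
  proof -
    define D where "D = (\<lambda>t \<omega>. snd (Z t \<omega>) - exp (c * t) * snd (Z 0 \<omega>))"
    have D_ad: "D t \<in> borel_measurable (F t)" if "t \<in> {0..T}" for t
      using snd_ad[OF that] measurable_F_mono[OF snd_ad[of 0], of t] that unfolding D_def
      by (intro borel_measurable_diff borel_measurable_times borel_measurable_const) auto
    have D_cont: "AE \<omega> in M. continuous_on {0..T} (\<lambda>t. D t \<omega>)"
      using cont by eventually_elim (auto simp: D_def intro!: continuous_intros)
    have "AE \<omega> in M. D t \<omega> = 0"
    proof (rule linear_sde_unique[where a = c and b = 0, OF D_ad D_cont _ t])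
      fix t assume t: "t \<in> {0..T}"
      then have t0: "0 \<le> t" by simp
      obtain I where I: "conv_prob M (riemann_sum (\<lambda>s \<omega>. ?\<sigma> (Z s \<omega>) \<bullet> (0, 1)) t) I"
        "AE \<omega> in M. I \<omega> = (Z t \<omega> - Z 0 \<omega>) \<bullet> (0, 1) - integral {0..t} (\<lambda>s. ?a (Z s \<omega>) \<bullet> (0, 1))"
        using sde_solution_riemann_sum[OF sol' t basis(1) ca c\<sigma>] by blast
      \<comment> \<open>The diffusion coefficient has second component zero, so the integral
        belonging to the variance vanishes almost surely.\<close>
      have "riemann_sum (\<lambda>s \<omega>. ?\<sigma> (Z s \<omega>) \<bullet> (0, 1)) t n \<omega> = 0" for n \<omega>
        by (simp add: riemann_sum_def inner_prod_def)
      then have "conv_prob M (\<lambda>n \<omega>. 0) I" using I(1) by (simp add: conv_prob_def)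
      then have I0: "AE \<omega> in M. I \<omega> = 0"
        using conv_prob_unique[OF conv_prob_AE[of "\<lambda>_ _. 0" "\<lambda>_. 0"]] by (auto elim: eventually_mono)
      show "conv_prob M (\<lambda>n \<omega>. c * (t / real n * (\<Sum>i<n. D (grid t n i) \<omega>)) + 0 * riemann_sum D t n \<omega>) (D t)"
        unfolding mult_zero_left add_0_right
      proof (rule conv_prob_AE)
        have "D (grid t n i) \<in> borel_measurable M" if "i < n" for n i
          using grid_mem[OF t0, of i n] that t by (intro measurable_F[OF D_ad]) auto
        then show "(\<lambda>\<omega>. c * (t / real n * (\<Sum>i<n. D (grid t n i) \<omega>))) \<in> borel_measurable M" for n
          by (intro borel_measurable_times borel_measurable_const borel_measurable_sum) auto
        show "D t \<in> borel_measurable M" using measurable_F[OF D_ad[OF t]] .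
        show "AE \<omega> in M. (\<lambda>n. c * (t / real n * (\<Sum>i<n. D (grid t n i) \<omega>))) \<longlonglongrightarrow> D t \<omega>"
          using cont I0 I(2)
        proof eventually_elim
          case (elim \<omega>)
          have Vc: "continuous_on {0..t} (\<lambda>s. snd (Z s \<omega>))"
            using elim(1) t by (intro continuous_on_snd) (auto intro: continuous_on_subset)
          have "snd (Z t \<omega>) - snd (Z 0 \<omega>) = c * integral {0..t} (\<lambda>s. snd (Z s \<omega>))"
            using elim by (simp add: inner_prod_def)
          moreover have "integral {0..t} (\<lambda>s. D s \<omega>) = integral {0..t} (\<lambda>s. snd (Z s \<omega>)) - integral {0..t} (\<lambda>s. exp (c * s)) * snd (Z 0 \<omega>)"
            unfolding D_def
            by (subst Henstock_Kurzweil_Integration.integral_diff)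
              (auto intro!: integrable_continuous_real Vc continuous_intros)
          ultimately have "c * integral {0..t} (\<lambda>s. D s \<omega>) = snd (Z t \<omega>) - snd (Z 0 \<omega>) - (exp (c * t) - 1) * snd (Z 0 \<omega>)"
            using exp_int[OF t0] by (simp add: right_diff_distrib flip: mult.assoc)
          then have "c * integral {0..t} (\<lambda>s. D s \<omega>) = D t \<omega>" by (simp add: D_def algebra_simps)
          moreover have "continuous_on {0..t} (\<lambda>s. D s \<omega>)"
            unfolding D_def by (rule continuous_on_diff[OF Vc]) (intro continuous_intros)
          then have "(\<lambda>n. c * (t / real n * (\<Sum>i<n. D (grid t n i) \<omega>))) \<longlonglongrightarrow> c * integral {0..t} (\<lambda>s. D s \<omega>)"
            by (intro tendsto_mult_left riemann_mean_tendsto t0)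
          ultimately show ?case by simp
        qed
      qed
    qed
    then show ?thesis by eventually_elim (simp add: D_def)
  qed
  show "AE \<omega> in M. snd (Z T \<omega>) = exp (c * T) * snd (Z 0 \<omega>)" using V[of T] T by simp
  obtain J where J: "conv_prob M (riemann_sum (\<lambda>s \<omega>. ?\<sigma> (Z s \<omega>) \<bullet> (1, 0)) T) J"
    "AE \<omega> in M. J \<omega> = (Z T \<omega> - Z 0 \<omega>) \<bullet> (1, 0) - integral {0..T} (\<lambda>s. ?a (Z s \<omega>) \<bullet> (1, 0))"
    using sde_solution_riemann_sum[OF sol' _ basis(2) ca c\<sigma>, of T] T by auto
  let ?G = "\<lambda>\<omega>. wiener_integral c T (\<lambda>t. W t \<omega>)"
  \<comment> \<open>The formula for the variance holds almost surely at each single time; there are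
    countably many grid points, so one null set serves all grids.\<close>
  have V_grid: "AE \<omega> in M. \<forall>n i. i < n \<longrightarrow> snd (Z (grid T n i) \<omega>) = exp (c * grid T n i) * snd (Z 0 \<omega>)"
    unfolding AE_all_countable
  proof (intro allI)
    fix n i show "AE \<omega> in M. i < n \<longrightarrow> snd (Z (grid T n i) \<omega>) = exp (c * grid T n i) * snd (Z 0 \<omega>)"
      using V[of "grid T n i"] grid_mem[OF T, of i n] by (cases "i < n") auto
  qed
  have "conv_prob M (riemann_sum (\<lambda>s \<omega>. ?\<sigma> (Z s \<omega>) \<bullet> (1, 0)) T)
     (\<lambda>\<omega>. sqrt (1 - \<rho>\<^sup>2) * sqrt (snd (Z 0 \<omega>)) * ?G \<omega>)"
  proof (rule conv_prob_AE)
    show "riemann_sum (\<lambda>s \<omega>. ?\<sigma> (Z s \<omega>) \<bullet> (1, 0)) T n \<in> borel_measurable M" for n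
      using J(1) by (simp add: conv_prob_def)
    have "(\<lambda>\<omega>. snd (Z 0 \<omega>)) \<in> borel_measurable M"
      by (rule measurable_F[OF snd_ad]) (use T in simp)
    then have "(\<lambda>\<omega>. sqrt (snd (Z 0 \<omega>))) \<in> borel_measurable M" by measurable
    then show "(\<lambda>\<omega>. sqrt (1 - \<rho>\<^sup>2) * sqrt (snd (Z 0 \<omega>)) * ?G \<omega>) \<in> borel_measurable M"
      by (intro borel_measurable_times borel_measurable_const wiener_integral_W_measurable T)
    show "AE \<omega> in M. (\<lambda>n. riemann_sum (\<lambda>s \<omega>. ?\<sigma> (Z s \<omega>) \<bullet> (1, 0)) T n \<omega>)
        \<longlonglongrightarrow> sqrt (1 - \<rho>\<^sup>2) * sqrt (snd (Z 0 \<omega>)) * ?G \<omega>"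
      using V_grid W_continuous_on[of T]
    proof eventually_elim
      case (elim \<omega>)
      have "riemann_sum (\<lambda>s \<omega>. ?\<sigma> (Z s \<omega>) \<bullet> (1, 0)) T n \<omega>
          = sqrt (1 - \<rho>\<^sup>2) * sqrt (snd (Z 0 \<omega>)) * wiener_sum c T n (\<lambda>t. W t \<omega>)" for n
        unfolding riemann_sum_def wiener_sum_def sum_distrib_left
        by (intro sum.cong refl) (simp add: elim(1) inner_prod_def real_sqrt_mult sqrt_exp)
      then show ?case
        using wiener_sum_tendsto[OF elim(2) T, of c] by (auto intro: tendsto_mult_left)
    qed
  qed
  then have "AE \<omega> in M. J \<omega> = sqrt (1 - \<rho>\<^sup>2) * sqrt (snd (Z 0 \<omega>)) * ?G \<omega>"
    by (rule conv_prob_unique[OF J(1)])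
  with J(2) cont V_grid
  show "AE \<omega> in M. fst (Z T \<omega>) = fst (Z 0 \<omega>) + r * T - snd (Z 0 \<omega>) / 2 * integral {0..T} (\<lambda>s. exp (c * s))
      + sqrt (1 - \<rho>\<^sup>2) * sqrt (snd (Z 0 \<omega>)) * ?G \<omega>"
  proof eventually_elim
    case (elim \<omega>)
    have Vc: "continuous_on {0..T} (\<lambda>s. snd (Z s \<omega>))" using elim(2) by (intro continuous_on_snd)
    \<comment> \<open>The integral of the variance is recovered from its grid values, the times at
      which the formula holds outside the common null set.\<close>
    have l1: "(\<lambda>n. T / real n * (\<Sum>i<n. snd (Z (grid T n i) \<omega>))) \<longlonglongrightarrow> integral {0..T} (\<lambda>s. snd (Z s \<omega>))"
      by (rule riemann_mean_tendsto[OF Vc T])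
    have eq: "T / real n * (\<Sum>i<n. snd (Z (grid T n i) \<omega>))
        = T / real n * (\<Sum>i<n. exp (c * grid T n i)) * snd (Z 0 \<omega>)" for n
      using elim(3) by (simp add: sum_distrib_right)
    have l2: "(\<lambda>n. T / real n * (\<Sum>i<n. exp (c * grid T n i)) * snd (Z 0 \<omega>))
        \<longlonglongrightarrow> integral {0..T} (\<lambda>s. exp (c * s)) * snd (Z 0 \<omega>)"
      by (intro tendsto_mult_right riemann_mean_tendsto exp_cont T)
    have "integral {0..T} (\<lambda>s. snd (Z s \<omega>)) = integral {0..T} (\<lambda>s. exp (c * s)) * snd (Z 0 \<omega>)"
      by (rule LIMSEQ_unique[OF l1[unfolded eq] l2])
    moreover have "integral {0..T} (\<lambda>s. r - snd (Z s \<omega>) / 2) = r * T - integral {0..T} (\<lambda>s. snd (Z s \<omega>)) / 2"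
      using T by (subst Henstock_Kurzweil_Integration.integral_diff)
        (auto intro!: integrable_continuous_real continuous_on_divide Vc)
    ultimately show ?case using elim by (simp add: inner_prod_def)
  qed
qed

end

section \<open>The law of one Strang step\<close>

text \<open>Tonelli in monadic form: it turns a function of independent variables into successive
  sampling, the shape of the claimed law.\<close>

lemma distr_pair_eq_bind:
  assumes "prob_space N1" "prob_space N2" and f: "f \<in> measurable (N1 \<Otimes>\<^sub>M N2) L"
  shows "distr (N1 \<Otimes>\<^sub>M N2) L f = N1 \<bind> (\<lambda>x. distr N2 L (\<lambda>y. f (x, y)))"
proof -
  interpret N1: prob_space N1 by fact
  interpret N2: prob_space N2 by fact
  have fx: "(\<lambda>y. f (x, y)) \<in> measurable N2 L" if "x \<in> space N1" for x
    by (rule measurable_compose[OF measurable_Pair1'[OF that] f])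
  have "N2 \<in> space (subprob_algebra N2)"
    by (simp add: space_subprob_algebra N2.subprob_space_axioms)
  then have K: "(\<lambda>x. distr N2 L (\<lambda>y. f (x, y))) \<in> measurable N1 (subprob_algebra L)"
    using f by (intro measurable_distr2) (auto simp: case_prod_beta')
  show ?thesis
  proof (rule measure_eqI)
    show sets: "sets (distr (N1 \<Otimes>\<^sub>M N2) L f) = sets (N1 \<bind> (\<lambda>x. distr N2 L (\<lambda>y. f (x, y))))"
      by (subst sets_bind[OF sets_kernel[OF K]]) (auto simp: N1.not_empty)
    fix A assume "A \<in> sets (distr (N1 \<Otimes>\<^sub>M N2) L f)"
    then have A: "A \<in> sets L" by simp
    have "emeasure (distr (N1 \<Otimes>\<^sub>M N2) L f) A
        = (\<integral>\<^sup>+x. emeasure N2 (Pair x -` (f -` A \<inter> space (N1 \<Otimes>\<^sub>M N2))) \<partial>N1)"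
      using f A by (simp add: emeasure_distr N2.emeasure_pair_measure_alt)
    also have "\<dots> = (\<integral>\<^sup>+x. emeasure (distr N2 L (\<lambda>y. f (x, y))) A \<partial>N1)"
    proof (rule nn_integral_cong)
      fix x assume x: "x \<in> space N1"
      have "Pair x -` (f -` A \<inter> space (N1 \<Otimes>\<^sub>M N2)) = (\<lambda>y. f (x, y)) -` A \<inter> space N2"
        using x by (auto simp: space_pair_measure)
      then show "emeasure N2 (Pair x -` (f -` A \<inter> space (N1 \<Otimes>\<^sub>M N2))) = emeasure (distr N2 L (\<lambda>y. f (x, y))) A"
        using emeasure_distr[OF fx[OF x] A] by simp
    qed
    also have "\<dots> = emeasure (N1 \<bind> (\<lambda>x. distr N2 L (\<lambda>y. f (x, y)))) A"
      using emeasure_bind[OF N1.not_empty K A] by simp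
    finally show "emeasure (distr (N1 \<Otimes>\<^sub>M N2) L f) A = emeasure (N1 \<bind> (\<lambda>x. distr N2 L (\<lambda>y. f (x, y)))) A" .
  qed
qed

text \<open>Characteristic functions treat vanishing variances or coefficients, where densities are
  missing, together with the regular case.\<close>

lemma normal_law_linear_combination:
  "distr (normal_law 0 s \<Otimes>\<^sub>M normal_law 0 s) borel (\<lambda>p. \<alpha> * fst p + \<beta> * snd p)
    = normal_law 0 ((\<alpha>\<^sup>2 + \<beta>\<^sup>2) * s)"
proof (rule Levy_uniqueness)
  interpret P: prob_space "normal_law 0 s" by (rule prob_space_normal_law)
  interpret PP: pair_prob_space "normal_law 0 s" "normal_law 0 s" ..
  let ?P = "normal_law 0 s \<Otimes>\<^sub>M normal_law 0 s"
  have m: "(\<lambda>p. \<alpha> * fst p + \<beta> * snd p) \<in> borel_measurable ?P" by measurable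
  show "real_distribution (distr ?P borel (\<lambda>p. \<alpha> * fst p + \<beta> * snd p))"
    using m by (rule PP.real_distribution_distr)
  show "real_distribution (normal_law 0 ((\<alpha>\<^sup>2 + \<beta>\<^sup>2) * s))" by (rule real_distribution_normal_law)
  show "char (distr ?P borel (\<lambda>p. \<alpha> * fst p + \<beta> * snd p)) = char (normal_law 0 ((\<alpha>\<^sup>2 + \<beta>\<^sup>2) * s))"
  proof
    fix \<theta>
    let ?e = "\<lambda>p. iexp (\<theta> * \<alpha> * fst p) * iexp (\<theta> * \<beta> * snd p)"
    have int: "integrable ?P ?e"
      by (rule PP.integrable_const_bound[where B = 1]) (auto simp: norm_mult)
    have "char (distr ?P borel (\<lambda>p. \<alpha> * fst p + \<beta> * snd p)) \<theta> = (\<integral>p. ?e p \<partial>?P)"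
      using m by (simp add: char_def integral_distr exp_add[symmetric] algebra_simps)
    also have "\<dots> = (\<integral>x. (\<integral>y. iexp (\<theta> * \<alpha> * x) * iexp (\<theta> * \<beta> * y) \<partial>normal_law 0 s) \<partial>normal_law 0 s)"
      using PP.integral_fst'[OF int] by simp
    also have "\<dots> = char (normal_law 0 s) (\<theta> * \<alpha>) * char (normal_law 0 s) (\<theta> * \<beta>)"
      by (simp add: char_def)
    also have "\<dots> = char (normal_law 0 ((\<alpha>\<^sup>2 + \<beta>\<^sup>2) * s)) \<theta>"
      unfolding char_normal_law exp_add[symmetric] of_real_minus[symmetric] of_real_add[symmetric]
    proof (rule arg_cong[where f = "\<lambda>x. exp (complex_of_real x)"])
      have "\<bar>(\<alpha>\<^sup>2 + \<beta>\<^sup>2) * s\<bar> = (\<alpha>\<^sup>2 + \<beta>\<^sup>2) * \<bar>s\<bar>" by (simp add: abs_mult)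
      then show "- (\<bar>s\<bar> * (\<theta> * \<alpha>)\<^sup>2 / 2) + - (\<bar>s\<bar> * (\<theta> * \<beta>)\<^sup>2 / 2) = - (\<bar>(\<alpha>\<^sup>2 + \<beta>\<^sup>2) * s\<bar> * \<theta>\<^sup>2 / 2)"
        by (simp only: power_mult_distrib) (simp add: field_simps)
    qed
    finally show "char (distr ?P borel (\<lambda>p. \<alpha> * fst p + \<beta> * snd p)) \<theta> = char (normal_law 0 ((\<alpha>\<^sup>2 + \<beta>\<^sup>2) * s)) \<theta>" .
  qed
qed

text \<open>Independence is applied to the groups {1} and {0, 2}, then to {0} and {2}. The variable
  with index 1 comes first because the law is later mixed over it.\<close>

lemma (in prob_space) indep_vars_3_joint_law:
  fixes X :: "nat \<Rightarrow> 'a \<Rightarrow> real"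
  assumes ind: "indep_vars (\<lambda>_. borel) X {0, 1, 2}"
  shows "distr M (borel \<Otimes>\<^sub>M (borel \<Otimes>\<^sub>M borel)) (\<lambda>\<omega>. (X 1 \<omega>, X 0 \<omega>, X 2 \<omega>))
    = distr M borel (X 1) \<Otimes>\<^sub>M (distr M borel (X 0) \<Otimes>\<^sub>M distr M borel (X 2))"
proof -
  have proj: "(\<lambda>f. f i) \<in> borel_measurable (PiM A (\<lambda>_. borel :: real measure))" if "i \<in> A" for i :: nat and A
    using that by (rule measurable_component_singleton)
  have "indep_var (PiM {0} (\<lambda>_. borel)) (\<lambda>\<omega>. restrict (\<lambda>i. X i \<omega>) {0})
      (PiM {2} (\<lambda>_. borel)) (\<lambda>\<omega>. restrict (\<lambda>i. X i \<omega>) {2})"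
    by (rule indep_var_restrict[OF ind]) auto
  from indep_var_compose[OF this proj[of 0] proj[of 2]]
  have 02: "indep_var borel (X 0) borel (X 2)" by (simp add: comp_def)
  let ?R = "\<lambda>A \<omega>. restrict (\<lambda>i. X i \<omega>) A"
  let ?D = "\<lambda>A. distr M (PiM A (\<lambda>_. borel)) (?R A)"
  have 1: "indep_var (PiM {1} (\<lambda>_. borel)) (?R {1}) (PiM {0, 2} (\<lambda>_. borel)) (?R {0, 2})"
    by (rule indep_var_restrict[OF ind]) auto
  have R: "?R {1} \<in> measurable M (PiM {1} (\<lambda>_. borel))" "?R {0, 2} \<in> measurable M (PiM {0, 2} (\<lambda>_. borel))"
    and prod: "?D {1} \<Otimes>\<^sub>M ?D {0, 2}
      = distr M (PiM {1} (\<lambda>_. borel) \<Otimes>\<^sub>M PiM {0, 2} (\<lambda>_. borel)) (\<lambda>\<omega>. (?R {1} \<omega>, ?R {0, 2} \<omega>))"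
    using 1 by (simp_all add: indep_var_distribution_eq)
  let ?p = "\<lambda>f::nat \<Rightarrow> real. f 1" and ?q = "\<lambda>g::nat \<Rightarrow> real. (g 0, g 2)"
  have p: "?p \<in> measurable (PiM {1} (\<lambda>_. borel)) borel" by (rule proj) simp
  have q: "?q \<in> measurable (PiM {0, 2} (\<lambda>_. borel)) (borel \<Otimes>\<^sub>M borel)"
    by (intro measurable_Pair proj) simp_all
  have "distr M borel (X 1) \<Otimes>\<^sub>M (distr M borel (X 0) \<Otimes>\<^sub>M distr M borel (X 2))
      = distr M borel (X 1) \<Otimes>\<^sub>M distr M (borel \<Otimes>\<^sub>M borel) (\<lambda>\<omega>. (X 0 \<omega>, X 2 \<omega>))"
    using 02 by (simp add: indep_var_distribution_eq)
  also have "\<dots> = distr (?D {1}) borel ?p \<Otimes>\<^sub>M distr (?D {0, 2}) (borel \<Otimes>\<^sub>M borel) ?q"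
    by (simp add: distr_distr[OF p R(1)] distr_distr[OF q R(2)] comp_def del: One_nat_def)
  also have "\<dots> = distr (?D {1} \<Otimes>\<^sub>M ?D {0, 2}) (borel \<Otimes>\<^sub>M (borel \<Otimes>\<^sub>M borel)) (\<lambda>(f, g). (?p f, ?q g))"
  proof (rule pair_measure_distr)
    have "prob_space (distr (?D {0, 2}) (borel \<Otimes>\<^sub>M borel) ?q)"
      using q by (intro prob_space.prob_space_distr prob_space_distr R) simp
    then show "sigma_finite_measure (distr (?D {0, 2}) (borel \<Otimes>\<^sub>M borel) ?q)"
      by (rule prob_space_imp_sigma_finite)
  qed (use p q in simp_all)
  also have "\<dots> = distr M (borel \<Otimes>\<^sub>M (borel \<Otimes>\<^sub>M borel)) (\<lambda>\<omega>. (X 1 \<omega>, X 0 \<omega>, X 2 \<omega>))"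
    unfolding prod
  proof (subst distr_distr)
    show "(\<lambda>\<omega>. (?R {1} \<omega>, ?R {0, 2} \<omega>)) \<in> measurable M (PiM {1} (\<lambda>_. borel) \<Otimes>\<^sub>M PiM {0, 2} (\<lambda>_. borel))"
      by (intro measurable_Pair R)
    show "(\<lambda>(f, g). (?p f, ?q g)) \<in> measurable (PiM {1} (\<lambda>_. borel) \<Otimes>\<^sub>M PiM {0, 2} (\<lambda>_. borel)) (borel \<Otimes>\<^sub>M (borel \<Otimes>\<^sub>M borel))"
      unfolding case_prod_beta'
      by (intro measurable_Pair measurable_compose[OF measurable_fst p] measurable_compose[OF measurable_snd proj]) simp_all
  qed (simp add: comp_def)
  finally show ?thesis by simp
qed

lemma sde_solution_brownian: "sde_solution M F W T S Z \<Longrightarrow> brownian M F W"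
  by (cases S) (simp add: brownian_def)

text \<open>Mixing over the law of \<open>B\<^sub>h\<close>, the Wiener integrals of the two half steps add up to a normal
  variable with the variance stated in the scheme.\<close>

lemma strang_law_eq:
  fixes X r h \<xi> \<rho> V1 v0 A e :: real
  defines "f \<equiv> \<lambda>d. V1 * exp (- (\<xi>\<^sup>2 / 4) * h + \<xi> * d)"
  assumes \<rho>: "\<rho>\<^sup>2 \<le> 1" and pos: "0 \<le> v0" "0 \<le> V1"
    and I: "I \<in> borel_measurable borel" "\<And>v. I v = (v0 + v) * A"
  shows "distr (normal_law 0 h \<Otimes>\<^sub>M (normal_law 0 A \<Otimes>\<^sub>M normal_law 0 A)) borel
      (\<lambda>p. (X + r * h - 1 / 2 * I (f (fst p)) + 2 * \<rho> / \<xi> * (sqrt (f (fst p)) - sqrt V1)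
        + (sqrt (1 - \<rho>\<^sup>2) * sqrt v0 * fst (snd p) + sqrt (1 - \<rho>\<^sup>2) * sqrt (f (fst p)) * snd (snd p)),
        e * f (fst p)))
    = do {
        V2 \<leftarrow> distr (normal_law 0 h) borel f;
        N \<leftarrow> normal_law 0 ((1 - \<rho>\<^sup>2) * I V2);
        return borel (X + r * h - 1 / 2 * I V2 + 2 * \<rho> / \<xi> * (sqrt V2 - sqrt V1) + N, e * V2)
      }"
    (is "distr (?H \<Otimes>\<^sub>M ?P) borel ?\<Psi> = _ \<bind> ?K")
proof -
  note [measurable] = I(1)
  have [measurable]: "f \<in> borel_measurable borel" unfolding f_def by measurable
  have pP: "prob_space ?P"
    by (intro prob_space_pair prob_space_normal_law)
  have K: "?K v = distr (normal_law 0 ((1 - \<rho>\<^sup>2) * I v)) borel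
      (\<lambda>N. (X + r * h - 1 / 2 * I v + 2 * \<rho> / \<xi> * (sqrt v - sqrt V1) + N, e * v))" for v
    by (rule bind_return_distr') auto
  \<comment> \<open>With the standard normal law as common source, the kernel is the image of one
    fixed measure under a map jointly measurable in \<open>v\<close> and \<open>z\<close>, which
    yields its measurability in \<open>v\<close>.\<close>
  have K': "?K v = distr (normal_law 0 1) borel
      (\<lambda>z. (X + r * h - 1 / 2 * I v + 2 * \<rho> / \<xi> * (sqrt v - sqrt V1) + sqrt \<bar>(1 - \<rho>\<^sup>2) * I v\<bar> * z, e * v))" for v
    unfolding K unfolding normal_law_eq_distr[of "(1 - \<rho>\<^sup>2) * I v"] by (subst distr_distr) (auto simp: comp_def)
  have "normal_law 0 1 \<in> space (subprob_algebra borel)"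
    using prob_space_imp_subprob_space[OF prob_space_std_normal] by (simp add: space_subprob_algebra)
  then have Km: "?K \<in> measurable borel (subprob_algebra borel)"
    unfolding K' by (intro measurable_distr2[where M = borel]) auto
  have "distr ?H borel f \<bind> ?K = ?H \<bind> (\<lambda>d. ?K (f d))"
    by (rule bind_distr[OF _ Km]) auto
  also have "\<dots> = ?H \<bind> (\<lambda>d. distr ?P borel (\<lambda>y. ?\<Psi> (d, y)))"
  proof (intro bind_cong refl)
    fix d
    have fd: "0 \<le> f d" using pos by (simp add: f_def)
    \<comment> \<open>Since \<open>I v = (v0 + v) * A\<close>, the required variance is the sum of
      the squared coefficients of the two Wiener integrals, times \<open>A\<close>.\<close>
    have "normal_law 0 ((1 - \<rho>\<^sup>2) * I (f d)) = normal_law 0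
       (((sqrt (1 - \<rho>\<^sup>2) * sqrt v0)\<^sup>2 + (sqrt (1 - \<rho>\<^sup>2) * sqrt (f d))\<^sup>2) * A)"
      using \<rho> pos fd by (simp add: I(2) power_mult_distrib algebra_simps)
    also have "\<dots> = distr ?P borel (\<lambda>p. sqrt (1 - \<rho>\<^sup>2) * sqrt v0 * fst p + sqrt (1 - \<rho>\<^sup>2) * sqrt (f d) * snd p)"
      by (rule normal_law_linear_combination[symmetric])
    finally show "?K (f d) = distr ?P borel (\<lambda>y. ?\<Psi> (d, y))"
      unfolding K by (simp only:) (subst distr_distr, auto simp: comp_def)
  qed
  also have "\<dots> = distr (?H \<Otimes>\<^sub>M ?P) borel ?\<Psi>"
    by (rule distr_pair_eq_bind[symmetric, OF prob_space_normal_law pP]) measurable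
  finally show ?thesis by simp
qed

theorem proposition3:
  fixes M :: "'a measure" and X_split V_split :: "'a \<Rightarrow> real"
    and \<mu> r \<xi> \<rho> h X\<^sub>t V\<^sub>t :: real
  assumes "\<xi> > 0" and "\<rho> \<in> {-1..1}" and "h > 0" and "V\<^sub>t > 0"
    and "strang_step M h (hw_system1 \<mu> r \<xi> \<rho>) (hw_system2 \<xi> \<rho>) (X\<^sub>t, V\<^sub>t)
           (\<lambda>\<omega>. (X_split \<omega>, V_split \<omega>))"
  shows
    "let c = \<mu> - \<xi>\<^sup>2 / 4;
         V1 = exp (c * h / 2) * V\<^sub>t;
         I = (\<lambda>V2. if c \<noteq> 0 then (V\<^sub>t + V2) / c * (exp (c * h / 2) - 1) else (V\<^sub>t + V2) * h / 2)
     in distr M borel (\<lambda>\<omega>. (X_split \<omega>, V_split \<omega>)) =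
        do {
          V2 \<leftarrow> distr (normal_law 0 h) borel (\<lambda>\<Delta>W. V1 * exp (- (\<xi>\<^sup>2 / 4) * h + \<xi> * \<Delta>W));
          N \<leftarrow> normal_law 0 ((1 - \<rho>\<^sup>2) * I V2);
          return borel
            (X\<^sub>t + r * h - 1 / 2 * I V2 + 2 * \<rho> / \<xi> * (sqrt V2 - sqrt V1) + N,
             exp (c * h / 2) * V2)
        }"
proof -
  define c where "c = \<mu> - \<xi>\<^sup>2 / 4"
  define V1 where "V1 = exp (c * h / 2) * V\<^sub>t"
  define I where "I = (\<lambda>V2. if c \<noteq> 0 then (V\<^sub>t + V2) / c * (exp (c * h / 2) - 1) else (V\<^sub>t + V2) * h / 2)"
  \<comment> \<open>Both cases of the stated integral are (V_t + V2) times this number: each half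
    step integrates e^(cs) over [0, h/2], from initial variance V_t and V2 respectively.\<close>
  define A where "A = integral {0..h / 2} (\<lambda>s. exp (c * s))"
  define f where "f = (\<lambda>d. V1 * exp (- (\<xi>\<^sup>2 / 4) * h + \<xi> * d))"
  obtain F :: "nat \<Rightarrow> real \<Rightarrow> 'a measure" and B :: "nat \<Rightarrow> real \<Rightarrow> 'a \<Rightarrow> real"
      and Z :: "nat \<Rightarrow> real \<Rightarrow> 'a \<Rightarrow> real \<times> real" where
      indep: "prob_space.indep_vars M (\<lambda>_. \<Pi>\<^sub>M t\<in>{0::real..}. (borel :: real measure))
          (\<lambda>k \<omega>. \<lambda>t\<in>{0..}. B k t \<omega>) {0, 1, 2::nat}"
    and S0: "sde_solution M (F 0) (B 0) (h / 2) (hw_system1 \<mu> r \<xi> \<rho>) (Z 0)"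
    and S1: "sde_solution M (F 1) (B 1) h (hw_system2 \<xi> \<rho>) (Z 1)"
    and S2: "sde_solution M (F 2) (B 2) (h / 2) (hw_system1 \<mu> r \<xi> \<rho>) (Z 2)"
    and Z00: "AE \<omega> in M. Z 0 0 \<omega> = (X\<^sub>t, V\<^sub>t)"
    and Z10: "AE \<omega> in M. Z 1 0 \<omega> = Z 0 (h / 2) \<omega>"
    and Z20: "AE \<omega> in M. Z 2 0 \<omega> = Z 1 h \<omega>"
    and R: "(\<lambda>\<omega>. (X_split \<omega>, V_split \<omega>)) = Z 2 (h / 2)"
    using assms(5) unfolding strang_step_def by blast
  interpret B0: brownian M "F 0" "B 0" using S0 by (rule sde_solution_brownian)
  interpret B1: brownian M "F 1" "B 1" using S1 by (rule sde_solution_brownian)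
  interpret B2: brownian M "F 2" "B 2" using S2 by (rule sde_solution_brownian)
  have h: "0 \<le> h" "0 \<le> h / 2" using assms(3) by auto
  have I_eq: "I v = (V\<^sub>t + v) * A" for v
    using integral_exp_linear[OF h(2), of c] by (simp add: I_def A_def)
  let ?G = "\<lambda>k \<omega>. wiener_integral c (h / 2) (\<lambda>t. B k t \<omega>)"
  \<comment> \<open>The functionals through which the three paths enter the result. The increment is
    taken instead of the value at \<open>h\<close> because the path starts at 0 only almost
    surely.\<close>
  define Y where "Y = (\<lambda>k::nat. if k = 1 then (\<lambda>w. w h - w 0) else wiener_integral c (h / 2))"
  define X where "X = (\<lambda>k \<omega>. Y k (\<lambda>t\<in>{0..}. B k t \<omega>))"
  have X: "X 1 \<omega> = B 1 h \<omega> - B 1 0 \<omega>" "X 0 \<omega> = ?G 0 \<omega>" "X 2 \<omega> = ?G 2 \<omega>" for \<omega>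
    using h by (simp_all add: X_def Y_def cong: wiener_integral_cong)
  have "B0.indep_vars (\<lambda>_. borel) (\<lambda>k. Y k \<circ> (\<lambda>\<omega>. \<lambda>t\<in>{0..}. B k t \<omega>)) {0, 1, 2}"
    using indep
  proof (rule B0.indep_vars_compose)
    show "Y k \<in> borel_measurable (\<Pi>\<^sub>M t\<in>{0::real..}. (borel :: real measure))" if "k \<in> {0, 1, 2}" for k
      unfolding Y_def using wiener_integral_measurable[OF h(2)] h
      by (auto intro!: borel_measurable_diff measurable_component_singleton)
  qed
  then have "B0.indep_vars (\<lambda>_. borel) X {0, 1, 2}" by (simp add: X_def comp_def)
  from B0.indep_vars_3_joint_law[OF this]
  have joint: "distr M (borel \<Otimes>\<^sub>M (borel \<Otimes>\<^sub>M borel)) (\<lambda>\<omega>. (X 1 \<omega>, X 0 \<omega>, X 2 \<omega>))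
      = normal_law 0 h \<Otimes>\<^sub>M (normal_law 0 A \<Otimes>\<^sub>M normal_law 0 A)"
  proof -
    have "X 1 = (\<lambda>\<omega>. B 1 h \<omega> - B 1 0 \<omega>)" "X 0 = ?G 0" "X 2 = ?G 2" by (rule ext, rule X)+
    then show ?thesis
      using \<open>distr M _ (\<lambda>\<omega>. (X 1 \<omega>, X 0 \<omega>, X 2 \<omega>)) = _\<close>
        B1.increment_law[of 0 h] B0.wiener_integral_law[OF h(2), of c] B2.wiener_integral_law[OF h(2), of c] h(1)
      by (simp add: A_def del: One_nat_def)
  qed
  have Xm: "X k \<in> borel_measurable M" if "k \<in> {0, 1, 2}" for k
    using \<open>B0.indep_vars (\<lambda>_. borel) X {0, 1, 2}\<close> that by (auto simp: B0.indep_vars_def)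
  let ?\<Psi> = "\<lambda>p. (X\<^sub>t + r * h - 1 / 2 * I (f (fst p)) + 2 * \<rho> / \<xi> * (sqrt (f (fst p)) - sqrt V1)
        + (sqrt (1 - \<rho>\<^sup>2) * sqrt V\<^sub>t * fst (snd p) + sqrt (1 - \<rho>\<^sup>2) * sqrt (f (fst p)) * snd (snd p)),
        exp (c * h / 2) * f (fst p))"
  \<comment> \<open>The scheme starts at a fixed state and system (1) has no noise in the variance,
    so system (2) starts from the constant variance \<open>V1\<close>.\<close>
  have Vhalf: "AE \<omega> in M. snd (Z 1 0 \<omega>) = V1"
    using B0.hw_system1_solution(1)[OF S0 h(2) c_def] Z00 Z10
    by eventually_elim (simp add: V1_def)
  \<comment> \<open>Composition of the three explicit solutions: each half step contributes r h/2
    and minus half its initial variance times \<open>A\<close>, which add up to r h and minus half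
    of \<open>I\<close>.\<close>
  have ae: "AE \<omega> in M. Z 2 (h / 2) \<omega> = ?\<Psi> (X 1 \<omega>, X 0 \<omega>, X 2 \<omega>)"
    using B0.hw_system1_solution(2)[OF S0 h(2) c_def] Z00 Z10
      B1.hw_system2_solution[OF S1 h(1) assms(1) Vhalf] B1.W_0 Z20
      B2.hw_system1_solution[OF S2 h(2) c_def]
  proof eventually_elim
    case (elim \<omega>)
    have d: "X 1 \<omega> = B 1 h \<omega>" using elim X(1)[of \<omega>] by (simp del: One_nat_def)
    have v: "snd (Z 1 h \<omega>) = f (X 1 \<omega>)" using elim by (simp add: f_def d del: One_nat_def)
    have "fst (Z 0 (h / 2) \<omega>) = X\<^sub>t + r * (h / 2) - V\<^sub>t / 2 * A + sqrt (1 - \<rho>\<^sup>2) * sqrt V\<^sub>t * X 0 \<omega>"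
      using elim by (simp add: X(2) A_def)
    moreover have "fst (Z 1 h \<omega>) = fst (Z 0 (h / 2) \<omega>) + 2 * \<rho> / \<xi> * (sqrt (f (X 1 \<omega>)) - sqrt V1)"
      using elim v by (simp del: One_nat_def)
    moreover have "fst (Z 2 (h / 2) \<omega>) = fst (Z 1 h \<omega>) + r * (h / 2) - f (X 1 \<omega>) / 2 * A
        + sqrt (1 - \<rho>\<^sup>2) * sqrt (f (X 1 \<omega>)) * X 2 \<omega>"
      using elim v by (simp add: X(3) A_def del: One_nat_def)
    ultimately have "fst (Z 2 (h / 2) \<omega>) = fst (?\<Psi> (X 1 \<omega>, X 0 \<omega>, X 2 \<omega>))"
      by (simp only: I_eq fst_conv snd_conv) (simp add: field_simps del: One_nat_def)
    moreover have "snd (Z 2 (h / 2) \<omega>) = exp (c * h / 2) * f (X 1 \<omega>)"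
      using elim v by (simp del: One_nat_def)
    ultimately show ?case by (simp add: prod_eq_iff del: One_nat_def)
  qed
  have m: "(\<lambda>\<omega>. (X 1 \<omega>, X 0 \<omega>, X 2 \<omega>)) \<in> measurable M (borel \<Otimes>\<^sub>M (borel \<Otimes>\<^sub>M borel))"
    using Xm by (intro measurable_Pair) auto
  have Im: "I \<in> borel_measurable borel"
    unfolding I_eq[abs_def] by measurable
  have \<Psi>m: "?\<Psi> \<in> borel_measurable (borel \<Otimes>\<^sub>M (borel \<Otimes>\<^sub>M borel))"
    using Im unfolding f_def by measurable
  have Zm: "Z 2 (h / 2) \<in> borel_measurable M"
    using S2 h by (intro B2.measurable_F[of _ "h / 2"]) (simp add: hw_system1_def)
  have "distr M borel (Z 2 (h / 2)) = distr M borel (\<lambda>\<omega>. ?\<Psi> (X 1 \<omega>, X 0 \<omega>, X 2 \<omega>))"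
    by (intro distr_cong_AE refl ae Zm measurable_compose[OF m \<Psi>m])
  also have "\<dots> = distr (distr M (borel \<Otimes>\<^sub>M (borel \<Otimes>\<^sub>M borel)) (\<lambda>\<omega>. (X 1 \<omega>, X 0 \<omega>, X 2 \<omega>))) borel ?\<Psi>"
    by (subst distr_distr[OF \<Psi>m m]) (simp add: comp_def)
  also have "\<dots> = do {
          V2 \<leftarrow> distr (normal_law 0 h) borel (\<lambda>\<Delta>W. V1 * exp (- (\<xi>\<^sup>2 / 4) * h + \<xi> * \<Delta>W));
          N \<leftarrow> normal_law 0 ((1 - \<rho>\<^sup>2) * I V2);
          return borel
            (X\<^sub>t + r * h - 1 / 2 * I V2 + 2 * \<rho> / \<xi> * (sqrt V2 - sqrt V1) + N,
             exp (c * h / 2) * V2)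
        }"
    unfolding joint f_def
    by (rule strang_law_eq) (use assms(2,4) Im I_eq in \<open>auto simp: V1_def abs_square_le_1\<close>)
  finally show ?thesis
    unfolding Let_def R[symmetric] V1_def I_def c_def by simp
qed

end
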